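(* Let $\nu>0$ and let $t\in\mathbb{C}$ with $\Re t>0$. Then $$\int_{-\infty}^{\infty}x\,e^{\nu x-t\cosh x}\,dx=\nu\left[\frac{K_{\nu}(t)}{\sqrt{\pi}}\,G_{2,4}^{3,1}\left(t^{2}\left|\begin{array}{c}1/2,\,1\\ 0,\,0,\,\nu,\,-\nu\end{array}\right.\right)-\sqrt{\pi}\,I_{\nu}(t)\,G_{2,4}^{4,0}\left(t^{2}\left|\begin{array}{c}1/2,\,1\\ 0,\,0,\,\nu,\,-\nu\end{array}\right.\right)\right].$$
   Context: $I_\nu(t)=\left(\frac t2\right)^{\nu}\sum_{k=0}^{\infty}\frac{(t/2)^{2k}}{k!\,\Gamma(\nu+k+1)}$ is the modified Bessel function of the first kind (principal branch of the power), and $K_\nu(t)=\frac{\pi}{2}\frac{I_{-\nu}(t)-I_\nu(t)}{\sin\pi\nu}$ for $\nu\notin\mathbb{Z}$ (extended to integer $\nu$ by taking the limit in $\nu$) is the Macdonald function. The Meijer $G$-function is $$G^{m,n}_{p,q}\left(z\left|\begin{array}{c} a_1,\dots,a_p \\ {b_1},\dots,b_q \end{array}\right.\right)=\frac{1}{2\pi i}\int_L\frac{\prod_{j=1}^m\Gamma(b_j-s)\prod_{j=1}^n\Gamma(1-a_j+s)}{\prod_{j=m+1}^{q}\Gamma(1-b_j+s)\prod_{j=n+1}^{p}\Gamma(a_j-s)}\,z^s\,ds,$$ where the contour $L$ goes from $-i\infty$ to $i\infty$ and separates the poles of the $\Gamma(b_j-s)$, $1\le j\le m$ (to the right of $L$),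 from those of the $\Gamma(1-a_j+s)$, $1\le j\le n$ (to the left of $L$); $z^s$ is the principal branch. *)

theory Defs
  imports "HOL-Complex_Analysis.Complex_Analysis"
begin

text \<open>The library puts \<open>Gamma z = 0\<close> at the poles, and \<open>x / 0 = 0\<close>. So a Gamma factor in a denominator
  contributes the conventional value \<open>1 / \<Gamma> = 0\<close> at its poles, here and in the Meijer integrand.\<close>

definition bessel_I :: "complex \<Rightarrow> complex \<Rightarrow> complex" where
  "bessel_I \<nu> t =
     (t / 2) powr \<nu> * (\<Sum>k. (t / 2) ^ (2 * k) / (fact k * Gamma (\<nu> + of_nat k + 1)))"

definition macdonald_K_nonint :: "complex \<Rightarrow> complex \<Rightarrow> complex" where
  "macdonald_K_nonint \<nu> t =
     of_real pi / 2 * ((bessel_I (- \<nu>) t - bessel_I \<nu> t) / sin (of_real pi * \<nu>))"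

definition macdonald_K :: "complex \<Rightarrow> complex \<Rightarrow> complex" where
  "macdonald_K \<nu> t =
     (if \<nu> \<in> \<int> then Lim (at \<nu>) (\<lambda>\<mu>. macdonald_K_nonint \<mu> t) else macdonald_K_nonint \<nu> t)"

text \<open>Contours from \<open>-\<i>\<infinity>\<close> to \<open>\<i>\<infinity>\<close>: piecewise continuously differentiable curves, parametrised
  by the whole real line, that stay in some vertical strip.\<close>

definition vertical_contour :: "(real \<Rightarrow> complex) \<Rightarrow> bool" where
  "vertical_contour L \<longleftrightarrow>
     (\<forall>a b. valid_path (subpath a b L)) \<and>
     bounded (range (\<lambda>y. Re (L y))) \<and>
     filterlim (\<lambda>y. Im (L y)) at_top at_top \<and>
     filterlim (\<lambda>y. Im (L y)) at_bot at_bot"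

text \<open>The points to the right (left) of \<open>L\<close> are those in the component of the complement of \<open>L\<close>
  that contains all real numbers close enough to \<open>\<infinity>\<close> (\<open>-\<infinity>\<close>). A contour need not be a graph over
  the imaginary axis, because a separating one may have to wind between the poles.\<close>

definition right_of :: "(real \<Rightarrow> complex) \<Rightarrow> complex set" where
  "right_of L = {w. \<forall>\<^sub>F x in at_top. connected_component (- range L) w (complex_of_real x)}"

definition left_of :: "(real \<Rightarrow> complex) \<Rightarrow> complex set" where
  "left_of L = {w. \<forall>\<^sub>F x in at_bot. connected_component (- range L) w (complex_of_real x)}"

definition has_line_integral ::
    "(complex \<Rightarrow> complex) \<Rightarrow> complex \<Rightarrow> (real \<Rightarrow> complex) \<Rightarrow> bool" where
  "has_line_integral f v L \<longleftrightarrow>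
     (\<forall>a b. f contour_integrable_on subpath a b L) \<and>
     ((\<lambda>(a, b). contour_integral (subpath a b L) f) \<longlongrightarrow> v) (at_bot \<times>\<^sub>F at_top)"

text \<open>In the following, \<open>as\<close> and \<open>bs\<close> are the lists of the upper and lower parameters, so that
  \<open>p = length as\<close> and \<open>q = length bs\<close>; it is understood that \<open>m \<le> q\<close> and \<open>n \<le> p\<close>. List positions
  start at \<open>0\<close>.\<close>

definition meijer_integrand ::
    "nat \<Rightarrow> nat \<Rightarrow> complex list \<Rightarrow> complex list \<Rightarrow> complex \<Rightarrow> complex \<Rightarrow> complex" where
  "meijer_integrand m n as bs z s =
     ((\<Prod>j<m. Gamma (bs ! j - s)) * (\<Prod>j<n. Gamma (1 - as ! j + s))) /
     ((\<Prod>j=m..<length bs. Gamma (1 - bs ! j + s)) * (\<Prod>j=n..<length as. Gamma (as ! j - s))) *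
     z powr s"

text \<open>\<open>\<Gamma>(b - s)\<close> has its poles at \<open>s = b + k\<close> and \<open>\<Gamma>(1 - a + s)\<close> at \<open>s = a - 1 - k\<close>, for \<open>k \<ge> 0\<close>.\<close>

definition meijer_contour ::
    "nat \<Rightarrow> nat \<Rightarrow> complex list \<Rightarrow> complex list \<Rightarrow> (real \<Rightarrow> complex) \<Rightarrow> bool" where
  "meijer_contour m n as bs L \<longleftrightarrow>
     vertical_contour L \<and>
     (\<forall>j<m. \<forall>k::nat. bs ! j + of_nat k \<in> right_of L) \<and>
     (\<forall>j<n. \<forall>k::nat. as ! j - 1 - of_nat k \<in> left_of L)"

text \<open>By Cauchy's theorem the value does not depend on the admissible contour.\<close>

definition meijer_G ::
    "nat \<Rightarrow> nat \<Rightarrow> complex list \<Rightarrow> complex list \<Rightarrow> complex \<Rightarrow> complex" where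
  "meijer_G m n as bs z =
     (THE v. \<exists>L. meijer_contour m n as bs L \<and>
        has_line_integral (meijer_integrand m n as bs z) (2 * of_real pi * \<i> * v) L)"

end

(* Write D for the integral on the left, I and K for the Bessel functions of index nu, and I', K', D'
   for the same functions of index nu + 1. The recurrences of these functions and the Wronskian relation
   t (I K' + I' K) = 1 give D = K E - I F with E = t (I' D + I D') - 2 I K and F = t (K D' - K' D) - 2 K^2,
   where the derivatives of E and F are -4 nu I K / t and -4 nu K^2 / t. Differentiating the Mellin--Barnes
   integrals of the two Meijer functions under the integral sign removes the quotient
   Gamma(-s) / Gamma(1-s), and the residue series of the remaining integrals are the power series of I K
   and K^2, so that up to a factor E and F have the same derivatives as the Meijer functions. All four
   functions vanish as t tends to infinity along the real axis. The poles are simple only if 2 nu is not an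
   integer; the other cases follow by continuity in nu. *)
theory Submission
  imports Defs
begin

section \<open>The Gamma function in vertical strips\<close>

text \<open>D is 2 dK/dnu, so differentiating the modified Bessel equation in nu gives t^2 D'' + t
  D' - (t^2 + nu^2) D = 4 nu K, where primes mean d/dt here. E and F are -t times the Wronskians of
  D with I and with K, which explains their derivatives; written with index nu + 1 they need
  first-order relations only. The Meijer integrands themselves contain Gamma(-s)^2 / Gamma(1-s) =
  -Gamma(-s) / s with a double pole at s = 0; the factor s produced by t d/dt removes exactly this
  pole. The limits at infinity are obtained without asymptotic expansions: x <= sinh x for x >= 0
  bounds D by 2 nu K / t, and the Wronskian controls the products of the growing I with the decaying
  K. K is defined through I, so its integral representation has to be proved: one of the two
  exponentials in exp(-t cosh x) is replaced by its Mellin-Barnes integral. Finally,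
  \<open>meijer_G\<close> is a definite description over all separating curves, which may wind
  between the poles; a winding number argument reduces it to a straight line.\<close>

lemma norm_rGamma_shift:
  fixes x d y :: real
  assumes "x > 0" "d \<ge> 0"
  shows "norm (rGamma (Complex (x + d) y)) * rGamma x \<le> norm (rGamma (Complex x y)) * rGamma (x + d)"
proof (rule LIMSEQ_le)
  show "(\<lambda>n. norm (rGamma_series (Complex (x + d) y) n) * rGamma_series x n)
          \<longlonglongrightarrow> norm (rGamma (Complex (x + d) y)) * rGamma x"
    by (intro tendsto_intros)
  show "(\<lambda>n. norm (rGamma_series (Complex x y) n) * rGamma_series (x + d) n)
          \<longlonglongrightarrow> norm (rGamma (Complex x y)) * rGamma (x + d)"
    by (intro tendsto_intros)
  \<comment> \<open>The lemma says that Gamma(x) / |Gamma(x + iy)| decreases as x > 0 grows. In the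
    Gauss product this holds factor by factor, because |x + k + iy| / (x + k) = sqrt(1 + y^2 / (x +
    k)^2) decreases in x; in cross-multiplied form it passes to the limit.\<close>
  have factor: "norm (Complex (x + d) y + of_nat k) * (x + k) \<le> norm (Complex x y + of_nat k) * (x + d + k)" for k :: nat
  proof (rule power2_le_imp_le)
    have "((x + d + k)\<^sup>2 + y\<^sup>2) * (x + k)\<^sup>2 \<le> ((x + k)\<^sup>2 + y\<^sup>2) * (x + d + k)\<^sup>2"
    proof -
      have "(x + k)\<^sup>2 \<le> (x + d + k)\<^sup>2" using assms by (intro power_mono) auto
      hence "y\<^sup>2 * (x + k)\<^sup>2 \<le> y\<^sup>2 * (x + d + k)\<^sup>2" by (intro mult_left_mono) auto
      thus ?thesis by (simp add: algebra_simps)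
    qed
    thus "(norm (Complex (x + d) y + of_nat k) * (x + k))\<^sup>2 \<le> (norm (Complex x y + of_nat k) * (x + d + k))\<^sup>2"
      by (simp add: power_mult_distrib cmod_power2)
  qed (use assms in auto)
  have prod: "norm (pochhammer (Complex (x + d) y) n) * pochhammer x n
                \<le> norm (pochhammer (Complex x y) n) * pochhammer (x + d) n" for n
  proof -
    have "(\<Prod>k<n. norm (Complex (x + d) y + of_nat k) * (x + k)) \<le>
          (\<Prod>k<n. norm (Complex x y + of_nat k) * (x + d + k))"
      using factor assms by (intro prod_mono) (auto intro!: mult_nonneg_nonneg)
    thus ?thesis
      by (simp add: pochhammer_prod prod.distrib prod_norm lessThan_atLeast0)
  qed
  have "norm (rGamma_series (Complex (x + d) y) n) * rGamma_series x n
          \<le> norm (rGamma_series (Complex x y) n) * rGamma_series (x + d) n" for n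
  proof -
    let ?c = "fact n * exp (x * ln n) * (fact n * exp ((x + d) * ln n)) :: real"
    have "norm (rGamma_series (Complex (x + d) y) n) * rGamma_series x n =
            norm (pochhammer (Complex (x + d) y) (n+1)) * pochhammer x (n+1) / ?c"
         "norm (rGamma_series (Complex x y) n) * rGamma_series (x + d) n =
            norm (pochhammer (Complex x y) (n+1)) * pochhammer (x + d) (n+1) / ?c"
      by (simp_all add: rGamma_series_def norm_divide norm_mult del: of_nat_Suc)
    thus ?thesis using prod[of "n+1"] by (simp add: divide_right_mono)
  qed
  thus "\<exists>N. \<forall>n\<ge>N. norm (rGamma_series (Complex (x + d) y) n) * rGamma_series x n
          \<le> norm (rGamma_series (Complex x y) n) * rGamma_series (x + d) n" by blast
qed

text \<open>On the line Re z = 1/2 the reflection 1 - z is complex conjugation, so the reflection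
  formula gives the modulus exactly. Every other line is compared with this one, which replaces
  Stirling's formula.\<close>

lemma norm_rGamma_half: "(norm (rGamma (Complex (1/2) y)))\<^sup>2 = cosh (pi * y) / pi"
proof -
  let ?z = "Complex (1/2) y"
  have c: "1 - ?z = cnj ?z" by (simp add: complex_eq_iff)
  have "Gamma ?z * Gamma (cnj ?z) = of_real pi / sin (of_real pi * ?z)"
    using Gamma_reflection_complex[of ?z] unfolding c .
  also have "Gamma ?z * Gamma (cnj ?z) = of_real ((norm (Gamma ?z))\<^sup>2)"
    by (simp only: complex_norm_square cnj_Gamma)
  also have "of_real pi * ?z = of_real (pi/2) + \<i> * of_real (pi * y)"
    by (simp add: complex_eq_iff)
  also have "sin \<dots> = of_real (cosh (pi * y))"
  proof -
    have "sin (of_real (pi/2) + z) = cos z" for z :: complex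
      by (simp only: sin_add sin_of_real cos_of_real sin_pi_half cos_pi_half) simp
    moreover have "cos (\<i> * of_real a) = of_real (cosh a)" for a
    proof -
      have "\<i> * (\<i> * complex_of_real a) = - of_real a" by (simp add: complex_eq_iff)
      thus ?thesis
        by (simp only: cos_conv_cosh) (simp add: cosh_def scaleR_conv_of_real exp_of_real[symmetric])
    qed
    ultimately show ?thesis by (simp only:)
  qed
  finally have "of_real ((norm (Gamma ?z))\<^sup>2) = (of_real (pi / cosh (pi * y)) :: complex)"
    by simp
  hence "(norm (Gamma ?z))\<^sup>2 = pi / cosh (pi * y)" by (simp only: of_real_eq_iff)
  thus ?thesis by (simp add: rGamma_inverse_Gamma norm_inverse power_inverse)
qed

lemma norm_rGamma_half_bounds:
  "norm (rGamma (Complex (1/2) y)) \<le> exp (pi / 2 * \<bar>y\<bar>)"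
  "exp (pi / 2 * \<bar>y\<bar>) \<le> 3 * norm (rGamma (Complex (1/2) y))"
proof -
  have c: "cosh (pi * y) = cosh (pi * \<bar>y\<bar>)" by (cases "y \<ge> 0") auto
  have e: "(exp (pi / 2 * \<bar>y\<bar>))\<^sup>2 = exp (pi * \<bar>y\<bar>)"
    by (simp flip: exp_of_nat_mult exp_double)
  have u: "cosh (pi * \<bar>y\<bar>) \<le> exp (pi * \<bar>y\<bar>)"
    unfolding cosh_def by simp
  have l: "exp (pi * \<bar>y\<bar>) \<le> 2 * cosh (pi * \<bar>y\<bar>)"
    unfolding cosh_def by simp
  show "norm (rGamma (Complex (1/2) y)) \<le> exp (pi / 2 * \<bar>y\<bar>)"
  proof (rule power2_le_imp_le)
    have "cosh (pi * \<bar>y\<bar>) / pi \<le> cosh (pi * \<bar>y\<bar>) / 1"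
      using pi_gt3 by (intro divide_left_mono) auto
    thus "(norm (rGamma (Complex (1/2) y)))\<^sup>2 \<le> (exp (pi / 2 * \<bar>y\<bar>))\<^sup>2"
      unfolding norm_rGamma_half e c using u by simp
  qed auto
  show "exp (pi / 2 * \<bar>y\<bar>) \<le> 3 * norm (rGamma (Complex (1/2) y))"
  proof (rule power2_le_imp_le)
    \<comment> \<open>The constant 3 of the claim enters squared: 2 <= 9 / pi.\<close>
    have "2 * cosh (pi * \<bar>y\<bar>) \<le> (9 / pi) * cosh (pi * \<bar>y\<bar>)"
      using pi_less_4 by (intro mult_right_mono) (auto simp: field_simps)
    thus "(exp (pi / 2 * \<bar>y\<bar>))\<^sup>2 \<le> (3 * norm (rGamma (Complex (1/2) y)))\<^sup>2"
      unfolding power_mult_distrib norm_rGamma_half e c using l by simp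
  qed auto
qed

text \<open>Absorbs the factor |s| that each use of Gamma(s + 1) = s Gamma(s) costs into an
  arbitrarily small exponential loss.\<close>

lemma linear_le_exp:
  fixes a e :: real
  assumes "e > 0" "a \<ge> 0"
  obtains C where "C > 0" "\<And>u. u \<ge> 0 \<Longrightarrow> a + u \<le> C * exp (e * u)"
proof
  show "a + 1 + 1/e > 0" using assms by (auto intro!: add_nonneg_pos)
  fix u :: real assume u: "u \<ge> 0"
  have "a * 1 \<le> a * exp (e * u)" using assms u by (intro mult_left_mono) auto
  moreover have "u \<le> (1/e) * exp (e * u)"
    proof -
    have "e * u \<le> exp (e * u)" using exp_ge_add_one_self[of "e * u"] by linarith
    thus ?thesis using assms by (simp add: field_simps)
  qed
  moreover have "(a + 1 + 1/e) * exp (e * u) = a * exp (e * u) + exp (e*u) + (1/e) * exp (e * u)"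
    by (simp add: algebra_simps)
  ultimately show "a + u \<le> (a + 1 + 1/e) * exp (e * u)" using exp_gt_zero[of "e*u"] by linarith
qed

lemma compact_quotient_bound:
  fixes x0 x1 :: real
  assumes "continuous_on {x0..x1} (f :: real \<Rightarrow> real)"
  obtains C where "C > 0" "\<And>x. x0 \<le> x \<Longrightarrow> x \<le> x1 \<Longrightarrow> f x \<le> C"
proof -
  have "bounded (f ` {x0..x1})"
    using compact_continuous_image[OF assms] compact_imp_bounded by auto
  then obtain C where C: "C > 0" "\<And>x. x0 \<le> x \<Longrightarrow> x \<le> x1 \<Longrightarrow> \<bar>f x\<bar> \<le> C"
    unfolding bounded_pos by auto
  show ?thesis by (rule that[of C]) (use C in \<open>force+\<close>)
qed

lemma rGamma_strip_bound_right:
  fixes x0 x1 :: real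
  assumes "x0 \<ge> 1/2"
  obtains C where "C > 0" "\<And>s. x0 \<le> Re s \<Longrightarrow> Re s \<le> x1 \<Longrightarrow>
             norm (rGamma s) \<le> C * exp (pi/2 * \<bar>Im s\<bar>)"
proof -
  have pos: "x \<notin> \<int>\<^sub>\<le>\<^sub>0" if "x0 \<le> x" for x using that assms by (auto elim!: nonpos_Ints_cases)
  have half: "rGamma (1/2 :: real) > 0"
    by (simp add: rGamma_inverse_Gamma Gamma_real_pos)
  obtain C where C: "C > 0" "\<And>x. x0 \<le> x \<Longrightarrow> x \<le> x1 \<Longrightarrow> rGamma x / rGamma (1/2) \<le> C"
    by (rule compact_quotient_bound[of x0 x1 "\<lambda>x. rGamma x / rGamma (1/2 :: real)"])
       (auto intro!: continuous_intros simp: half less_imp_neq[OF half, symmetric])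
  show ?thesis
  proof (rule that[of C])
    fix s :: complex assume s: "x0 \<le> Re s" "Re s \<le> x1"
    have "norm (rGamma s) * rGamma (1/2) \<le> norm (rGamma (Complex (1/2) (Im s))) * rGamma (Re s)"
      using norm_rGamma_shift[of "1/2" "Re s - 1/2" "Im s"] s assms by simp
    hence "norm (rGamma s) \<le> norm (rGamma (Complex (1/2) (Im s))) * (rGamma (Re s) / rGamma (1/2))"
      using half by (simp add: field_simps)
    also have "\<dots> \<le> exp (pi/2 * \<bar>Im s\<bar>) * C"
      by (intro mult_mono norm_rGamma_half_bounds C s)
         (use half s assms in \<open>auto simp: rGamma_inverse_Gamma intro!: Gamma_real_pos less_imp_le\<close>)
    finally show "norm (rGamma s) \<le> C * exp (pi/2 * \<bar>Im s\<bar>)" by (simp add: mult.commute)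
  qed (use C in auto)
qed

text \<open>Induction on the number of unit steps that bring the strip to Re s >= 1/2, where
  \<open>rGamma_strip_bound_right\<close> applies. Each step uses 1/Gamma(s) = s / Gamma(s + 1) and
  spends half of the remaining loss \<open>e\<close> on the factor s.\<close>

lemma rGamma_strip_bound:
  fixes x0 x1 e :: real
  assumes "e > 0"
  obtains C where "C > 0" "\<And>s. x0 \<le> Re s \<Longrightarrow> Re s \<le> x1 \<Longrightarrow>
             norm (rGamma s) \<le> C * exp ((pi/2 + e) * \<bar>Im s\<bar>)"
proof -
  have "\<exists>C>0. \<forall>s. x0 \<le> Re s \<longrightarrow> Re s \<le> x1 \<longrightarrow> norm (rGamma s) \<le> C * exp ((pi/2 + e) * \<bar>Im s\<bar>)"
    if "x0 + of_nat n \<ge> 1/2" "e > 0" for n e x0 x1 using that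
  proof (induction n arbitrary: x0 x1 e)
    case 0
    obtain C where C: "C > 0" "\<And>s. x0 \<le> Re s \<Longrightarrow> Re s \<le> x1 \<Longrightarrow>
             norm (rGamma s) \<le> C * exp (pi/2 * \<bar>Im s\<bar>)"
      using rGamma_strip_bound_right[of x0 x1] 0 by auto
    have "C * exp (pi/2 * \<bar>Im s\<bar>) \<le> C * exp ((pi/2 + e) * \<bar>Im s\<bar>)" for s
      using C(1) 0 by (auto simp: algebra_simps)
    thus ?case using C by (intro exI[of _ C]) (blast intro: order_trans)
  next
    case (Suc n)
    obtain C where C: "C > 0" "\<And>s. x0 + 1 \<le> Re s \<Longrightarrow> Re s \<le> x1 + 1 \<Longrightarrow>
             norm (rGamma s) \<le> C * exp ((pi/2 + e/2) * \<bar>Im s\<bar>)"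
      using Suc.IH[of "x0+1" "e/2" "x1+1"] Suc.prems by auto
    obtain B where B: "B > 0" "\<And>u. u \<ge> 0 \<Longrightarrow> (\<bar>x0\<bar> + \<bar>x1\<bar>) + u \<le> B * exp (e/2 * u)"
      using linear_le_exp[of "e/2" "\<bar>x0\<bar> + \<bar>x1\<bar>"] Suc.prems by auto
    show ?case
    proof (rule exI[of _ "B * C"], intro conjI allI impI)
      fix s :: complex assume s: "x0 \<le> Re s" "Re s \<le> x1"
      have "norm (rGamma s) = norm s * norm (rGamma (s + 1))"
        by (metis norm_mult rGamma_plus1)
      also have "norm s \<le> (\<bar>x0\<bar> + \<bar>x1\<bar>) + \<bar>Im s\<bar>"
        using cmod_le[of s] s by linarith
      also have "\<dots> \<le> B * exp (e/2 * \<bar>Im s\<bar>)" by (rule B(2)) auto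
      also have "norm (rGamma (s + 1)) \<le> C * exp ((pi/2 + e/2) * \<bar>Im s\<bar>)"
        using C(2)[of "s+1"] s by auto
      also have "(B * exp (e/2 * \<bar>Im s\<bar>)) * (C * exp ((pi/2 + e/2) * \<bar>Im s\<bar>)) =
                   (B * C) * exp ((pi/2 + e) * \<bar>Im s\<bar>)"
        by (simp add: algebra_simps flip: exp_add)
      finally show "norm (rGamma s) \<le> (B * C) * exp ((pi/2 + e) * \<bar>Im s\<bar>)"
        using B(1) by (auto simp: mult_right_mono mult_left_mono)
    qed (use B C in auto)
  qed
  moreover obtain n :: nat where "1/2 - x0 \<le> n" using real_arch_simple by blast
  moreover from this have "x0 + of_nat n \<ge> 1/2" by simp
  ultimately show ?thesis using that assms by blast
qed

text \<open>An upper bound for Gamma by monotonicity needs a reference line to the right of the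
  strip. The lines Re s = 1/2 + m are reached from Re s = 1/2 by the functional equation.\<close>

lemma Gamma_half_line_bound:
  fixes e :: real
  assumes "e > 0"
  obtains C where "C > 0" "\<And>y. norm (Gamma (Complex (1/2 + of_nat m) y)) \<le> C * exp (- (pi/2 - e) * \<bar>y\<bar>)"
proof -
  have "\<exists>C>0. \<forall>y. norm (Gamma (Complex (1/2 + of_nat m) y)) \<le> C * exp (- (pi/2 - e) * \<bar>y\<bar>)" if "e > 0" for e
    using that
  proof (induction m arbitrary: e)
    case 0
    have "norm (Gamma (Complex (1/2) y)) \<le> 3 * exp (- (pi/2 - e) * \<bar>y\<bar>)" for y
    proof -
      have hz: "norm (rGamma (Complex (1/2) y)) > 0" using norm_rGamma_half_bounds(2)[of y]
        by (smt (verit) exp_gt_zero)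
      have "norm (Gamma (Complex (1/2) y)) \<le> 3 * exp (- (pi/2 * \<bar>y\<bar>))"
        using norm_rGamma_half_bounds(2)[of y] hz
        by (simp add: exp_minus field_simps Gamma_def norm_inverse norm_divide)
      also have "\<dots> \<le> 3 * exp (- (pi/2 - e) * \<bar>y\<bar>)"
        using 0 by (simp add: algebra_simps)
      finally show ?thesis .
    qed
    thus ?case by (intro exI[of _ 3]) auto
  next
    case (Suc m)
    obtain C where C: "C > 0" "\<And>y. norm (Gamma (Complex (1/2 + of_nat m) y)) \<le> C * exp (- (pi/2 - e/2) * \<bar>y\<bar>)"
      using Suc.IH[of "e/2"] Suc.prems by auto
    obtain B where B: "B > 0" "\<And>u. u \<ge> 0 \<Longrightarrow> (1/2 + of_nat m) + u \<le> B * exp (e/2 * u)"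
      using linear_le_exp[of "e/2" "1/2 + of_nat m"] Suc.prems by auto
    show ?case
    proof (rule exI[of _ "B * C"], intro conjI allI)
      fix y :: real
      let ?s = "Complex (1/2 + of_nat m) y"
      have "?s \<notin> \<int>\<^sub>\<le>\<^sub>0" by (auto elim!: nonpos_Ints_cases simp: complex_eq_iff)
      moreover have "Complex (1/2 + of_nat (Suc m)) y = ?s + 1" by (simp add: complex_eq_iff)
      ultimately have "norm (Gamma (Complex (1/2 + of_nat (Suc m)) y)) = norm ?s * norm (Gamma ?s)"
        by (metis Gamma_plus1 norm_mult)
      also have "norm ?s \<le> (1/2 + of_nat m) + \<bar>y\<bar>" using cmod_le[of ?s] by simp
      also have "\<dots> \<le> B * exp (e/2 * \<bar>y\<bar>)" by (rule B(2)) auto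
      also have "norm (Gamma ?s) \<le> C * exp (- (pi/2 - e/2) * \<bar>y\<bar>)" by (rule C)
      also have "(B * exp (e/2 * \<bar>y\<bar>)) * (C * exp (- (pi/2 - e/2) * \<bar>y\<bar>)) =
                   (B * C) * exp (- (pi/2 - e) * \<bar>y\<bar>)"
        by (simp add: algebra_simps flip: exp_add)
      finally show "norm (Gamma (Complex (1/2 + of_nat (Suc m)) y)) \<le> (B * C) * exp (- (pi/2 - e) * \<bar>y\<bar>)"
        using B(1) by (auto simp: mult_right_mono mult_left_mono)
    qed (use B C in auto)
  qed
  thus ?thesis using that assms by blast
qed

text \<open>\<open>norm_rGamma_shift\<close> is used from a point of the strip to the line Re s =
  1/2 + m, which lies to its right by the choice of m >= x1.\<close>

lemma Gamma_strip_bound: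
  fixes x0 x1 e :: real
  assumes "x0 > 0" "e > 0"
  obtains C where "C > 0" "\<And>s. x0 \<le> Re s \<Longrightarrow> Re s \<le> x1 \<Longrightarrow>
             norm (Gamma s) \<le> C * exp (- (pi/2 - e) * \<bar>Im s\<bar>)"
proof -
  obtain m :: nat where m: "x1 \<le> m" using real_arch_simple by blast
  obtain C where C: "C > 0" "\<And>x. x0 \<le> x \<Longrightarrow> x \<le> x1 \<Longrightarrow> rGamma (1/2 + real m) / rGamma x \<le> C"
    by (rule compact_quotient_bound[of x0 x1 "\<lambda>x. rGamma (1/2 + real m) / rGamma x"])
       (use assms in \<open>auto intro!: continuous_intros simp: rGamma_eq_zero_iff elim!: nonpos_Ints_cases\<close>)
  obtain B where B: "B > 0" "\<And>y. norm (Gamma (Complex (1/2 + of_nat m) y)) \<le> B * exp (- (pi/2 - e) * \<bar>y\<bar>)"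
    using Gamma_half_line_bound assms by blast
  show ?thesis
  proof (rule that[of "C * B"])
    fix s :: complex assume s: "x0 \<le> Re s" "Re s \<le> x1"
    let ?w = "Complex (1/2 + of_nat m) (Im s)"
    have pos: "rGamma (Re s) > 0" using s assms
      by (auto simp: rGamma_inverse_Gamma intro!: Gamma_real_pos)
    have "s \<notin> \<int>\<^sub>\<le>\<^sub>0" "?w \<notin> \<int>\<^sub>\<le>\<^sub>0" using s assms by (auto elim!: nonpos_Ints_cases simp: complex_eq_iff)
    hence nz: "norm (rGamma s) > 0" "norm (rGamma ?w) > 0" by (auto simp: rGamma_eq_zero_iff)
    have "norm (rGamma ?w) * rGamma (Re s) \<le> norm (rGamma s) * rGamma (1/2 + real m)"
      using norm_rGamma_shift[of "Re s" "1/2 + m - Re s" "Im s"] s assms m by simp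
    hence "norm (Gamma s) \<le> (rGamma (1/2 + real m) / rGamma (Re s)) * norm (Gamma ?w)"
      using pos nz by (simp add: Gamma_def norm_inverse norm_divide field_simps)
    also have "\<dots> \<le> C * (B * exp (- (pi/2 - e) * \<bar>Im s\<bar>))"
      by (intro mult_mono C(2) B(2) s) (use C in auto)
    finally show "norm (Gamma s) \<le> C * B * exp (- (pi/2 - e) * \<bar>Im s\<bar>)"
      by (simp add: mult.assoc)
  qed (use B C in auto)
qed

text \<open>Keeping |Im s| >= 1 avoids the poles and makes |s| >= 1, so that |Gamma(s)| <= |Gamma(s
  + 1)| and the move to the right half-plane costs nothing.\<close>

lemma Gamma_strip_bound_away:
  fixes x0 x1 e :: real
  assumes "e > 0"
  obtains C where "C > 0" "\<And>s. x0 \<le> Re s \<Longrightarrow> Re s \<le> x1 \<Longrightarrow> 1 \<le> \<bar>Im s\<bar> \<Longrightarrow>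
             norm (Gamma s) \<le> C * exp (- (pi/2 - e) * \<bar>Im s\<bar>)"
proof -
  have "\<exists>C>0. \<forall>s. x0 \<le> Re s \<longrightarrow> Re s \<le> x1 \<longrightarrow> 1 \<le> \<bar>Im s\<bar> \<longrightarrow> norm (Gamma s) \<le> C * exp (- (pi/2 - e) * \<bar>Im s\<bar>)"
    if "x0 + of_nat n > 0" for n x0 x1 using that
  proof (induction n arbitrary: x0 x1)
    case 0
    hence "x0 > 0" by simp
    from Gamma_strip_bound[OF this assms, of x1] show ?case by metis
  next
    case (Suc n)
    obtain C where C: "C > 0" "\<And>s. x0 + 1 \<le> Re s \<Longrightarrow> Re s \<le> x1 + 1 \<Longrightarrow> 1 \<le> \<bar>Im s\<bar> \<Longrightarrow>
             norm (Gamma s) \<le> C * exp (- (pi/2 - e) * \<bar>Im s\<bar>)"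
      using Suc.IH[of "x0+1" "x1+1"] Suc.prems by auto
    show ?case
    proof (rule exI[of _ C], intro conjI allI impI)
      fix s :: complex assume s: "x0 \<le> Re s" "Re s \<le> x1" "1 \<le> \<bar>Im s\<bar>"
      have "s \<notin> \<int>\<^sub>\<le>\<^sub>0" using s by (auto elim!: nonpos_Ints_cases)
      hence "norm (Gamma (s + 1)) = norm s * norm (Gamma s)" by (metis Gamma_plus1 norm_mult)
      moreover have "norm s \<ge> 1" using s(3) abs_Im_le_cmod[of s] by linarith
      ultimately have "norm (Gamma s) \<le> norm (Gamma (s + 1))"
        by (simp add: mult_le_cancel_right1)
      also have "\<dots> \<le> C * exp (- (pi/2 - e) * \<bar>Im s\<bar>)" using C(2)[of "s+1"] s by auto
      finally show "norm (Gamma s) \<le> C * exp (- (pi/2 - e) * \<bar>Im s\<bar>)" .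
    qed (use C in auto)
  qed
  moreover obtain n :: nat where "- x0 < n" using reals_Archimedean2 by blast
  moreover from this have "x0 + of_nat n > 0" by simp
  ultimately show ?thesis using that by blast
qed

section \<open>Integrals along vertical lines\<close>

text \<open>Exponential type in |Im s|, up to an arbitrarily small loss and locally uniformly in Re
  s. Only large |Im s| counts, so poles at bounded height are harmless. Types add under products:
  each Gamma contributes -pi/2 and each reciprocal Gamma +pi/2; negative type means convergence on
  vertical lines.\<close>

definition strip_type :: "(complex \<Rightarrow> complex) \<Rightarrow> real \<Rightarrow> bool" where
  "strip_type f \<kappa> \<longleftrightarrow> (\<forall>x0 x1. \<forall>e>0. \<exists>C Y. \<forall>s. x0 \<le> Re s \<longrightarrow> Re s \<le> x1 \<longrightarrow> Y \<le> \<bar>Im s\<bar> \<longrightarrow>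
      norm (f s) \<le> C * exp ((\<kappa> + e) * \<bar>Im s\<bar>))"

lemma strip_typeD:
  assumes "strip_type f \<kappa>" "e > 0"
  obtains C Y where "C > 0" "\<And>s. x0 \<le> Re s \<Longrightarrow> Re s \<le> x1 \<Longrightarrow> Y \<le> \<bar>Im s\<bar> \<Longrightarrow>
      norm (f s) \<le> C * exp ((\<kappa> + e) * \<bar>Im s\<bar>)"
proof -
  obtain C Y where C: "\<And>s. x0 \<le> Re s \<Longrightarrow> Re s \<le> x1 \<Longrightarrow> Y \<le> \<bar>Im s\<bar> \<Longrightarrow>
      norm (f s) \<le> C * exp ((\<kappa> + e) * \<bar>Im s\<bar>)"
    using assms unfolding strip_type_def by blast
  have "C * exp ((\<kappa> + e) * \<bar>Im s\<bar>) \<le> max C 1 * exp ((\<kappa> + e) * \<bar>Im s\<bar>)" for s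
    by (intro mult_right_mono) auto
  with C have "x0 \<le> Re s \<Longrightarrow> Re s \<le> x1 \<Longrightarrow> Y \<le> \<bar>Im s\<bar> \<Longrightarrow>
      norm (f s) \<le> max C 1 * exp ((\<kappa> + e) * \<bar>Im s\<bar>)" for s
    using order_trans by blast
  thus ?thesis by (intro that[of "max C 1" Y]) auto
qed

lemma strip_type_mult:
  assumes "strip_type f \<kappa>" "strip_type g \<kappa>'"
  shows "strip_type (\<lambda>s. f s * g s) (\<kappa> + \<kappa>')"
  unfolding strip_type_def
proof (intro allI impI)
  fix x0 x1 e :: real assume e: "e > 0"
  obtain C Y where C: "C > 0" "\<And>s. x0 \<le> Re s \<Longrightarrow> Re s \<le> x1 \<Longrightarrow> Y \<le> \<bar>Im s\<bar> \<Longrightarrow>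
      norm (f s) \<le> C * exp ((\<kappa> + e/2) * \<bar>Im s\<bar>)"
    using strip_typeD[OF assms(1), of "e/2" x0 x1] e by auto
  obtain C' Y' where C': "C' > 0" "\<And>s. x0 \<le> Re s \<Longrightarrow> Re s \<le> x1 \<Longrightarrow> Y' \<le> \<bar>Im s\<bar> \<Longrightarrow>
      norm (g s) \<le> C' * exp ((\<kappa>' + e/2) * \<bar>Im s\<bar>)"
    using strip_typeD[OF assms(2), of "e/2" x0 x1] e by auto
  show "\<exists>C Y. \<forall>s. x0 \<le> Re s \<longrightarrow> Re s \<le> x1 \<longrightarrow> Y \<le> \<bar>Im s\<bar> \<longrightarrow>
      norm (f s * g s) \<le> C * exp ((\<kappa> + \<kappa>' + e) * \<bar>Im s\<bar>)"
  proof (rule exI[of _ "C * C'"], rule exI[of _ "max Y Y'"], intro allI impI)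
    fix s assume s: "x0 \<le> Re s" "Re s \<le> x1" "max Y Y' \<le> \<bar>Im s\<bar>"
    have "norm (f s * g s) \<le> (C * exp ((\<kappa> + e/2) * \<bar>Im s\<bar>)) * (C' * exp ((\<kappa>' + e/2) * \<bar>Im s\<bar>))"
      unfolding norm_mult by (intro mult_mono C C') (use s C(1) in auto)
    also have "\<dots> = C * C' * exp ((\<kappa> + \<kappa>' + e) * \<bar>Im s\<bar>)"
      by (simp add: algebra_simps flip: exp_add)
    finally show "norm (f s * g s) \<le> C * C' * exp ((\<kappa> + \<kappa>' + e) * \<bar>Im s\<bar>)" .
  qed
qed

lemma strip_type_uminus_arg:
  assumes "strip_type f \<kappa>"
  shows "strip_type (\<lambda>s. f (- s)) \<kappa>"
  unfolding strip_type_def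
proof (intro allI impI)
  fix x0 x1 e :: real assume e: "e > 0"
  obtain C Y where C: "C > 0" "\<And>s. - x1 \<le> Re s \<Longrightarrow> Re s \<le> - x0 \<Longrightarrow> Y \<le> \<bar>Im s\<bar> \<Longrightarrow>
      norm (f s) \<le> C * exp ((\<kappa> + e) * \<bar>Im s\<bar>)"
    using strip_typeD[OF assms e, of "-x1" "-x0"] by auto
  show "\<exists>C Y. \<forall>s. x0 \<le> Re s \<longrightarrow> Re s \<le> x1 \<longrightarrow> Y \<le> \<bar>Im s\<bar> \<longrightarrow>
      norm (f (- s)) \<le> C * exp ((\<kappa> + e) * \<bar>Im s\<bar>)"
    by (rule exI[of _ C], rule exI[of _ Y]) (use C(2)[of "- s" for s] in auto)
qed

lemma strip_type_shift_arg:
  assumes "strip_type f \<kappa>"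
  shows "strip_type (\<lambda>s. f (b + s)) \<kappa>"
  unfolding strip_type_def
proof (intro allI impI)
  fix x0 x1 e :: real assume e: "e > 0"
  obtain C Y where C: "C > 0" "\<And>s. x0 + Re b \<le> Re s \<Longrightarrow> Re s \<le> x1 + Re b \<Longrightarrow> Y \<le> \<bar>Im s\<bar> \<Longrightarrow>
      norm (f s) \<le> C * exp ((\<kappa> + e) * \<bar>Im s\<bar>)"
    using strip_typeD[OF assms e, of "x0 + Re b" "x1 + Re b"] by auto
  show "\<exists>C Y. \<forall>s. x0 \<le> Re s \<longrightarrow> Re s \<le> x1 \<longrightarrow> Y \<le> \<bar>Im s\<bar> \<longrightarrow>
      norm (f (b + s)) \<le> C * exp ((\<kappa> + e) * \<bar>Im s\<bar>)"
  proof (rule exI[of _ "C * exp (\<bar>\<kappa> + e\<bar> * \<bar>Im b\<bar>)"], rule exI[of _ "Y + \<bar>Im b\<bar>"], intro allI impI)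
    fix s assume s: "x0 \<le> Re s" "Re s \<le> x1" "Y + \<bar>Im b\<bar> \<le> \<bar>Im s\<bar>"
    have "(\<kappa> + e) * (\<bar>Im b + Im s\<bar> - \<bar>Im s\<bar>) \<le> \<bar>\<kappa> + e\<bar> * \<bar>Im b\<bar>"
      by (rule order_trans[OF abs_ge_self]) (auto simp: abs_mult intro!: mult_left_mono)
    hence "(\<kappa> + e) * \<bar>Im b + Im s\<bar> \<le> \<bar>\<kappa> + e\<bar> * \<bar>Im b\<bar> + (\<kappa> + e) * \<bar>Im s\<bar>"
      by (simp add: algebra_simps)
    hence "exp ((\<kappa> + e) * \<bar>Im b + Im s\<bar>) \<le> exp (\<bar>\<kappa> + e\<bar> * \<bar>Im b\<bar>) * exp ((\<kappa> + e) * \<bar>Im s\<bar>)"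
      by (simp flip: exp_add)
    moreover have "norm (f (b + s)) \<le> C * exp ((\<kappa> + e) * \<bar>Im b + Im s\<bar>)"
      using C(2)[of "b + s"] s by auto
    ultimately show "norm (f (b + s)) \<le> C * exp (\<bar>\<kappa> + e\<bar> * \<bar>Im b\<bar>) * exp ((\<kappa> + e) * \<bar>Im s\<bar>)"
      using C(1) by (smt (verit) mult_left_mono mult.assoc)
  qed
qed

lemma strip_type_Gamma: "strip_type Gamma (- pi / 2)"
  unfolding strip_type_def
proof (intro allI impI)
  fix x0 x1 e :: real assume "e > 0"
  from Gamma_strip_bound_away[OF this, of x0 x1] obtain C where
    "C > 0" "\<And>s. x0 \<le> Re s \<Longrightarrow> Re s \<le> x1 \<Longrightarrow> 1 \<le> \<bar>Im s\<bar> \<Longrightarrow>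
       norm (Gamma s :: complex) \<le> C * exp (- (pi/2 - e) * \<bar>Im s\<bar>)" by blast
  thus "\<exists>C Y. \<forall>s. x0 \<le> Re s \<longrightarrow> Re s \<le> x1 \<longrightarrow> Y \<le> \<bar>Im s\<bar> \<longrightarrow>
      norm (Gamma s :: complex) \<le> C * exp ((- pi/2 + e) * \<bar>Im s\<bar>)"
    by (intro exI[of _ C] exI[of _ 1]) auto
qed

lemma strip_type_rGamma: "strip_type rGamma (pi / 2)"
  unfolding strip_type_def
proof (intro allI impI)
  fix x0 x1 e :: real assume "e > 0"
  from rGamma_strip_bound[OF this, of x0 x1] obtain C where
    "C > 0" "\<And>s. x0 \<le> Re s \<Longrightarrow> Re s \<le> x1 \<Longrightarrow>
       norm (rGamma s :: complex) \<le> C * exp ((pi/2 + e) * \<bar>Im s\<bar>)" by blast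
  thus "\<exists>C Y. \<forall>s. x0 \<le> Re s \<longrightarrow> Re s \<le> x1 \<longrightarrow> Y \<le> \<bar>Im s\<bar> \<longrightarrow>
      norm (rGamma s :: complex) \<le> C * exp ((pi/2 + e) * \<bar>Im s\<bar>)"
    by (intro exI[of _ C] exI[of _ 1]) auto
qed

lemma strip_type_Gamma_minus: "strip_type (\<lambda>s. Gamma (b - s)) (- pi / 2)"
  using strip_type_uminus_arg[OF strip_type_shift_arg[OF strip_type_Gamma, of b]] by simp

lemma strip_type_rGamma_minus: "strip_type (\<lambda>s. rGamma (b - s)) (pi / 2)"
  using strip_type_uminus_arg[OF strip_type_shift_arg[OF strip_type_rGamma, of b]] by simp

lemmas strip_type_Gamma_plus = strip_type_shift_arg[OF strip_type_Gamma]
lemmas strip_type_rGamma_plus = strip_type_shift_arg[OF strip_type_rGamma]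

lemma strip_type_exp: "strip_type (\<lambda>s. exp (s * l)) \<bar>Im l\<bar>"
  unfolding strip_type_def
proof (intro allI impI)
  fix x0 x1 e :: real assume e: "e > 0"
  show "\<exists>C Y. \<forall>s. x0 \<le> Re s \<longrightarrow> Re s \<le> x1 \<longrightarrow> Y \<le> \<bar>Im s\<bar> \<longrightarrow>
      norm (exp (s * l)) \<le> C * exp ((\<bar>Im l\<bar> + e) * \<bar>Im s\<bar>)"
  proof (rule exI[of _ "exp ((\<bar>x0\<bar> + \<bar>x1\<bar>) * \<bar>Re l\<bar>)"], rule exI[of _ 0], intro allI impI)
    fix s assume s: "x0 \<le> Re s" "Re s \<le> x1" "0 \<le> \<bar>Im s\<bar>"
    have "Re s * Re l \<le> \<bar>Re s\<bar> * \<bar>Re l\<bar>" by (metis abs_ge_self abs_mult)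
    also have "\<dots> \<le> (\<bar>x0\<bar> + \<bar>x1\<bar>) * \<bar>Re l\<bar>" using s by (intro mult_right_mono) auto
    finally have 1: "Re s * Re l \<le> (\<bar>x0\<bar> + \<bar>x1\<bar>) * \<bar>Re l\<bar>" .
    have "- (Im s * Im l) \<le> \<bar>Im l\<bar> * \<bar>Im s\<bar>"
      by (metis abs_ge_minus_self abs_mult mult.commute)
    also have "\<dots> \<le> (\<bar>Im l\<bar> + e) * \<bar>Im s\<bar>" using e by (intro mult_right_mono) auto
    finally have "Re s * Re l - Im s * Im l \<le> (\<bar>x0\<bar> + \<bar>x1\<bar>) * \<bar>Re l\<bar> + (\<bar>Im l\<bar> + e) * \<bar>Im s\<bar>"
      using 1 by linarith
    thus "norm (exp (s * l)) \<le> exp ((\<bar>x0\<bar> + \<bar>x1\<bar>) * \<bar>Re l\<bar>) * exp ((\<bar>Im l\<bar> + e) * \<bar>Im s\<bar>)"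
      by (simp flip: exp_add)
  qed
qed

lemma strip_type_decay:
  assumes "strip_type f \<kappa>" "\<kappa> < 0"
  obtains C Y \<delta> where "C > 0" "\<delta> > 0" "\<And>s. x0 \<le> Re s \<Longrightarrow> Re s \<le> x1 \<Longrightarrow> Y \<le> \<bar>Im s\<bar> \<Longrightarrow>
      norm (f s) \<le> C * exp (- \<delta> * \<bar>Im s\<bar>)"
proof -
  obtain C Y where C: "C > 0" "\<And>s. x0 \<le> Re s \<Longrightarrow> Re s \<le> x1 \<Longrightarrow> Y \<le> \<bar>Im s\<bar> \<Longrightarrow>
      norm (f s) \<le> C * exp ((\<kappa> + (-\<kappa>/2)) * \<bar>Im s\<bar>)"
    using strip_typeD[OF assms(1), of "-\<kappa>/2" x0 x1] assms(2) by auto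
  thus ?thesis using assms(2) by (intro that[of C "-\<kappa>/2" Y]) (auto simp: algebra_simps)
qed

lemma integrable_exp_neg_abs:
  fixes \<delta> :: real
  assumes "\<delta> > 0"
  shows "integrable lborel (\<lambda>y::real. exp (- \<delta> * \<bar>y\<bar>))"
proof -
  have "(\<lambda>y. exp (- \<delta> * y)) absolutely_integrable_on {0..}"
    using has_integral_exp_minus_to_infinity[OF assms, of 0]
    by (intro nonnegative_absolutely_integrable_1) (auto simp: integrable_on_def)
  hence "integrable lborel (\<lambda>y. indicator {0..} y *\<^sub>R exp (- \<delta> * y))"
    unfolding set_integrable_def by (subst (asm) integrable_completion) auto
  moreover from this have "integrable lborel (\<lambda>y. indicator {0..} (0 + (-1) * y) *\<^sub>R exp (- \<delta> * (0 + (-1) * y)))"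
    by (subst lborel_integrable_real_affine_iff) auto
  ultimately have "integrable lborel (\<lambda>y. indicator {0..} y *\<^sub>R exp (- \<delta> * y) +
                     indicator {0..} (0 + (-1) * y) *\<^sub>R exp (- \<delta> * (0 + (-1) * y)))"
    by (rule Bochner_Integration.integrable_add)
  thus ?thesis
    by (rule Bochner_Integration.integrable_bound) (auto simp: indicator_def)
qed

lemma integrable_exp_decay:
  fixes h :: "real \<Rightarrow> complex"
  assumes "h \<in> borel_measurable borel" "\<delta> > 0" "\<And>y. norm (h y) \<le> C * exp (- \<delta> * \<bar>y\<bar>)"
  shows "integrable lborel h"
proof (rule Bochner_Integration.integrable_bound)
  show "integrable lborel (\<lambda>y. C * exp (- \<delta> * \<bar>y\<bar>))"
    using integrable_exp_neg_abs[OF assms(2)] by simp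
  have "norm (h y) \<le> norm (C * exp (- \<delta> * \<bar>y\<bar>))" for y
    using assms(3)[of y] by (smt (verit) real_norm_def)
  thus "AE y in lborel. norm (h y) \<le> norm (C * exp (- \<delta> * \<bar>y\<bar>))" by simp
qed (use assms in auto)

section \<open>Integrals over full vertical lines as limits of contour integrals\<close>

lemma line_integrable:
  assumes "strip_type f \<kappa>" "\<kappa> < 0" "continuous_on UNIV (\<lambda>y. f (Complex c y))"
  shows "integrable lborel (\<lambda>y. f (Complex c y))"
proof -
  obtain C Y \<delta> where C: "C > 0" "\<delta> > 0" "\<And>s. c \<le> Re s \<Longrightarrow> Re s \<le> c \<Longrightarrow> Y \<le> \<bar>Im s\<bar> \<Longrightarrow>
      norm (f s) \<le> C * exp (- \<delta> * \<bar>Im s\<bar>)"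
    using strip_type_decay[OF assms(1,2), where ?x0.0 = c and ?x1.0 = c] by metis
  have "bounded ((\<lambda>y. f (Complex c y)) ` {-\<bar>Y\<bar>..\<bar>Y\<bar>})"
    by (intro compact_imp_bounded compact_continuous_image continuous_on_subset[OF assms(3)]) auto
  then obtain M where M: "M > 0" "\<And>y. \<bar>y\<bar> \<le> \<bar>Y\<bar> \<Longrightarrow> norm (f (Complex c y)) \<le> M"
    unfolding bounded_pos by (auto simp: abs_le_iff)
  show ?thesis
  proof (rule integrable_exp_decay[of _ \<delta> "C + M * exp (\<delta> * \<bar>Y\<bar>)"])
    fix y :: real
    show "norm (f (Complex c y)) \<le> (C + M * exp (\<delta> * \<bar>Y\<bar>)) * exp (- \<delta> * \<bar>y\<bar>)"
    proof (cases "\<bar>y\<bar> \<le> \<bar>Y\<bar>")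
      case True
      have "M * 1 \<le> M * exp (\<delta> * (\<bar>Y\<bar> - \<bar>y\<bar>))" using M(1) C(2) True by (intro mult_left_mono) auto
      also have "\<dots> = M * exp (\<delta> * \<bar>Y\<bar>) * exp (- \<delta> * \<bar>y\<bar>)"
        by (simp add: algebra_simps flip: exp_add)
      also have "\<dots> \<le> (C + M * exp (\<delta> * \<bar>Y\<bar>)) * exp (- \<delta> * \<bar>y\<bar>)"
        using C(1) by (intro mult_right_mono) auto
      finally show ?thesis using M(2)[OF True] by simp
    next
      case False
      hence "norm (f (Complex c y)) \<le> C * exp (- \<delta> * \<bar>y\<bar>)" using C(3)[of "Complex c y"] by auto
      also have "\<dots> \<le> (C + M * exp (\<delta> * \<bar>Y\<bar>)) * exp (- \<delta> * \<bar>y\<bar>)"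
        using M(1) by (intro mult_right_mono) auto
      finally show ?thesis .
    qed
  qed (use C assms in \<open>auto intro: borel_measurable_continuous_onI\<close>)
qed

text \<open>The two end points move independently, as \<open>has_line_integral\<close> demands. The
  integral over {a..b} is split as A(b) - B(a), integrals over left half-lines, and each term has
  its own limit by dominated convergence.\<close>

lemma tendsto_integral_interval:
  fixes h :: "real \<Rightarrow> complex"
  assumes h: "integrable lborel h"
  shows "((\<lambda>(a, b). integral {a..b} h) \<longlongrightarrow> (\<integral>x. h x \<partial>lborel)) (at_bot \<times>\<^sub>F at_top)"
proof -
  define A where "A = (\<lambda>b. \<integral>x. indicator {..b} x *\<^sub>R h x \<partial>lborel)"
  define B where "B = (\<lambda>b. \<integral>x. indicator {..<b} x *\<^sub>R h x \<partial>lborel)"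
  have A: "(A \<longlongrightarrow> (\<integral>x. h x \<partial>lborel)) at_top"
    unfolding A_def by (rule tendsto_integral_at_top) (use h in auto)
  have "((\<lambda>b. \<integral>x. indicator {..<-b} x *\<^sub>R h x \<partial>lborel) \<longlongrightarrow> integral\<^sup>L lborel (\<lambda>_::real. 0::complex)) at_top"
  proof (rule integral_dominated_convergence_at_top[where w = "\<lambda>x. norm (h x)"])
    show "AE x in lborel. ((\<lambda>b. indicator {..<-b} x *\<^sub>R h x) \<longlongrightarrow> 0) at_top"
    proof (rule AE_I2, rule tendsto_eventually)
      fix x :: real
      show "\<forall>\<^sub>F b in at_top. indicator {..<- b} x *\<^sub>R h x = 0"
        using eventually_ge_at_top[of "-x"] by eventually_elim auto
    qed
    show "\<forall>\<^sub>F b in at_top. AE x in lborel. norm (indicator {..<-b} x *\<^sub>R h x) \<le> norm (h x)"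
      by (intro always_eventually allI AE_I2) (auto simp: indicator_def)
  qed (use h in auto)
  hence B: "(B \<longlongrightarrow> 0) at_bot" unfolding B_def filterlim_at_bot_mirror by simp
  have eq: "integral {a..b} h = A b - B a" if "a \<le> b" for a b
  proof -
    have si: "set_integrable lborel S h" if "S \<in> sets borel" for S
      using h that unfolding set_integrable_def by (intro integrable_mult_indicator) auto
    have "integral {a..b} h = (LINT x:{a..b}|lborel. h x)"
      using set_borel_integral_eq_integral(2)[OF si[of "{a..b}"]] by simp
    also have "\<dots> = (\<integral>x. indicator {..b} x *\<^sub>R h x - indicator {..<a} x *\<^sub>R h x \<partial>lborel)"
      unfolding set_lebesgue_integral_def
      by (intro Bochner_Integration.integral_cong) (use that in \<open>auto simp: indicator_def\<close>)
    also have "\<dots> = A b - B a"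
      unfolding A_def B_def
      by (intro Bochner_Integration.integral_diff) (use si[unfolded set_integrable_def] in auto)
    finally show ?thesis .
  qed
  have "((\<lambda>z. A (snd z) - B (fst z)) \<longlongrightarrow> (\<integral>x. h x \<partial>lborel) - 0) (at_bot \<times>\<^sub>F at_top)"
    by (intro tendsto_diff filterlim_compose[OF A] filterlim_compose[OF B] filterlim_snd filterlim_fst)
  moreover have "\<forall>\<^sub>F z in at_bot \<times>\<^sub>F at_top. A (snd z) - B (fst z) = (case z of (a, b) \<Rightarrow> integral {a..b} h)"
    using eventually_prodI[OF eventually_le_at_bot[of 0] eventually_ge_at_top[of "0::real"]]
    by eventually_elim (auto simp: eq)
  ultimately show ?thesis by (simp add: tendsto_cong)
qed

lemma tendsto_line_integral:
  assumes "integrable lborel (\<lambda>y. f (Complex c y))"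
  shows "((\<lambda>(a, b). contour_integral (linepath (Complex c a) (Complex c b)) f) \<longlongrightarrow>
            \<i> * (\<integral>y. f (Complex c y) \<partial>lborel)) (at_bot \<times>\<^sub>F at_top)"
proof -
  have "((\<lambda>z. \<i> * (case z of (a, b) \<Rightarrow> integral {a..b} (\<lambda>y. f (Complex c y)))) \<longlongrightarrow>
            \<i> * (\<integral>y. f (Complex c y) \<partial>lborel)) (at_bot \<times>\<^sub>F at_top)"
    by (intro tendsto_mult_left tendsto_integral_interval assms)
  moreover have "\<forall>\<^sub>F z in at_bot \<times>\<^sub>F at_top. \<i> * (case z of (a, b) \<Rightarrow> integral {a..b} (\<lambda>y. f (Complex c y)))
     = (case z of (a, b) \<Rightarrow> contour_integral (linepath (Complex c a) (Complex c b)) f)"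
    using eventually_prodI[OF eventually_le_at_bot[of 0] eventually_gt_at_top[of "0::real"]]
    by eventually_elim (auto simp: contour_integral_linepath_same_Re)
  ultimately show ?thesis by (simp add: tendsto_cong)
qed

section \<open>Residue series for Mellin--Barnes integrals\<close>

lemma contour_integral_rectpath_eq:
  assumes "continuous_on (path_image (rectpath (Complex c u) (Complex d v))) f"
  shows "contour_integral (rectpath (Complex c u) (Complex d v)) f =
           contour_integral (linepath (Complex c u) (Complex d u)) f +
           contour_integral (linepath (Complex d u) (Complex d v)) f -
           contour_integral (linepath (Complex c v) (Complex d v)) f -
           contour_integral (linepath (Complex c u) (Complex c v)) f"
proof -
  let ?a = "Complex c u" and ?b = "Complex d u" and ?c = "Complex d v" and ?d = "Complex c v"
  have R: "rectpath ?a ?c = linepath ?a ?b +++ linepath ?b ?c +++ linepath ?c ?d +++ linepath ?d ?a"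
    by (simp add: rectpath_def Let_def)
  have cont: "continuous_on (closed_segment ?a ?b) f" "continuous_on (closed_segment ?b ?c) f"
             "continuous_on (closed_segment ?c ?d) f" "continuous_on (closed_segment ?d ?a) f"
    using assms unfolding R by (auto simp: path_image_join elim!: continuous_on_subset)
  note ci = cont[THEN contour_integrable_continuous_linepath]
  have "contour_integral (rectpath ?a ?c) f = contour_integral (linepath ?a ?b) f +
          (contour_integral (linepath ?b ?c) f + (contour_integral (linepath ?c ?d) f +
           contour_integral (linepath ?d ?a) f))"
    unfolding R using ci by (simp add: contour_integral_join contour_integrable_joinI)
  moreover have "contour_integral (linepath ?c ?d) f = - contour_integral (linepath ?d ?c) f"
    using cont(3) by (intro contour_integral_reverse_linepath) auto
  moreover have "contour_integral (linepath ?d ?a) f = - contour_integral (linepath ?a ?d) f"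
    using cont(4) by (intro contour_integral_reverse_linepath) auto
  ultimately show ?thesis by simp
qed

lemma convex_Im_eq: "convex {z. Im z = k}"
proof -
  have "{z. Im z = k} = {z. Im z \<le> k} \<inter> {z. k \<le> Im z}" by auto
  thus ?thesis by (simp add: convex_Int convex_halfspace_Im_le convex_halfspace_Im_ge)
qed

text \<open>The end points are functions along an arbitrary filter because two situations are
  served: the sides of growing rectangles, and the segments that join a moving point of a curved
  contour to a vertical line.\<close>

lemma horizontal_integral_tendsto_0:
  assumes "\<delta> > 0" "c \<le> d"
    and bound: "\<And>s. c \<le> Re s \<Longrightarrow> Re s \<le> d \<Longrightarrow> Y \<le> \<bar>Im s\<bar> \<Longrightarrow> norm (f s) \<le> C * exp (- \<delta> * \<bar>Im s\<bar>)"
    and p: "\<And>T. c \<le> Re (p T)" "\<And>T. Re (p T) \<le> d"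
    and q: "\<And>T. c \<le> Re (q T)" "\<And>T. Re (q T) \<le> d" "\<And>T. Im (q T) = Im (p T)"
    and lim: "filterlim (\<lambda>T. \<bar>Im (p T)\<bar>) at_top F"
  shows "((\<lambda>T. contour_integral (linepath (p T) (q T)) f) \<longlongrightarrow> 0) F"
proof (rule tendsto_0_le)
  have "filterlim (\<lambda>T. \<delta> * \<bar>Im (p T)\<bar>) at_top F"
    using lim assms(1) by (intro filterlim_tendsto_pos_mult_at_top[OF tendsto_const])
  hence "((\<lambda>T. exp (- (\<delta> * \<bar>Im (p T)\<bar>))) \<longlongrightarrow> 0) F"
    by (intro filterlim_compose[OF exp_at_bot] filterlim_compose[OF filterlim_uminus_at_bot_at_top])
  thus "((\<lambda>T. C * exp (- \<delta> * \<bar>Im (p T)\<bar>)) \<longlongrightarrow> 0) F"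
    by (auto intro: tendsto_mult_right_zero)
  have "\<forall>\<^sub>F T in F. \<bar>Im (p T)\<bar> \<ge> Y" using lim unfolding filterlim_at_top by blast
  thus "\<forall>\<^sub>F T in F. norm (contour_integral (linepath (p T) (q T)) f)
          \<le> norm (C * exp (- \<delta> * \<bar>Im (p T)\<bar>)) * (d - c)"
  proof eventually_elim
    case (elim T)
    show ?case
    proof (cases "f contour_integrable_on linepath (p T) (q T)")
      case True
      have "norm (contour_integral (linepath (p T) (q T)) f)
            \<le> norm (C * exp (- \<delta> * \<bar>Im (p T)\<bar>)) * norm (q T - p T)"
      proof (rule contour_integral_bound_linepath[OF True])
        fix x assume x: "x \<in> closed_segment (p T) (q T)"
        have "closed_segment (p T) (q T) \<subseteq> {z. c \<le> Re z} \<inter> {z. Re z \<le> d} \<inter> {z. Im z = Im (p T)}"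
          by (rule closed_segment_subset)
             (use p q in \<open>auto intro!: convex_Int convex_halfspace_Re_ge convex_halfspace_Re_le
                convex_Im_eq\<close>)
        with x have "Im x = Im (p T)" "Re x \<in> {c..d}" by auto
        thus "norm (f x) \<le> norm (C * exp (- \<delta> * \<bar>Im (p T)\<bar>))"
          using bound[of x] elim by (auto intro: order_trans)
      qed auto
      also have "q T - p T = of_real (Re (q T) - Re (p T))" using q(3)[of T] by (simp add: complex_eq_iff)
      also have "norm (\<dots> :: complex) \<le> d - c"
        using p[of T] q(1,2)[of T] unfolding norm_of_real by linarith
      finally show ?thesis by (simp add: mult_left_mono)
    next
      \<comment> \<open>A \<open>contour_integral\<close> that does not exist has the value 0, so
        the bound holds here as well.\<close>
      case False
      thus ?thesis using assms(2) by (simp add: not_integrable_contour_integral)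
    qed
  qed
qed

text \<open>Residue theorem on rectangles of growing height. The right side is traversed upwards and
  the left side downwards, and ds = i dy cancels the i of 2 pi i; hence the minus sign.
  \<open>P\<close> may contain poles to the right of \<open>d\<close>: their winding number is
  0.\<close>

lemma line_shift:
  assumes "c0 < c" "c < d" "d < d0" "finite P" "\<And>p. p \<in> P \<Longrightarrow> c < Re p \<and> Re p \<noteq> d"
    and hol: "f holomorphic_on {s. c0 < Re s \<and> Re s < d0} - P"
    and "\<delta> > 0"
    and bound: "\<And>s. c \<le> Re s \<Longrightarrow> Re s \<le> d \<Longrightarrow> Y \<le> \<bar>Im s\<bar> \<Longrightarrow> norm (f s) \<le> C * exp (- \<delta> * \<bar>Im s\<bar>)"
    and int: "integrable lborel (\<lambda>y. f (Complex c y))" "integrable lborel (\<lambda>y. f (Complex d y))"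
  shows "(\<integral>y. f (Complex c y) \<partial>lborel) = (\<integral>y. f (Complex d y) \<partial>lborel) -
            2 * pi * (\<Sum>p\<in>{p\<in>P. Re p < d}. residue f p)"
proof -
  let ?S = "{s. c0 < Re s \<and> Re s < d0}"
  have oS: "open ?S"
    by (intro open_Collect_conj open_Collect_less continuous_intros)
  have "convex ({s. Re s > c0} \<inter> {s. Re s < d0})"
    by (intro convex_Int convex_halfspace_Re_gt convex_halfspace_Re_lt)
  also have "{s. Re s > c0} \<inter> {s. Re s < d0} = ?S" by auto
  finally have conS: "connected ?S" by (rule convex_connected)
  obtain M where M: "\<And>p. p \<in> P \<Longrightarrow> \<bar>Im p\<bar> < M"
  proof -
    have "bounded (Im ` P)" using assms by (intro finite_imp_bounded) auto
    then obtain M where "\<And>p. p \<in> P \<Longrightarrow> \<bar>Im p\<bar> \<le> M" unfolding bounded_iff by auto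
    thus ?thesis by (intro that[of "M + 1"]) force
  qed
  have lim: "filterlim (\<lambda>T::real. (-T, T)) (at_bot \<times>\<^sub>F at_top) at_top"
    by (intro filterlim_Pair filterlim_ident filterlim_uminus_at_bot_at_top)
  have rect: "path_image (rectpath (Complex c (-T)) (Complex d T)) \<subseteq> ?S - P" if T: "T > M" "T > 0" for T
  proof -
    have "path_image (rectpath (Complex c (-T)) (Complex d T)) =
            cbox (Complex c (-T)) (Complex d T) - box (Complex c (-T)) (Complex d T)"
      by (rule path_image_rectpath_cbox_minus_box) (use T assms in auto)
    moreover have "p \<in> box (Complex c (-T)) (Complex d T) \<or> p \<notin> cbox (Complex c (-T)) (Complex d T)" if "p \<in> P" for p
      using assms(5)[OF that] M[OF that] T by (auto simp: in_box_complex_iff in_cbox_complex_iff)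
    ultimately have "path_image (rectpath (Complex c (-T)) (Complex d T)) \<inter> P = {}" by blast
    moreover have "cbox (Complex c (-T)) (Complex d T) \<subseteq> ?S"
      using assms(1-3) by (auto simp: in_cbox_complex_iff)
    ultimately show ?thesis using path_image_rectpath_subset_cbox[of "Complex c (-T)" "Complex d T"] T assms(2)
      by auto
  qed
  have cont: "continuous_on (path_image (rectpath (Complex c (-T)) (Complex d T))) f" if "T > M" "T > 0" for T
    using holomorphic_on_imp_continuous_on[OF hol] rect[OF that] continuous_on_subset by blast
  have res: "contour_integral (rectpath (Complex c (-T)) (Complex d T)) f =
               2 * pi * \<i> * (\<Sum>p\<in>{p\<in>P. Re p < d}. residue f p)" if T: "T > M" "T > 0" for T
  proof -
    have "contour_integral (rectpath (Complex c (-T)) (Complex d T)) f =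
            2 * pi * \<i> * (\<Sum>p\<in>P. winding_number (rectpath (Complex c (-T)) (Complex d T)) p * residue f p)"
    proof (rule Residue_theorem[OF oS conS assms(4) hol])
      show "\<forall>z. z \<notin> ?S \<longrightarrow> winding_number (rectpath (Complex c (-T)) (Complex d T)) z = 0"
        by (intro allI impI winding_number_rectpath_outside)
           (use T assms in \<open>auto simp: in_cbox_complex_iff\<close>)
    qed (use rect[OF T] in auto)
    also have "(\<Sum>p\<in>P. winding_number (rectpath (Complex c (-T)) (Complex d T)) p * residue f p) =
               (\<Sum>p\<in>P. if Re p < d then residue f p else 0)"
    proof (rule sum.cong)
      fix p assume p: "p \<in> P"
      show "winding_number (rectpath (Complex c (-T)) (Complex d T)) p * residue f p =
               (if Re p < d then residue f p else 0)"
      proof (cases "Re p < d")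
        case True
        hence "winding_number (rectpath (Complex c (-T)) (Complex d T)) p = 1"
          using assms(5)[OF p] M[OF p] T by (intro winding_number_rectpath) (auto simp: in_box_complex_iff)
        thus ?thesis using True by simp
      next
        case False
        hence "winding_number (rectpath (Complex c (-T)) (Complex d T)) p = 0"
          using assms(5)[OF p] M[OF p] T assms(2)
          by (intro winding_number_rectpath_outside) (auto simp: in_cbox_complex_iff)
        thus ?thesis using False by simp
      qed
    qed auto
    also have "\<dots> = (\<Sum>p\<in>{p\<in>P. Re p < d}. residue f p)"
      using assms(4) by (subst sum.inter_filter) auto
    finally show ?thesis by simp
  qed
  have hor: "((\<lambda>T. contour_integral (linepath (Complex c (u T)) (Complex d (u T))) f) \<longlongrightarrow> 0) at_top"
    if "u = uminus \<or> u = (\<lambda>T::real. T)" for u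
  proof (rule horizontal_integral_tendsto_0[OF assms(7) _ bound])
    show "filterlim (\<lambda>T. \<bar>Im (Complex c (u T))\<bar>) at_top at_top"
    proof -
      have "\<forall>\<^sub>F T in at_top. Z \<le> \<bar>T\<bar>" for Z :: real
        using eventually_ge_at_top[of Z] by eventually_elim auto
      thus ?thesis using that by (auto simp: filterlim_at_top)
    qed
  qed (use assms(2) in auto)
  have ver: "((\<lambda>T. contour_integral (linepath (Complex x (-T)) (Complex x T)) f) \<longlongrightarrow>
               \<i> * (\<integral>y. f (Complex x y) \<partial>lborel)) at_top"
    if "integrable lborel (\<lambda>y. f (Complex x y))" for x
    using filterlim_compose[OF tendsto_line_integral[OF that] lim] by simp
  let ?I = "\<lambda>T. contour_integral (rectpath (Complex c (-T)) (Complex d T)) f"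
  have "((\<lambda>T. contour_integral (linepath (Complex c (-T)) (Complex d (-T))) f +
           contour_integral (linepath (Complex d (-T)) (Complex d T)) f -
           contour_integral (linepath (Complex c T) (Complex d T)) f -
           contour_integral (linepath (Complex c (-T)) (Complex c T)) f) \<longlongrightarrow>
         0 + \<i> * (\<integral>y. f (Complex d y) \<partial>lborel) - 0 - \<i> * (\<integral>y. f (Complex c y) \<partial>lborel)) at_top"
    using hor[of uminus] hor[of "\<lambda>T. T"] ver[OF int(1)] ver[OF int(2)]
    by (intro tendsto_intros) auto
  moreover have "\<forall>\<^sub>F T in at_top. contour_integral (linepath (Complex c (-T)) (Complex d (-T))) f +
           contour_integral (linepath (Complex d (-T)) (Complex d T)) f -
           contour_integral (linepath (Complex c T) (Complex d T)) f -
           contour_integral (linepath (Complex c (-T)) (Complex c T)) f =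
             2 * pi * \<i> * (\<Sum>p\<in>{p\<in>P. Re p < d}. residue f p)"
    using eventually_gt_at_top[of M] eventually_gt_at_top[of 0]
  proof eventually_elim
    case (elim T)
    show ?case using contour_integral_rectpath_eq[OF cont[OF elim]] res[OF elim] by simp
  qed
  ultimately have "((\<lambda>T::real. 2 * pi * \<i> * (\<Sum>p\<in>{p\<in>P. Re p < d}. residue f p)) \<longlongrightarrow>
         0 + \<i> * (\<integral>y. f (Complex d y) \<partial>lborel) - 0 - \<i> * (\<integral>y. f (Complex c y) \<partial>lborel)) at_top"
    by (rule Lim_transform_eventually)
  hence "2 * pi * \<i> * (\<Sum>p\<in>{p\<in>P. Re p < d}. residue f p) =
         0 + \<i> * (\<integral>y. f (Complex d y) \<partial>lborel) - 0 - \<i> * (\<integral>y. f (Complex c y) \<partial>lborel)"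
    by (simp only: tendsto_const_iff trivial_limit_at_top_linorder not_False_eq_True)
  hence "\<i> * (\<integral>y. f (Complex c y) \<partial>lborel) = \<i> * ((\<integral>y. f (Complex d y) \<partial>lborel) -
            2 * pi * (\<Sum>p\<in>{p\<in>P. Re p < d}. residue f p))"
    by (simp add: algebra_simps)
  thus ?thesis by (simp only: mult_cancel_left) simp
qed

text \<open>The line is moved to the right by unit steps, each collecting the residues it crosses.
  The functional equation f(s + 1) = q(s) f(s) with |q| <= 1/2 far to the right makes the remaining
  integral at least halve in L1 norm at every step, so it vanishes in the limit without bounds on
  \<open>f\<close> that are uniform in Re s. Since Re (b i) - c is no integer, no pole lies on any
  of the lines used.\<close>

theorem barnes_series:
  fixes f :: "complex \<Rightarrow> complex" and b :: "'i \<Rightarrow> complex" and J :: "'i set"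
    and r :: "'i \<Rightarrow> nat \<Rightarrow> complex" and S :: "'i \<Rightarrow> complex"
  defines "P \<equiv> {b i + of_nat k |i k. i \<in> J}"
  assumes "finite J" and Reb: "\<And>i. i \<in> J \<Longrightarrow> Re (b i) > c \<and> Re (b i) - c \<notin> \<int>"
    and inj: "\<And>i j k l. i \<in> J \<Longrightarrow> j \<in> J \<Longrightarrow> b i + of_nat k = b j + of_nat l \<Longrightarrow> i = j"
    and "c0 < c" and hol: "f holomorphic_on {s. c0 < Re s} - P"
    and type: "strip_type f \<kappa>" "\<kappa> < 0"
    and ratio: "\<And>s. Re s \<ge> c \<Longrightarrow> s \<notin> P \<Longrightarrow> f (s + 1) = q s * f s"
    and q: "\<And>s. Re s \<ge> X \<Longrightarrow> norm (q s) \<le> 1/2"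
    and res: "\<And>i k. i \<in> J \<Longrightarrow> residue f (b i + of_nat k) = r i k"
    and sums: "\<And>i. i \<in> J \<Longrightarrow> r i sums S i"
  shows "(\<integral>y. f (Complex c y) \<partial>lborel) = - 2 * pi * (\<Sum>i\<in>J. S i)"
    and "integrable lborel (\<lambda>y. f (Complex c y))"
proof -
  have line: "Complex (c + of_nat N) y \<notin> P" for N y
  proof
    assume "Complex (c + of_nat N) y \<in> P"
    then obtain i k where "i \<in> J" "Complex (c + of_nat N) y = b i + of_nat k" unfolding P_def by auto
    hence "Re (b i) - c = of_int (int N - int k)" by (auto simp: complex_eq_iff)
    thus False using Reb[OF \<open>i \<in> J\<close>] by (metis Ints_of_int)
  qed
  have int: "integrable lborel (\<lambda>y. f (Complex (c + of_nat N) y))" for N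
  proof (rule line_integrable[OF type])
    show "continuous_on UNIV (\<lambda>y. f (Complex (c + real N) y))"
      by (rule continuous_on_compose2[OF holomorphic_on_imp_continuous_on[OF hol]])
         (use line assms(5) in \<open>auto intro!: continuous_intros\<close>)
  qed
  from int[of 0] show "integrable lborel (\<lambda>y. f (Complex c y))" by simp
  define I where "I = (\<lambda>N. \<integral>y. f (Complex (c + of_nat N) y) \<partial>lborel)"
  define A where "A = (\<lambda>i N. {k. Re (b i) + of_nat k < c + of_nat N})"
  have A: "A i N = {..<nat \<lceil>c + of_nat N - Re (b i)\<rceil>}" for i N
    unfolding A_def by (auto simp: less_ceiling_iff zless_nat_eq_int_zless algebra_simps)
  have shift: "I 0 = I N - 2 * pi * (\<Sum>i\<in>J. \<Sum>k\<in>A i N. r i k)" if "N > 0" for N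
  proof -
    \<comment> \<open>The bound N + 1 instead of N gives \<open>line_shift\<close> an open strip
      around the closed rectangle in which \<open>PN\<close> contains all poles; those beyond the
      line c + N are dropped again by the condition Re p < c + N.\<close>
    define PN where "PN = {b i + of_nat k |i k. i \<in> J \<and> Re (b i) + of_nat k < c + of_nat (N+1)}"
    have PN: "PN = (\<lambda>(i,k). b i + of_nat k) ` (SIGMA i:J. A i (N+1))"
      unfolding PN_def A_def by auto
    have fin: "finite PN" unfolding PN using assms(2) by (auto simp: A)
    obtain C Y \<delta> where C: "C > 0" "\<delta> > 0" "\<And>s. c \<le> Re s \<Longrightarrow> Re s \<le> c + N \<Longrightarrow> Y \<le> \<bar>Im s\<bar> \<Longrightarrow>
        norm (f s) \<le> C * exp (- \<delta> * \<bar>Im s\<bar>)"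
      using strip_type_decay[OF type, where ?x0.0 = c and ?x1.0 = "c + N"] by metis
    have "(\<integral>y. f (Complex c y) \<partial>lborel) = (\<integral>y. f (Complex (c + N) y) \<partial>lborel) -
            2 * pi * (\<Sum>p\<in>{p\<in>PN. Re p < c + N}. residue f p)"
    proof (rule line_shift[OF assms(5) _ _ fin _ _ C(2) C(3)])
      show "c + real N < c + real (N + 1)" by simp
      show "c < Re p \<and> Re p \<noteq> c + real N" if p: "p \<in> PN" for p
      proof -
        have "p \<in> P" "c < Re p" using p Reb unfolding PN_def P_def by force+
        moreover have "p = Complex (Re p) (Im p)" by simp
        ultimately show ?thesis using line[of N "Im p"] by metis
      qed
      have "{s. c0 < Re s \<and> Re s < c + real (N + 1)} - PN \<subseteq> {s. c0 < Re s} - P"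
        unfolding PN_def P_def by auto
      thus "f holomorphic_on {s. c0 < Re s \<and> Re s < c + real (N + 1)} - PN"
        using hol holomorphic_on_subset by blast
    qed (use int[of 0] int[of N] that in auto)
    moreover have "{p\<in>PN. Re p < c + N} = (\<lambda>(i,k). b i + of_nat k) ` (SIGMA i:J. A i N)"
      unfolding PN_def A_def by (auto simp: image_iff) fastforce+
    moreover have "inj_on (\<lambda>(i,k). b i + of_nat k) (SIGMA i:J. A i N)"
    proof (rule inj_onI, clarify)
      fix i k j l assume ij: "i \<in> J" "j \<in> J" and eq: "b i + of_nat k = b j + of_nat l"
      from inj[OF ij eq] eq show "i = j \<and> k = l" by simp
    qed
    ultimately show ?thesis unfolding I_def
      using assms(2) by (simp add: sum.reindex sum.Sigma A case_prod_unfold) (auto intro!: sum.cong simp: res)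
  qed
  have lim1: "(\<lambda>N. \<Sum>i\<in>J. \<Sum>k\<in>A i N. r i k) \<longlonglongrightarrow> (\<Sum>i\<in>J. S i)"
  proof (intro tendsto_sum)
    fix i assume "i \<in> J"
    have "filterlim (\<lambda>N. nat \<lceil>c + real N - Re (b i)\<rceil>) at_top sequentially"
    proof (rule filterlim_at_top_mono)
      show "filterlim (\<lambda>N. N - nat \<lceil>\<bar>Re (b i) - c\<bar>\<rceil>) at_top sequentially"
        by (rule filterlim_minus_const_nat_at_top)
      show "\<forall>\<^sub>F N in sequentially. N - nat \<lceil>\<bar>Re (b i) - c\<bar>\<rceil> \<le> nat \<lceil>c + real N - Re (b i)\<rceil>"
        by (intro always_eventually allI) linarith
    qed
    thus "(\<lambda>N. \<Sum>k\<in>A i N. r i k) \<longlonglongrightarrow> S i"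
      unfolding A using sums[OF \<open>i \<in> J\<close>] unfolding sums_def by (rule filterlim_compose[rotated])
  qed
  have lim2: "I \<longlonglongrightarrow> 0"
  proof -
    obtain N0 :: nat where N0: "X - c \<le> N0" using real_arch_simple by blast
    define D where "D = (\<integral>y. norm (f (Complex (c + N0) y)) \<partial>lborel)"
    have step: "(\<integral>y. norm (f (Complex (c + of_nat (Suc N)) y)) \<partial>lborel) \<le>
                  1/2 * (\<integral>y. norm (f (Complex (c + of_nat N) y)) \<partial>lborel)" if "N \<ge> N0" for N
    proof -
      have "norm (f (Complex (c + of_nat (Suc N)) y)) \<le> 1/2 * norm (f (Complex (c + of_nat N) y))" for y
      proof -
        have "Complex (c + of_nat (Suc N)) y = Complex (c + of_nat N) y + 1" by (simp add: complex_eq_iff)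
        hence "norm (f (Complex (c + of_nat (Suc N)) y)) =
            norm (q (Complex (c + of_nat N) y)) * norm (f (Complex (c + of_nat N) y))"
          using ratio[OF _ line[of N y]] assms(5) by (simp add: norm_mult)
        also have "\<dots> \<le> 1/2 * norm (f (Complex (c + of_nat N) y))"
          by (intro mult_right_mono q) (use N0 that in auto)
        finally show ?thesis .
      qed
      thus ?thesis using int[of N] int[of "Suc N"]
        by (subst Bochner_Integration.integral_mult_right_zero[symmetric])
           (intro integral_mono integrable_norm Bochner_Integration.integrable_mult_right, auto)
    qed
    have geo: "(\<integral>y. norm (f (Complex (c + of_nat (N0 + n)) y)) \<partial>lborel) \<le> D * (1/2) ^ n" for n
    proof (induction n)
      case (Suc n)
      thus ?case using step[of "N0 + n"] by simp
    qed (simp add: D_def)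
    have "(\<lambda>n. I (n + N0)) \<longlonglongrightarrow> 0"
    proof (rule tendsto_0_le)
      show "(\<lambda>n. D * (1/2) ^ n) \<longlonglongrightarrow> 0"
        by (intro tendsto_mult_right_zero LIMSEQ_power_zero) auto
      show "\<forall>\<^sub>F n in sequentially. norm (I (n + N0)) \<le> norm (D * (1/2) ^ n) * 1"
      proof (intro always_eventually allI)
        fix n
        have "norm (I (n + N0)) \<le> (\<integral>y. norm (f (Complex (c + of_nat (N0 + n)) y)) \<partial>lborel)"
          unfolding I_def by (subst add.commute[of n]) (rule integral_norm_bound)
        with geo[of n] show "norm (I (n + N0)) \<le> norm (D * (1/2) ^ n) * 1" by simp
      qed
    qed
    thus ?thesis by (rule LIMSEQ_offset)
  qed
  have "(\<lambda>N. I N - 2 * pi * (\<Sum>i\<in>J. \<Sum>k\<in>A i N. r i k)) \<longlonglongrightarrow> 0 - 2 * pi * (\<Sum>i\<in>J. S i)"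
    by (intro tendsto_intros lim1 lim2)
  moreover have "\<forall>\<^sub>F N in sequentially. I N - 2 * pi * (\<Sum>i\<in>J. \<Sum>k\<in>A i N. r i k) = I 0"
    using eventually_gt_at_top[of 0] by eventually_elim (use shift in simp)
  ultimately have "(\<lambda>N. I 0) \<longlonglongrightarrow> 0 - 2 * pi * (\<Sum>i\<in>J. S i)" by (rule Lim_transform_eventually)
  hence "I 0 = 0 - 2 * pi * (\<Sum>i\<in>J. S i)" by (simp only: LIMSEQ_const_iff)
  thus "(\<integral>y. f (Complex c y) \<partial>lborel) = - 2 * pi * (\<Sum>i\<in>J. S i)" by (simp add: I_def)
qed

section \<open>Independence of the contour\<close>

lemma vertical_contour_bound:
  assumes "vertical_contour L"
  obtains M where "\<And>y. \<bar>Re (L y)\<bar> \<le> M" "M \<ge> 0"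
proof -
  obtain M where "\<And>y. \<bar>Re (L y)\<bar> \<le> M" using assms unfolding vertical_contour_def bounded_iff by auto
  moreover from this[of 0] have "M \<ge> 0" by linarith
  ultimately show ?thesis using that by blast
qed

text \<open>The range of a contour is not compact, but Im (L y) is unbounded at both ends, so only a
  compact piece of the curve comes near a given height.\<close>

lemma open_Compl_vertical_contour:
  assumes "vertical_contour L"
  shows "open (- range L)"
proof (subst open_subopen, intro ballI)
  fix w assume w: "w \<in> - range L"
  obtain b0 where b0: "\<And>y. y \<ge> b0 \<Longrightarrow> Im (L y) \<ge> \<bar>Im w\<bar> + 1"
    using assms unfolding vertical_contour_def filterlim_at_top eventually_at_top_linorder by metis
  obtain a0 where a0: "\<And>y. y \<le> a0 \<Longrightarrow> Im (L y) \<le> - (\<bar>Im w\<bar> + 1)"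
    using assms unfolding vertical_contour_def filterlim_at_bot eventually_at_bot_linorder by metis
  let ?T = "{z. \<bar>Im z\<bar> < \<bar>Im w\<bar> + 1} - path_image (subpath a0 b0 L)"
  have "compact (path_image (subpath a0 b0 L))"
    using assms unfolding vertical_contour_def by (auto intro: compact_valid_path_image)
  hence "open ?T"
    by (intro open_Diff open_Collect_less continuous_intros compact_imp_closed)
  moreover have "w \<in> ?T" using w by (auto simp: path_image_subpath_gen)
  moreover have "?T \<subseteq> - range L"
  proof (intro subsetI ComplI)
    fix z assume z: "z \<in> ?T" "z \<in> range L"
    then obtain y where y: "z = L y" by auto
    have "\<not> y \<ge> b0" "\<not> y \<le> a0" using b0[of y] a0[of y] z y by auto
    hence "y \<in> closed_segment a0 b0" by (auto simp: closed_segment_eq_real_ivl)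
    thus False using z y by (auto simp: path_image_subpath_gen)
  qed
  ultimately show "\<exists>T. open T \<and> w \<in> T \<and> T \<subseteq> - range L" by blast
qed

text \<open>The piece of the contour between the parameters a and b, completed to a loop by two
  horizontal segments and a piece of the line Re = d traversed from the height of L b to that of L
  a.\<close>

definition close_up :: "(real \<Rightarrow> complex) \<Rightarrow> real \<Rightarrow> real \<Rightarrow> real \<Rightarrow> real \<Rightarrow> complex" where
  "close_up L a b d = subpath a b L +++ linepath (L b) (Complex d (Im (L b))) +++
     linepath (Complex d (Im (L b))) (Complex d (Im (L a))) +++ linepath (Complex d (Im (L a))) (L a)"

lemma close_up_path [simp]:
  assumes "vertical_contour L"
  shows "valid_path (close_up L a b d)" "path (close_up L a b d)"
        "pathfinish (close_up L a b d) = pathstart (close_up L a b d)"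
  using assms unfolding vertical_contour_def close_up_def
  by (auto intro!: valid_path_join valid_path_imp_path)

lemma path_image_close_up:
  "path_image (close_up L a b d) = L ` closed_segment a b \<union> closed_segment (L b) (Complex d (Im (L b))) \<union>
     closed_segment (Complex d (Im (L b))) (Complex d (Im (L a))) \<union> closed_segment (Complex d (Im (L a))) (L a)"
  unfolding close_up_def by (simp add: path_image_join path_image_subpath_gen Un_assoc)

lemma horizontal_segment_Im: "x \<in> closed_segment z (Complex d (Im z)) \<Longrightarrow> Im x = Im z"
                      "x \<in> closed_segment (Complex d (Im z)) z \<Longrightarrow> Im x = Im z"
  using closed_segment_subset[OF _ _ convex_Im_eq[of "Im z"], of z "Complex d (Im z)"]
        closed_segment_subset[OF _ _ convex_Im_eq[of "Im z"], of "Complex d (Im z)" z] by auto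

lemma convex_Re_eq: "convex {z. Re z = k}"
proof -
  have "{z. Re z = k} = {z. Re z \<le> k} \<inter> {z. k \<le> Re z}" by auto
  thus ?thesis by (simp add: convex_Int convex_halfspace_Re_le convex_halfspace_Re_ge)
qed

lemma vertical_segment_Re: "x \<in> closed_segment (Complex d u) (Complex d v) \<Longrightarrow> Re x = d"
  using closed_segment_subset[OF _ _ convex_Re_eq[of d], of "Complex d u" "Complex d v"] by auto

lemma path_image_close_up_subset:
  assumes "convex H" "\<And>y. L y \<in> H" "\<And>y. Complex d (Im (L y)) \<in> H"
  shows "path_image (close_up L a b d) \<subseteq> H"
  unfolding path_image_close_up
  using assms by (intro Un_least closed_segment_subset) auto

lemma eventually_high:
  assumes "vertical_contour L"
  shows "\<forall>\<^sub>F (a, b) in at_bot \<times>\<^sub>F at_top. Im (L a) < - B \<and> B < Im (L b)"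
proof -
  have "\<forall>\<^sub>F a in at_bot. Im (L a) < - B" "\<forall>\<^sub>F b in at_top. B < Im (L b)"
    using assms unfolding vertical_contour_def filterlim_at_top_dense filterlim_at_bot_dense by blast+
  from eventually_prodI[OF this] show ?thesis by (simp add: case_prod_unfold)
qed

text \<open>The closing line is first pushed far away from the path that joins \<open>w\<close> to a real point beyond
  the contour, so that the winding number is constant along that path; moving the line back to
  abscissa \<open>c\<close> never meets \<open>w\<close>.\<close>

lemma winding_number_close_up_aux:
  assumes L: "vertical_contour L" and M: "\<And>y. \<bar>Re (L y)\<bar> \<le> M" "M \<ge> 0"
    and conn: "connected_component (- range L) w (complex_of_real x)"
    and side: "c < Re w \<and> M < x \<or> Re w < c \<and> x < - M"
  shows "\<forall>\<^sub>F (a, b) in at_bot \<times>\<^sub>F at_top. winding_number (close_up L a b c) w = 0"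
proof -
  have "path_component (- range L) w (of_real x)"
    using conn open_path_connected_component[OF open_Compl_vertical_contour[OF L]] by simp
  then obtain q where q: "path q" "path_image q \<subseteq> - range L" "pathstart q = w" "pathfinish q = of_real x"
    unfolding path_component_def by auto
  obtain B where B: "\<And>z. z \<in> path_image q \<Longrightarrow> norm z \<le> B"
    using compact_imp_bounded[OF compact_path_image[OF q(1)]] unfolding bounded_iff by auto
  have wq: "w \<in> path_image q" "of_real x \<in> path_image q"
    using q pathstart_in_path_image pathfinish_in_path_image by metis+
  have wL: "w \<notin> range L" using wq q by auto
  have "B \<ge> 0" using B[OF wq(1)] norm_ge_zero order_trans by blast
  \<comment> \<open>Large enough for the line Re = d, on the side of c away from w, to miss both the
    contour and the disc of radius \<open>B\<close> that contains the joining path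
    \<open>q\<close>.\<close>
  define K where "K = B + 1 + \<bar>c\<bar> + M"
  define d where "d = (if c < Re w then - K else K)"
  \<comment> \<open>A half-plane containing the whole loop closed at d but not the end point x of
    \<open>q\<close>; the winding number around x is therefore 0.\<close>
  define H where "H = (if c < Re w then {z. Re z \<le> M} else {z. - M \<le> Re z})"
  have H: "convex H" unfolding H_def by (auto intro: convex_halfspace_Re_le convex_halfspace_Re_ge)
  have LH: "L y \<in> H" "Complex d (Im (L y)) \<in> H" for y
    using M(1)[of y] M(2) \<open>B \<ge> 0\<close> by (auto simp: H_def d_def K_def)
  have xH: "of_real x \<notin> H" using side by (auto simp: H_def)
  \<comment> \<open>Contains every vertical segment swept when the closing line moves from d to c,
    but not w.\<close>
  define G where "G = (if c < Re w then {z. Re z \<le> c} else {z. c \<le> Re z})"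
  have G: "convex G" unfolding G_def by (auto intro: convex_halfspace_Re_le convex_halfspace_Re_ge)
  have wG: "w \<notin> G" using side by (auto simp: G_def)
  have lineG: "linepath (Complex e u) (Complex e v) r \<in> G" if "e = c \<or> e = d" for e u v r
    using that M(2) \<open>B \<ge> 0\<close> by (auto simp: G_def d_def K_def linepath_def algebra_simps)
  from eventually_high[OF L, of B] show ?thesis
  proof (rule eventually_mono, clarify)
    fix a b assume ab: "Im (L a) < - B" "B < Im (L b)"
    have disj: "path_image q \<inter> path_image (close_up L a b d) = {}"
    proof (rule ccontr)
      assume "path_image q \<inter> path_image (close_up L a b d) \<noteq> {}"
      then obtain z where z: "z \<in> path_image q" "z \<in> path_image (close_up L a b d)" by auto
      have z': "\<bar>Re z\<bar> \<le> B" "\<bar>Im z\<bar> \<le> B"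
        using B[OF z(1)] abs_Re_le_cmod[of z] abs_Im_le_cmod[of z] by linarith+
      have "z \<notin> range L" using z q by auto
      with z(2) consider "z \<in> closed_segment (L b) (Complex d (Im (L b)))"
        | "z \<in> closed_segment (Complex d (Im (L b))) (Complex d (Im (L a)))"
        | "z \<in> closed_segment (Complex d (Im (L a))) (L a)" unfolding path_image_close_up by auto
      thus False
      proof cases
        case 1 thus ?thesis using horizontal_segment_Im(1)[OF 1] z' ab by linarith
      next
        case 2 thus ?thesis using vertical_segment_Re[OF 2] z' M(2) by (auto simp: d_def K_def split: if_splits)
      next
        case 3 thus ?thesis using horizontal_segment_Im(2)[OF 3] z' ab by linarith
      qed
    qed
    have "winding_number (close_up L a b d) w = winding_number (close_up L a b d) (of_real x)"
      by (rule winding_number_eq[OF _ _ wq connected_path_image[OF q(1)] disj]) (use L in auto)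
    also have "\<dots> = 0"
      using path_image_close_up_subset[OF H LH(1) LH(2)]
      by (intro winding_number_zero_outside[OF _ H _ xH]) (use L in auto)
    finally have "winding_number (close_up L a b d) w = 0" .
    moreover have "winding_number (close_up L a b c) w = winding_number (close_up L a b d) w"
    proof (rule winding_number_loops_linear_eq)
      fix r :: real assume "r \<in> {0..1}"
      have Imw: "\<bar>Im w\<bar> \<le> B" using B[OF wq(1)] abs_Im_le_cmod[of w] by linarith
      have hor: "w \<notin> closed_segment p p'" if "Im p = k" "Im p' = k" "\<bar>k\<bar> > B" for p p' k
        using closed_segment_subset[OF _ _ convex_Im_eq[of k], of p p'] that Imw by auto
      have ver: "w \<notin> closed_segment p p'" if "p \<in> G" "p' \<in> G" for p p'
        using closed_segment_subset[OF that G] wG by auto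
      \<comment> \<open>The joins in \<open>close_up\<close> associate to the right, so the four
        pieces occupy the parameter intervals with break points 1/2, 3/4 and 7/8.\<close>
      consider "r \<le> 1/2" | "r > 1/2" "2*r-1 \<le> 1/2" | "2*r-1 > 1/2" "2*(2*r-1)-1 \<le> 1/2"
        | "2*(2*r-1)-1 > 1/2" by linarith
      thus "w \<notin> closed_segment (close_up L a b d r) (close_up L a b c r)"
      proof cases
        case 1
        thus ?thesis using wL by (auto simp: close_up_def joinpaths_def subpath_def)
      next
        case 2
        show ?thesis
          by (rule hor[of _ "Im (L b)"])
             (use 2 ab \<open>B \<ge> 0\<close> in \<open>auto simp: close_up_def joinpaths_def linepath_def algebra_simps\<close>)
      next
        case 3
        show ?thesis
          by (rule ver) (use 3 lineG in \<open>auto simp: close_up_def joinpaths_def\<close>)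
      next
        case 4
        show ?thesis
          by (rule hor[of _ "Im (L a)"])
             (use 4 ab \<open>B \<ge> 0\<close> in \<open>auto simp: close_up_def joinpaths_def linepath_def algebra_simps\<close>)
      qed
    qed (use L in auto)
    ultimately show "winding_number (close_up L a b c) w = 0" by simp
  qed
qed

lemma winding_number_close_up:
  assumes L: "vertical_contour L"
    and side: "w \<in> right_of L \<and> c < Re w \<or> w \<in> left_of L \<and> Re w < c"
  shows "\<forall>\<^sub>F (a, b) in at_bot \<times>\<^sub>F at_top. winding_number (close_up L a b c) w = 0"
proof -
  obtain M where M: "\<And>y. \<bar>Re (L y)\<bar> \<le> M" "M \<ge> 0" using vertical_contour_bound[OF L] by blast
  from side show ?thesis
  proof
    assume w: "w \<in> right_of L \<and> c < Re w"
    hence "\<forall>\<^sub>F x in at_top. connected_component (- range L) w (complex_of_real x) \<and> M < x"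
      unfolding right_of_def by (auto intro: eventually_conj eventually_gt_at_top)
    then obtain x where "connected_component (- range L) w (complex_of_real x)" "M < x"
      using eventually_happens'[OF trivial_limit_at_top_linorder] by blast
    thus ?thesis using winding_number_close_up_aux[OF L M] w by blast
  next
    assume w: "w \<in> left_of L \<and> Re w < c"
    hence "\<forall>\<^sub>F x in at_bot. connected_component (- range L) w (complex_of_real x) \<and> x < - M"
      unfolding left_of_def by (auto intro: eventually_conj eventually_gt_at_bot)
    then obtain x where "connected_component (- range L) w (complex_of_real x)" "x < - M"
      using eventually_happens'[OF trivial_limit_at_bot_linorder] by blast
    thus ?thesis using winding_number_close_up_aux[OF L M] w by blast
  qed
qed

lemma left_right_of_not_in_range: "w \<in> right_of L \<or> w \<in> left_of L \<Longrightarrow> w \<notin> range L"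
proof -
  assume "w \<in> right_of L \<or> w \<in> left_of L"
  then obtain x where "connected_component (- range L) w (complex_of_real x)"
    unfolding right_of_def left_of_def
    using eventually_happens'[OF trivial_limit_at_top_linorder] eventually_happens'[OF trivial_limit_at_bot_linorder]
    by blast
  thus ?thesis using connected_component_in by fastforce
qed

text \<open>Every pole lies on the same side of \<open>L\<close> as of the line Re = c, so loops
  that close \<open>L\<close> along this line eventually do not wind around it, and the global
  Cauchy theorem applies. The poles are real, hence the horizontal closing segments miss them once
  their heights have opposite signs; the integrals over these segments vanish in the limit.\<close>

theorem contour_independence:
  assumes L: "vertical_contour L" and hol: "f holomorphic_on - P"
    and P: "\<And>p. p \<in> P \<Longrightarrow> Im p = 0" "\<And>r. finite {p\<in>P. \<bar>Re p\<bar> \<le> r}"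
    and side: "\<And>p. p \<in> P \<Longrightarrow> p \<in> right_of L \<and> c < Re p \<or> p \<in> left_of L \<and> Re p < c"
    and type: "strip_type f \<kappa>" "\<kappa> < 0"
    and int: "integrable lborel (\<lambda>y. f (Complex c y))"
    and v: "has_line_integral f v L"
  shows "v = \<i> * (\<integral>y. f (Complex c y) \<partial>lborel)"
proof -
  obtain M where M: "\<And>y. \<bar>Re (L y)\<bar> \<le> M" "M \<ge> 0" using vertical_contour_bound[OF L] by blast
  define r where "r = max M \<bar>c\<bar>"
  have r: "\<bar>Re (L y)\<bar> \<le> r" "\<bar>c\<bar> \<le> r" for y using M(1)[of y] by (auto simp: r_def)
  have opn: "open (- P)"
  proof (subst open_subopen, intro ballI)
    fix w assume w: "w \<in> - P"
    let ?T = "{z. \<bar>Re z\<bar> < \<bar>Re w\<bar> + 1} - {p\<in>P. \<bar>Re p\<bar> \<le> \<bar>Re w\<bar> + 1}"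
    have "open ?T" using P(2)
      by (intro open_Diff open_Collect_less continuous_intros finite_imp_closed)
    thus "\<exists>T. open T \<and> w \<in> T \<and> T \<subseteq> - P" using w by (intro exI[of _ ?T]) auto
  qed
  \<comment> \<open>How far the loop must extend depends on the pole, so finiteness of the set
    within |Re| <= r is essential. Poles outside this strip are separated from the loop by convexity
    of the strip.\<close>
  have wind: "\<forall>\<^sub>F z in at_bot \<times>\<^sub>F at_top. \<forall>p\<in>{p\<in>P. \<bar>Re p\<bar> \<le> r}. winding_number (close_up L (fst z) (snd z) c) p = 0"
    using winding_number_close_up[OF L side] P(2)
    by (intro eventually_ball_finite) (auto simp: case_prod_unfold)
  obtain C Y \<delta> where C: "C > 0" "\<delta> > 0" "\<And>s. -r \<le> Re s \<Longrightarrow> Re s \<le> r \<Longrightarrow> Y \<le> \<bar>Im s\<bar> \<Longrightarrow>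
      norm (f s) \<le> C * exp (- \<delta> * \<bar>Im s\<bar>)"
    using strip_type_decay[OF type, where ?x0.0 = "-r" and ?x1.0 = r] by metis
  define I1 where "I1 = (\<lambda>z::real\<times>real. contour_integral (linepath (L (snd z)) (Complex c (Im (L (snd z))))) f)"
  define I2 where "I2 = (\<lambda>z::real\<times>real. contour_integral (linepath (Complex c (Im (L (fst z)))) (Complex c (Im (L (snd z))))) f)"
  define I3 where "I3 = (\<lambda>z::real\<times>real. contour_integral (linepath (Complex c (Im (L (fst z)))) (L (fst z))) f)"
  have hb: "filterlim (\<lambda>z. Im (L (snd z))) at_top (at_bot \<times>\<^sub>F at_top)"
    and ha: "filterlim (\<lambda>z. Im (L (fst z))) at_bot (at_bot \<times>\<^sub>F at_top)"
    using L unfolding vertical_contour_def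
    by (auto intro: filterlim_compose[OF _ filterlim_snd] filterlim_compose[OF _ filterlim_fst])
  have "(I1 \<longlongrightarrow> 0) (at_bot \<times>\<^sub>F at_top)"
    unfolding I1_def
  proof (rule horizontal_integral_tendsto_0[OF C(2) _ C(3)])
    show "filterlim (\<lambda>T::real\<times>real. \<bar>Im (L (snd T))\<bar>) at_top (at_bot \<times>\<^sub>F at_top)"
      by (rule filterlim_at_top_mono[OF hb]) (intro always_eventually allI abs_ge_self)
  qed (use r in \<open>auto simp: abs_le_iff minus_le_iff\<close>)
  moreover have "(I3 \<longlongrightarrow> 0) (at_bot \<times>\<^sub>F at_top)"
    unfolding I3_def
  proof (rule horizontal_integral_tendsto_0[OF C(2) _ C(3)])
    have "filterlim (\<lambda>T. - Im (L (fst T))) at_top (at_bot \<times>\<^sub>F at_top)"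
      using ha by (simp add: filterlim_uminus_at_bot)
    thus "filterlim (\<lambda>T::real\<times>real. \<bar>Im (Complex c (Im (L (fst T))))\<bar>) at_top (at_bot \<times>\<^sub>F at_top)"
      by (rule filterlim_at_top_mono) (simp, intro always_eventually allI abs_ge_minus_self)
  qed (use r in \<open>auto simp: abs_le_iff minus_le_iff\<close>)
  moreover have "(I2 \<longlongrightarrow> \<i> * (\<integral>y. f (Complex c y) \<partial>lborel)) (at_bot \<times>\<^sub>F at_top)"
    using filterlim_compose[OF tendsto_line_integral[OF int] filterlim_Pair[OF ha hb]]
    unfolding I2_def by simp
  ultimately have "((\<lambda>z. I2 z - I1 z - I3 z) \<longlongrightarrow> \<i> * (\<integral>y. f (Complex c y) \<partial>lborel) - 0 - 0) (at_bot \<times>\<^sub>F at_top)"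
    by (intro tendsto_diff)
  moreover have "\<forall>\<^sub>F z in at_bot \<times>\<^sub>F at_top. I2 z - I1 z - I3 z = contour_integral (subpath (fst z) (snd z) L) f"
    using wind eventually_high[OF L, of 0]
  proof eventually_elim
    case (elim z)
    obtain a b where z: "z = (a, b)" by (cases z)
    let ?g = "close_up L a b c"
    have ab: "Im (L a) < 0" "0 < Im (L b)" using elim z by auto
    have img: "path_image ?g \<subseteq> - P"
    proof (intro subsetI ComplI)
      fix p assume p: "p \<in> path_image ?g" "p \<in> P"
      have "p \<notin> range L" using side[OF p(2)] left_right_of_not_in_range by blast
      with p(1) consider "p \<in> closed_segment (L b) (Complex c (Im (L b)))"
        | "p \<in> closed_segment (Complex c (Im (L b))) (Complex c (Im (L a)))"
        | "p \<in> closed_segment (Complex c (Im (L a))) (L a)" unfolding path_image_close_up by auto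
      thus False
      proof cases
        case 1 thus ?thesis using horizontal_segment_Im(1)[OF 1] P(1)[OF p(2)] ab by linarith
      next
        case 2 thus ?thesis using vertical_segment_Re[OF 2] side[OF p(2)] by auto
      next
        case 3 thus ?thesis using horizontal_segment_Im(2)[OF 3] P(1)[OF p(2)] ab by linarith
      qed
    qed
    have 0: "(f has_contour_integral 0) ?g"
    proof (rule Cauchy_theorem_global[OF opn hol _ _ img])
      fix w assume "w \<notin> - P"
      show "winding_number ?g w = 0"
      proof (cases "\<bar>Re w\<bar> \<le> r")
        case True
        thus ?thesis using elim(1) \<open>w \<notin> - P\<close> z by auto
      next
        case False
        let ?H = "{z. - r \<le> Re z} \<inter> {z. Re z \<le> r}"
        have H: "convex ?H" by (intro convex_Int convex_halfspace_Re_le convex_halfspace_Re_ge)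
        have "path_image ?g \<subseteq> ?H"
          by (rule path_image_close_up_subset[OF H]) (use r in \<open>auto simp: abs_le_iff minus_le_iff\<close>)
        thus ?thesis using False H L
          by (intro winding_number_zero_outside[where s = ?H]) auto
      qed
    qed (use L in auto)
    have vp: "valid_path (subpath a b L)" using L unfolding vertical_contour_def by auto
    have ci: "f contour_integrable_on subpath a b L"
             "f contour_integrable_on linepath (L b) (Complex c (Im (L b)))"
             "f contour_integrable_on linepath (Complex c (Im (L b))) (Complex c (Im (L a)))"
             "f contour_integrable_on linepath (Complex c (Im (L a))) (L a)"
    proof -
      have "path_image (subpath a b L) \<subseteq> - P"
        using img unfolding path_image_close_up path_image_subpath_gen by blast
      thus "f contour_integrable_on subpath a b L"
        by (intro contour_integrable_holomorphic_simple[OF hol opn] vp)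
    qed (use img in \<open>auto intro!: contour_integrable_holomorphic_simple[OF hol opn] simp: path_image_close_up\<close>)
    have "0 = contour_integral ?g f" using contour_integral_unique[OF 0] by simp
    also have "\<dots> = contour_integral (subpath a b L) f + (contour_integral (linepath (L b) (Complex c (Im (L b)))) f +
             (contour_integral (linepath (Complex c (Im (L b))) (Complex c (Im (L a)))) f +
             contour_integral (linepath (Complex c (Im (L a))) (L a)) f))"
      unfolding close_up_def using ci vp by (simp add: contour_integral_join contour_integrable_joinI valid_path_join)
    also have "contour_integral (linepath (Complex c (Im (L b))) (Complex c (Im (L a)))) f =
               - contour_integral (linepath (Complex c (Im (L a))) (Complex c (Im (L b)))) f"
      using img unfolding path_image_close_up
      by (intro contour_integral_reverse_linepath continuous_on_subset[OF holomorphic_on_imp_continuous_on[OF hol]]) auto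
    finally show ?case unfolding I1_def I2_def I3_def z by (simp add: algebra_simps)
  qed
  ultimately have "((\<lambda>z. contour_integral (subpath (fst z) (snd z) L) f) \<longlongrightarrow> \<i> * (\<integral>y. f (Complex c y) \<partial>lborel)) (at_bot \<times>\<^sub>F at_top)"
    by (simp add: tendsto_cong)
  moreover have "((\<lambda>z. contour_integral (subpath (fst z) (snd z) L) f) \<longlongrightarrow> v) (at_bot \<times>\<^sub>F at_top)"
    using v unfolding has_line_integral_def by (simp add: case_prod_unfold)
  ultimately show ?thesis
    by (intro tendsto_unique[of "at_bot \<times>\<^sub>F at_top"]) (auto simp: prod_filter_eq_bot)
qed

section \<open>The Meijer function as an integral along a straight line\<close>

lemma subpath_vertical_line: "subpath a b (Complex c) = linepath (Complex c a) (Complex c b)"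
  by (auto simp: subpath_def linepath_def complex_eq_iff algebra_simps)

lemma vertical_contour_line: "vertical_contour (Complex c)"
  unfolding vertical_contour_def subpath_vertical_line by (auto intro: filterlim_ident)

lemma right_of_line:
  assumes "c < Re w"
  shows "w \<in> right_of (Complex c)"
  unfolding right_of_def mem_Collect_eq
  using eventually_gt_at_top[of c]
proof eventually_elim
  case (elim x)
  have "connected {z. c < Re z}" by (intro convex_connected convex_halfspace_Re_gt)
  thus ?case unfolding connected_component_def
    by (intro exI[of _ "{z. c < Re z}"]) (use elim assms in auto)
qed

lemma left_of_line:
  assumes "Re w < c"
  shows "w \<in> left_of (Complex c)"
  unfolding left_of_def mem_Collect_eq
  using eventually_gt_at_bot[of c]
proof eventually_elim
  case (elim x)
  have "connected {z. Re z < c}" by (intro convex_connected convex_halfspace_Re_lt)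
  thus ?case unfolding connected_component_def
    by (intro exI[of _ "{z. Re z < c}"]) (use elim assms in auto)
qed

text \<open>In terms of \<open>rGamma\<close> the denominators become entire factors. The
  conventional value 0 of 1/Gamma at its poles is the true value of \<open>rGamma\<close>
  there.\<close>

lemma meijer_integrand_eq:
  assumes "z \<noteq> 0"
  shows "meijer_integrand m n as bs z s =
     (\<Prod>j<m. Gamma (bs ! j - s)) * (\<Prod>j<n. Gamma (1 - as ! j + s)) *
     ((\<Prod>j=m..<length bs. rGamma (1 - bs ! j + s)) * (\<Prod>j=n..<length as. rGamma (as ! j - s))) *
     exp (s * Ln z)"
  using assms by (simp add: meijer_integrand_def powr_def rGamma_inverse_Gamma divide_inverse
      flip: prod_inversef)

text \<open>Resolves the definite description: the line Re = c is an admissible contour, and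
  \<open>contour_independence\<close> shows that any other one gives the same value. The parameters
  belonging to poles are taken real so that all poles are real.\<close>

theorem meijer_G_line:
  assumes real: "\<And>j. j < m \<Longrightarrow> bs ! j \<in> \<real>" "\<And>j. j < n \<Longrightarrow> as ! j \<in> \<real>"
    and sep: "\<And>j. j < m \<Longrightarrow> c < Re (bs ! j)" "\<And>j. j < n \<Longrightarrow> Re (as ! j) - 1 < c"
    and "z \<noteq> 0" and type: "strip_type (meijer_integrand m n as bs z) \<kappa>" "\<kappa> < 0"
  shows "meijer_G m n as bs z = (\<integral>y. meijer_integrand m n as bs z (Complex c y) \<partial>lborel) / (2 * pi)"
    and "integrable lborel (\<lambda>y. meijer_integrand m n as bs z (Complex c y))"
proof -
  let ?f = "meijer_integrand m n as bs z"
  define P where "P = (\<Union>j<m. range (\<lambda>k::nat. bs ! j + of_nat k)) \<union> (\<Union>j<n. range (\<lambda>k::nat. as ! j - 1 - of_nat k))"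
  have hol: "?f holomorphic_on - P"
  proof -
    have "(\<lambda>s. (\<Prod>j<m. Gamma (bs ! j - s)) * (\<Prod>j<n. Gamma (1 - as ! j + s)) *
     ((\<Prod>j=m..<length bs. rGamma (1 - bs ! j + s)) * (\<Prod>j=n..<length as. rGamma (as ! j - s))) *
     exp (s * Ln z)) holomorphic_on - P"
    proof (intro holomorphic_intros)
      fix j s assume "j \<in> {..<m}" "s \<in> - P"
      show "bs ! j - s \<notin> \<int>\<^sub>\<le>\<^sub>0"
      proof
        assume "bs ! j - s \<in> \<int>\<^sub>\<le>\<^sub>0"
        then obtain k where "bs ! j - s = - of_nat k" by (auto elim!: nonpos_Ints_cases')
        hence "s = bs ! j + of_nat k" by (simp add: algebra_simps)
        thus False using \<open>s \<in> - P\<close> \<open>j \<in> {..<m}\<close> unfolding P_def by auto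
      qed
    next
      fix j s assume "j \<in> {..<n}" "s \<in> - P"
      show "1 - as ! j + s \<notin> \<int>\<^sub>\<le>\<^sub>0"
      proof
        assume "1 - as ! j + s \<in> \<int>\<^sub>\<le>\<^sub>0"
        then obtain k where "1 - as ! j + s = - of_nat k" by (auto elim!: nonpos_Ints_cases')
        hence "s = as ! j - 1 - of_nat k" by (simp add: algebra_simps)
        hence "s \<in> (\<Union>j<n. range (\<lambda>k::nat. as ! j - 1 - of_nat k))" using \<open>j \<in> {..<n}\<close> by blast
        thus False using \<open>s \<in> - P\<close> \<open>j \<in> {..<n}\<close> unfolding P_def by auto
      qed
    qed
    thus ?thesis by (subst meijer_integrand_eq[OF \<open>z \<noteq> 0\<close>, abs_def])
  qed
  have sideP: "c < Re p \<or> Re p < c" if "p \<in> P" for p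
    using that sep unfolding P_def by fastforce
  have P1: "Im p = 0" if "p \<in> P" for p
    using that real unfolding P_def by (auto simp: complex_is_Real_iff)
  have P2: "finite {p\<in>P. \<bar>Re p\<bar> \<le> r}" for r
  proof (rule finite_subset)
    show "{p\<in>P. \<bar>Re p\<bar> \<le> r} \<subseteq> (\<Union>j<m. (\<lambda>k::nat. bs ! j + of_nat k) ` {k. real k \<le> r - Re (bs ! j)}) \<union>
            (\<Union>j<n. (\<lambda>k::nat. as ! j - 1 - of_nat k) ` {k. real k \<le> r + Re (as ! j) - 1})"
    proof (intro subsetI)
      fix p assume "p \<in> {p\<in>P. \<bar>Re p\<bar> \<le> r}"
      hence p: "p \<in> P" "Re p \<le> r" "- r \<le> Re p" by auto
      from p(1) consider j k where "j < m" "p = bs ! j + of_nat k"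
        | j k where "j < n" "p = as ! j - 1 - of_nat k" unfolding P_def by auto
      thus "p \<in> (\<Union>j<m. (\<lambda>k::nat. bs ! j + of_nat k) ` {k. real k \<le> r - Re (bs ! j)}) \<union>
            (\<Union>j<n. (\<lambda>k::nat. as ! j - 1 - of_nat k) ` {k. real k \<le> r + Re (as ! j) - 1})"
      proof cases
        case (1 j k)
        hence "k \<in> {k. real k \<le> r - Re (bs ! j)}" using p by auto
        thus ?thesis using 1 by blast
      next
        case (2 j k)
        hence "k \<in> {k. real k \<le> r + Re (as ! j) - 1}" using p by auto
        thus ?thesis using 2 by blast
      qed
    qed
    have "finite {k. real k \<le> u}" for u
      by (rule finite_subset[of _ "{..nat \<lceil>u\<rceil>}"]) (auto, linarith)
    thus "finite ((\<Union>j<m. (\<lambda>k::nat. bs ! j + of_nat k) ` {k. real k \<le> r - Re (bs ! j)}) \<union>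
            (\<Union>j<n. (\<lambda>k::nat. as ! j - 1 - of_nat k) ` {k. real k \<le> r + Re (as ! j) - 1}))" by auto
  qed
  have lineP: "Complex c y \<notin> P" for y using sideP[of "Complex c y"] by auto
  have cont: "continuous_on UNIV (\<lambda>y. ?f (Complex c y))"
    by (rule continuous_on_compose2[OF holomorphic_on_imp_continuous_on[OF hol]])
       (use lineP in \<open>auto intro!: continuous_intros\<close>)
  show int: "integrable lborel (\<lambda>y. ?f (Complex c y))" by (rule line_integrable[OF type cont])
  define V where "V = (\<integral>y. ?f (Complex c y) \<partial>lborel)"
  have "meijer_contour m n as bs (Complex c)"
    unfolding meijer_contour_def
    by (auto intro!: vertical_contour_line right_of_line left_of_line)
       (use sep in \<open>fastforce+\<close>)
  moreover have "has_line_integral ?f (\<i> * V) (Complex c)"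
    unfolding has_line_integral_def subpath_vertical_line
  proof (intro conjI allI)
    show "?f contour_integrable_on linepath (Complex c a) (Complex c b)" for a b
    proof (rule contour_integrable_continuous_linepath)
      have "closed_segment (Complex c a) (Complex c b) \<subseteq> - P"
        using vertical_segment_Re sideP by fastforce
      thus "continuous_on (closed_segment (Complex c a) (Complex c b)) ?f"
        using continuous_on_subset[OF holomorphic_on_imp_continuous_on[OF hol]] by blast
    qed
  qed (use tendsto_line_integral[OF int] in \<open>simp add: V_def\<close>)
  moreover have "v = V / (2 * pi)" if "meijer_contour m n as bs L" "has_line_integral ?f (2 * of_real pi * \<i> * v) L" for L v
  proof -
    have "2 * of_real pi * \<i> * v = \<i> * V"
      unfolding V_def
    proof (rule contour_independence[OF _ hol P1 P2 _ type int that(2)])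
      show "vertical_contour L" using that(1) unfolding meijer_contour_def by blast
      fix p assume p: "p \<in> P"
      thus "p \<in> right_of L \<and> c < Re p \<or> p \<in> left_of L \<and> Re p < c"
        using that(1) sep unfolding meijer_contour_def P_def by fastforce
    qed auto
    thus ?thesis by (simp add: field_simps)
  qed
  ultimately show "meijer_G m n as bs z = (\<integral>y. ?f (Complex c y) \<partial>lborel) / (2 * pi)"
    unfolding meijer_G_def V_def[symmetric]
    by (intro the_equality) (auto intro!: exI[of _ "Complex c"])
qed

section \<open>Integrals against \<open>exp (- t cosh x)\<close>\<close>

text \<open>Dominated convergence for difference quotients along sequences tending to t; the mean
  value inequality on the convex ball bounds them by the majorant \<open>g\<close> of the
  derivative.\<close>

lemma leibniz_integral:
  fixes f f' :: "complex \<Rightarrow> real \<Rightarrow> complex"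
  assumes "r > 0"
    and der: "\<And>w x. w \<in> ball t r \<Longrightarrow> ((\<lambda>w. f w x) has_field_derivative f' w x) (at w)"
    and int: "\<And>w. w \<in> ball t r \<Longrightarrow> integrable lborel (f w)"
    and meas: "f' t \<in> borel_measurable borel"
    and bound: "\<And>w x. w \<in> ball t r \<Longrightarrow> norm (f' w x) \<le> g x" and g: "integrable lborel g"
  shows "((\<lambda>w. \<integral>x. f w x \<partial>lborel) has_field_derivative (\<integral>x. f' t x \<partial>lborel)) (at t)"
proof -
  have t: "t \<in> ball t r" using assms by simp
  have "((\<lambda>w. ((\<integral>x. f w x \<partial>lborel) - (\<integral>x. f t x \<partial>lborel)) / (w - t)) \<longlongrightarrow> (\<integral>x. f' t x \<partial>lborel)) (at t within ball t r)"
    unfolding tendsto_at_iff_sequentially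
  proof (intro allI impI)
    fix X assume X: "\<forall>i. X i \<in> ball t r - {t}" "X \<longlonglongrightarrow> t"
    have XS: "X i \<in> ball t r" "X i \<noteq> t" for i using X(1) by auto
    have eq: "((\<integral>x. f (X i) x \<partial>lborel) - (\<integral>x. f t x \<partial>lborel)) / (X i - t)
                = (\<integral>x. (f (X i) x - f t x) / (X i - t) \<partial>lborel)" for i
      using int[OF XS(1)] int[OF t] by simp
    have "(\<lambda>i. \<integral>x. (f (X i) x - f t x) / (X i - t) \<partial>lborel) \<longlonglongrightarrow> (\<integral>x. f' t x \<partial>lborel)"
    proof (rule Bochner_Integration.integral_dominated_convergence[OF _ _ g])
      show "f' t \<in> borel_measurable lborel" using meas by simp
      show "(\<lambda>x. (f (X i) x - f t x) / (X i - t)) \<in> borel_measurable lborel" for i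
        using borel_measurable_integrable[OF int[OF XS(1)]] borel_measurable_integrable[OF int[OF t]]
        by (intro borel_measurable_divide borel_measurable_diff) auto
      show "AE x in lborel. (\<lambda>i. (f (X i) x - f t x) / (X i - t)) \<longlonglongrightarrow> f' t x"
      proof (rule AE_I2)
        fix x
        have "((\<lambda>w. (f w x - f t x) / (w - t)) \<longlongrightarrow> f' t x) (at t)"
          using der[OF t] unfolding has_field_derivative_iff .
        thus "(\<lambda>i. (f (X i) x - f t x) / (X i - t)) \<longlonglongrightarrow> f' t x"
          unfolding tendsto_at_iff_sequentially using X by (auto simp: o_def)
      qed
      show "AE x in lborel. norm ((f (X i) x - f t x) / (X i - t)) \<le> g x" for i
      proof (rule AE_I2)
        fix x
        have "norm (f (X i) x - f t x) \<le> g x * norm (X i - t)"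
          by (rule field_differentiable_bound[OF convex_ball _ _ XS(1) t])
             (use der bound in \<open>auto intro: has_field_derivative_at_within\<close>)
        thus "norm ((f (X i) x - f t x) / (X i - t)) \<le> g x"
          using XS(2)[of i] by (simp add: norm_divide divide_le_eq)
      qed
    qed
    thus "((\<lambda>w. ((\<integral>x. f w x \<partial>lborel) - (\<integral>x. f t x \<partial>lborel)) / (w - t)) \<circ> X) \<longlonglongrightarrow> (\<integral>x. f' t x \<partial>lborel)"
      by (simp add: o_def eq)
  qed
  thus ?thesis unfolding has_field_derivative_iff by (simp add: at_within_open[OF t])
qed

lemma integral_derivative_eq_0:
  fixes g g' :: "real \<Rightarrow> complex"
  assumes der: "\<And>x. (g has_vector_derivative g' x) (at x)" and int: "integrable lborel g'"
    and lim: "(g \<longlongrightarrow> 0) at_top" "(g \<longlongrightarrow> 0) at_bot"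
  shows "(\<integral>x. g' x \<partial>lborel) = 0"
proof -
  have "((\<lambda>z. g (snd z) - g (fst z)) \<longlongrightarrow> 0 - 0) (at_bot \<times>\<^sub>F at_top)"
    by (intro tendsto_diff filterlim_compose[OF lim(1)] filterlim_compose[OF lim(2)] filterlim_snd filterlim_fst)
  moreover have "\<forall>\<^sub>F z in at_bot \<times>\<^sub>F at_top. g (snd z) - g (fst z) = (case z of (a, b) \<Rightarrow> integral {a..b} g')"
    using eventually_prodI[OF eventually_le_at_bot[of 0] eventually_ge_at_top[of "0::real"]]
  proof eventually_elim
    case (elim z)
    hence "(g' has_integral (g (snd z) - g (fst z))) {fst z..snd z}"
      by (intro fundamental_theorem_of_calculus)
         (auto intro: has_vector_derivative_at_within[OF der])
    thus ?case by (auto simp: case_prod_unfold integral_unique)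
  qed
  ultimately have "((\<lambda>(a, b). integral {a..b} g') \<longlongrightarrow> 0 - 0) (at_bot \<times>\<^sub>F at_top)"
    by (rule Lim_transform_eventually)
  from tendsto_unique[OF _ this tendsto_integral_interval[OF int]] show ?thesis
    by (simp add: prod_filter_eq_bot)
qed

text \<open>The admissible weights against exp(-t cosh x). The class is closed under sums and
  products and contains x, sinh x, cosh x and exp(nu x), hence every weight produced by
  differentiation in t or integration by parts.\<close>

definition exp_growth :: "(real \<Rightarrow> complex) \<Rightarrow> bool" where
  "exp_growth p \<longleftrightarrow> p \<in> borel_measurable borel \<and> (\<exists>C B. \<forall>x. norm (p x) \<le> C * exp (B * \<bar>x\<bar>))"

lemma exp_growthI:
  "p \<in> borel_measurable borel \<Longrightarrow> (\<And>x. norm (p x) \<le> C * exp (B * \<bar>x\<bar>)) \<Longrightarrow> exp_growth p"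
  unfolding exp_growth_def by blast

definition cint :: "(real \<Rightarrow> complex) \<Rightarrow> complex \<Rightarrow> complex" where
  "cint p t = (\<integral>x. p x * exp (- t * of_real (cosh x)) \<partial>lborel)"

lemma cosh_real_ge_square: "x\<^sup>2 / 4 \<le> cosh (x::real)"
proof -
  have "1 + \<bar>x\<bar> + \<bar>x\<bar>\<^sup>2 / 2 \<le> exp \<bar>x\<bar>" by (rule exp_lower_Taylor_quadratic) auto
  moreover have "exp \<bar>x\<bar> \<le> 2 * cosh \<bar>x\<bar>" by (simp add: cosh_def)
  ultimately show ?thesis by (cases "x \<ge> 0") (auto simp: abs_if)
qed

text \<open>Completing the square after replacing cosh x by x^2 / 4. The extra 1 in B + 1 leaves the
  decay exp(-|x|).\<close>

lemma cosh_dominates: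
  fixes \<delta> B x :: real
  assumes "\<delta> > 0"
  shows "B * \<bar>x\<bar> - \<delta> * cosh x \<le> (B + 1)\<^sup>2 / \<delta> - \<bar>x\<bar>"
proof -
  have "0 \<le> (\<delta> * \<bar>x\<bar> / 2 - (B + 1))\<^sup>2" by simp
  hence "\<delta> * ((B + 1) * \<bar>x\<bar> - \<delta> * (x\<^sup>2 / 4)) \<le> (B + 1)\<^sup>2"
    by (simp add: power2_eq_square algebra_simps)
  hence "(B + 1) * \<bar>x\<bar> - \<delta> * (x\<^sup>2 / 4) \<le> (B + 1)\<^sup>2 / \<delta>"
    using assms by (simp add: pos_le_divide_eq mult.commute)
  moreover have "\<delta> * (x\<^sup>2 / 4) \<le> \<delta> * cosh x" using assms cosh_real_ge_square[of x] by (intro mult_left_mono) auto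
  ultimately show ?thesis by (simp add: algebra_simps)
qed

text \<open>The majorant depends on t only through a lower bound \<open>\<delta>\<close> of Re t, so
  that one bound serves a whole neighbourhood when differentiating in t.\<close>

lemma cint_integrand_bound:
  fixes p :: "real \<Rightarrow> complex" and x C B \<delta> :: real and t :: complex
  assumes p: "norm (p x) \<le> C * exp (B * \<bar>x\<bar>)" and \<delta>: "0 < \<delta>" "\<delta> \<le> Re t"
  shows "norm (p x * exp (- t * of_real (cosh x))) \<le> C * exp ((B + 1)\<^sup>2 / \<delta>) * exp (- 1 * \<bar>x\<bar>)"
proof -
  have C: "C \<ge> 0" using p norm_ge_zero[of "p x"] exp_gt_zero[of "B * \<bar>x\<bar>"]
    by (smt (verit) mult_neg_pos)
  have "\<delta> * cosh x \<le> Re t * cosh x" using \<delta> by (intro mult_right_mono) auto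
  hence "B * \<bar>x\<bar> - Re t * cosh x \<le> (B + 1)\<^sup>2 / \<delta> - \<bar>x\<bar>"
    using cosh_dominates[OF \<delta>(1), of B x] by linarith
  have "norm (p x * exp (- t * of_real (cosh x))) \<le> C * exp (B * \<bar>x\<bar>) * exp (- Re t * cosh x)"
    unfolding norm_mult using p order_trans[OF norm_ge_zero p] by (intro mult_mono) auto
  also have "\<dots> = C * exp (B * \<bar>x\<bar> - Re t * cosh x)" by (simp flip: exp_add)
  also have "\<dots> \<le> C * exp ((B + 1)\<^sup>2 / \<delta> - \<bar>x\<bar>)"
    using \<open>B * \<bar>x\<bar> - Re t * cosh x \<le> (B + 1)\<^sup>2 / \<delta> - \<bar>x\<bar>\<close> C by (intro mult_left_mono) auto
  finally show ?thesis by (simp add: exp_diff exp_minus divide_inverse mult.assoc)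
qed

lemma cosh_le_exp_abs: "cosh (x::real) \<le> exp \<bar>x\<bar>" "\<bar>sinh (x::real)\<bar> \<le> exp \<bar>x\<bar>"
proof -
  have "cosh \<bar>x\<bar> \<le> exp \<bar>x\<bar>" by (simp add: cosh_def)
  thus c: "cosh x \<le> exp \<bar>x\<bar>" by (cases "x \<ge> 0") (auto simp: abs_if)
  have "\<bar>sinh x\<bar> \<le> cosh x" using sinh_le_cosh_real[of x] sinh_le_cosh_real[of "-x"] by (auto simp: abs_if)
  thus "\<bar>sinh x\<bar> \<le> exp \<bar>x\<bar>" using c by linarith
qed

lemma exp_growth_mult:
  assumes "exp_growth p" "exp_growth q"
  shows "exp_growth (\<lambda>x. p x * q x)"
proof -
  obtain C B where p: "p \<in> borel_measurable borel" "\<And>x. norm (p x) \<le> C * exp (B * \<bar>x\<bar>)"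
    using assms(1) unfolding exp_growth_def by blast
  obtain C' B' where q: "q \<in> borel_measurable borel" "\<And>x. norm (q x) \<le> C' * exp (B' * \<bar>x\<bar>)"
    using assms(2) unfolding exp_growth_def by blast
  have "norm (p x * q x) \<le> (C * C') * exp ((B + B') * \<bar>x\<bar>)" for x
  proof -
    have "norm (p x * q x) \<le> (C * exp (B * \<bar>x\<bar>)) * (C' * exp (B' * \<bar>x\<bar>))"
      unfolding norm_mult using p(2)[of x] q(2)[of x] order_trans[OF norm_ge_zero p(2)[of x]] by (intro mult_mono) auto
    also have "\<dots> = (C * C') * exp ((B + B') * \<bar>x\<bar>)" by (simp add: algebra_simps flip: exp_add)
    finally show ?thesis .
  qed
  thus ?thesis using p(1) q(1) by (intro exp_growthI[where C = "C*C'" and B = "B+B'"]) auto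
qed

lemma exp_growth_add:
  assumes "exp_growth p" "exp_growth q"
  shows "exp_growth (\<lambda>x. p x + q x)"
proof -
  obtain C B where p: "p \<in> borel_measurable borel" "\<And>x. norm (p x) \<le> C * exp (B * \<bar>x\<bar>)"
    using assms(1) unfolding exp_growth_def by blast
  obtain C' B' where q: "q \<in> borel_measurable borel" "\<And>x. norm (q x) \<le> C' * exp (B' * \<bar>x\<bar>)"
    using assms(2) unfolding exp_growth_def by blast
  have CC: "C \<ge> 0" "C' \<ge> 0" using order_trans[OF norm_ge_zero p(2)[of 0]] order_trans[OF norm_ge_zero q(2)[of 0]] by auto
  have "norm (p x + q x) \<le> (C + C') * exp (max B B' * \<bar>x\<bar>)" for x
  proof -
    have "B * \<bar>x\<bar> \<le> max B B' * \<bar>x\<bar>" "B' * \<bar>x\<bar> \<le> max B B' * \<bar>x\<bar>" by (intro mult_right_mono; simp)+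
    hence "C * exp (B * \<bar>x\<bar>) \<le> C * exp (max B B' * \<bar>x\<bar>)" "C' * exp (B' * \<bar>x\<bar>) \<le> C' * exp (max B B' * \<bar>x\<bar>)"
      using CC by (auto intro!: mult_left_mono)
    thus ?thesis using p(2)[of x] q(2)[of x] norm_triangle_ineq[of "p x" "q x"]
      by (simp add: algebra_simps)
  qed
  thus ?thesis using p(1) q(1) by (intro exp_growthI[where C = "C+C'" and B = "max B B'"]) auto
qed

lemma exp_growth_const: "exp_growth (\<lambda>_. c)"
  by (rule exp_growthI[where C = "norm c" and B = 0]) auto

lemma exp_growth_of_real_I:
  assumes "h \<in> borel_measurable borel" "\<And>x. \<bar>h x\<bar> \<le> exp \<bar>x\<bar>"
  shows "exp_growth (\<lambda>x. of_real (h x))"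
  using assms by (intro exp_growthI[where C = 1 and B = 1]) auto

lemma abs_le_exp_abs: "\<bar>x\<bar> \<le> exp \<bar>x::real\<bar>" using exp_ge_add_one_self[of "\<bar>x\<bar>"] by linarith

lemma exp_growth_cosh: "exp_growth (\<lambda>x. of_real (cosh x))"
  by (rule exp_growth_of_real_I)
     (use cosh_le_exp_abs in \<open>auto intro!: borel_measurable_continuous_onI continuous_intros\<close>)

lemma exp_growth_sinh: "exp_growth (\<lambda>x. of_real (sinh x))"
  by (rule exp_growth_of_real_I)
     (use cosh_le_exp_abs in \<open>auto intro!: borel_measurable_continuous_onI continuous_intros\<close>)

lemma exp_growth_ident: "exp_growth (\<lambda>x. of_real x)"
  by (rule exp_growth_of_real_I) (use abs_le_exp_abs in auto)

lemma norm_exp_mult_le: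
  fixes \<nu> :: complex
  assumes "norm \<nu> \<le> B"
  shows "norm (exp (\<nu> * of_real x)) \<le> 1 * exp (B * \<bar>x\<bar>)"
proof -
  have "Re \<nu> * x \<le> \<bar>Re \<nu>\<bar> * \<bar>x\<bar>" by (metis abs_ge_self abs_mult)
  also have "\<dots> \<le> B * \<bar>x\<bar>"
    using assms abs_Re_le_cmod[of \<nu>] by (intro mult_right_mono) auto
  finally show ?thesis by simp
qed

lemma exp_growth_exp: "exp_growth (\<lambda>x. exp (\<nu> * of_real x))"
  by (rule exp_growthI[OF _ norm_exp_mult_le[OF order_refl]])
     (intro borel_measurable_continuous_onI continuous_intros)

lemmas exp_growth_intros =
  exp_growth_mult exp_growth_add exp_growth_const exp_growth_cosh exp_growth_sinh exp_growth_ident exp_growth_exp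

lemma cint_integrable:
  assumes "exp_growth p" "Re t > 0"
  shows "integrable lborel (\<lambda>x. p x * exp (- t * of_real (cosh x)))"
proof -
  obtain C B where p: "p \<in> borel_measurable borel" "\<And>x. norm (p x) \<le> C * exp (B * \<bar>x\<bar>)"
    using assms(1) unfolding exp_growth_def by blast
  have [measurable]: "p \<in> borel_measurable borel" by fact
  have [measurable]: "(\<lambda>x. exp (- t * of_real (cosh x))) \<in> borel_measurable borel"
    by (intro borel_measurable_continuous_onI continuous_intros)
  have "norm (p x * exp (- t * of_real (cosh x))) \<le> C * exp ((B + 1)\<^sup>2 / Re t) * exp (- 1 * \<bar>x\<bar>)" for x
    by (rule cint_integrand_bound[of p x C B "Re t" t, OF p(2) assms(2) order_refl])
  moreover have "(\<lambda>x. p x * exp (- t * of_real (cosh x))) \<in> borel_measurable borel" by measurable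
  ultimately show ?thesis by (intro integrable_exp_decay[where \<delta> = 1]) auto
qed

lemma cint_add:
  assumes "exp_growth p" "exp_growth q" "Re t > 0"
  shows "cint (\<lambda>x. p x + q x) t = cint p t + cint q t"
  unfolding cint_def ring_distribs
  by (intro Bochner_Integration.integral_add cint_integrable assms)

lemma cint_diff:
  assumes "exp_growth p" "exp_growth q" "Re t > 0"
  shows "cint (\<lambda>x. p x - q x) t = cint p t - cint q t"
  unfolding cint_def left_diff_distrib
  by (intro Bochner_Integration.integral_diff cint_integrable assms)

lemma cint_cmult: "cint (\<lambda>x. c * p x) t = c * cint p t"
  unfolding cint_def mult.assoc by simp

lemma cint_deriv:
  assumes p: "exp_growth p" and t: "Re t > 0"
  shows "(cint p has_field_derivative - cint (\<lambda>x. of_real (cosh x) * p x) t) (at t)"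
proof -
  have q: "exp_growth (\<lambda>x. - of_real (cosh x) * p x)"
    using exp_growth_mult[OF exp_growth_mult[OF exp_growth_const[of "-1"] exp_growth_cosh] p] by simp
  obtain C B where C: "\<And>x. norm (- of_real (cosh x) * p x) \<le> C * exp (B * \<bar>x\<bar>)"
    using q unfolding exp_growth_def by blast
  \<comment> \<open>On the disc of radius Re t / 2 the real part stays above Re t / 2, which gives a
    common majorant.\<close>
  have pos: "Re t / 2 \<le> Re w" if "w \<in> ball t (Re t / 2)" for w
    using that abs_Re_le_cmod[of "t - w"] by (auto simp: dist_norm)
  have "((\<lambda>w. \<integral>x. p x * exp (- w * of_real (cosh x)) \<partial>lborel) has_field_derivative
          (\<integral>x. (- of_real (cosh x) * p x) * exp (- t * of_real (cosh x)) \<partial>lborel)) (at t)"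
  proof (rule leibniz_integral)
    show "Re t / 2 > 0" using t by simp
    show "((\<lambda>w. p x * exp (- w * of_real (cosh x))) has_field_derivative
           (- of_real (cosh x) * p x) * exp (- w * of_real (cosh x))) (at w)" for w x
      by (auto intro!: derivative_eq_intros)
    show "integrable lborel (\<lambda>x. p x * exp (- w * of_real (cosh x)))" if "w \<in> ball t (Re t / 2)" for w
      using pos[OF that] t by (intro cint_integrable p) auto
    show "(\<lambda>x. (- of_real (cosh x) * p x) * exp (- t * of_real (cosh x))) \<in> borel_measurable borel"
      using borel_measurable_integrable[OF cint_integrable[OF q t]] by simp
    show "norm ((- of_real (cosh x) * p x) * exp (- w * of_real (cosh x))) \<le>
            C * exp ((B + 1)\<^sup>2 / (Re t / 2)) * exp (- 1 * \<bar>x\<bar>)" if "w \<in> ball t (Re t / 2)" for w x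
      by (rule cint_integrand_bound[of "\<lambda>x. - of_real (cosh x) * p x" x C B "Re t / 2" w, OF C]) (use t pos[OF that] in auto)
    show "integrable lborel (\<lambda>x::real. C * exp ((B + 1)\<^sup>2 / (Re t / 2)) * exp (- 1 * \<bar>x\<bar>))"
      using integrable_exp_neg_abs[of 1] by (intro Bochner_Integration.integrable_mult_right) auto
  qed
  moreover have "(\<integral>x. (- of_real (cosh x) * p x) * exp (- t * of_real (cosh x)) \<partial>lborel) =
                 - cint (\<lambda>x. of_real (cosh x) * p x) t"
    unfolding cint_def by (simp flip: Bochner_Integration.integral_minus)
  ultimately show ?thesis unfolding cint_def [abs_def] by simp
qed

text \<open>The derivative of -t cosh x brings down -t sinh x, and the boundary terms vanish. All
  recurrences for \<open>kfun\<close> and \<open>dfun\<close> come from this identity.\<close>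

lemma cint_by_parts:
  assumes der: "\<And>x. (p has_vector_derivative p' x) (at x)" and p: "exp_growth p" "exp_growth p'"
    and t: "Re t > 0"
  shows "cint p' t = t * cint (\<lambda>x. of_real (sinh x) * p x) t"
proof -
  let ?g = "\<lambda>x. p x * exp (- t * of_real (cosh x))"
  have q: "exp_growth (\<lambda>x. - t * (of_real (sinh x) * p x))"
    by (intro exp_growth_intros p)
  obtain C B where C: "\<And>x. norm (p x) \<le> C * exp (B * \<bar>x\<bar>)"
    using p unfolding exp_growth_def by blast
  have bound: "norm (?g x) \<le> C * exp ((B + 1)\<^sup>2 / Re t) * exp (- \<bar>x\<bar>)" for x
    using cint_integrand_bound[of p x C B "Re t" t, OF C t order_refl] by simp
  have lim: "(?g \<longlongrightarrow> 0) F" if "filterlim (\<lambda>x. \<bar>x\<bar>) at_top F" for F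
  proof (rule Lim_null_comparison)
    show "\<forall>\<^sub>F x in F. norm (?g x) \<le> C * exp ((B + 1)\<^sup>2 / Re t) * exp (- \<bar>x\<bar>)"
      using bound by (intro always_eventually allI)
    have "((\<lambda>x. exp (- \<bar>x\<bar>)) \<longlongrightarrow> 0) F"
      by (intro filterlim_compose[OF exp_at_bot] filterlim_compose[OF filterlim_uminus_at_bot_at_top] that)
    thus "((\<lambda>x. C * exp ((B + 1)\<^sup>2 / Re t) * exp (- \<bar>x\<bar>)) \<longlongrightarrow> 0) F"
      by (rule tendsto_mult_right_zero)
  qed
  have "(\<integral>x. (p' x + - t * (of_real (sinh x) * p x)) * exp (- t * of_real (cosh x)) \<partial>lborel) = 0"
  proof (rule integral_derivative_eq_0)
    fix x :: real
    have c: "((\<lambda>x. complex_of_real (cosh x)) has_vector_derivative of_real (sinh x)) (at x)"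
      by (intro has_vector_derivative_of_real) (auto intro!: derivative_eq_intros)
    have "((exp \<circ> (\<lambda>x. - t * of_real (cosh x))) has_vector_derivative (- t * of_real (sinh x)) * exp (- t * of_real (cosh x))) (at x)"
      by (rule field_vector_diff_chain_at)
         (auto intro!: derivative_eq_intros has_vector_derivative_mult_right c)
    hence e: "((\<lambda>x. exp (- t * of_real (cosh x))) has_vector_derivative (- t * of_real (sinh x)) * exp (- t * of_real (cosh x))) (at x)"
      by (simp add: o_def)
    have "(?g has_vector_derivative p x * ((- t * of_real (sinh x)) * exp (- t * of_real (cosh x))) + p' x * exp (- t * of_real (cosh x))) (at x)"
      by (rule has_vector_derivative_mult[OF der e])
    thus "(?g has_vector_derivative (p' x + - t * (of_real (sinh x) * p x)) * exp (- t * of_real (cosh x))) (at x)"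
      by (simp add: algebra_simps)
  next
    show "integrable lborel (\<lambda>x. (p' x + - t * (of_real (sinh x) * p x)) * exp (- t * of_real (cosh x)))"
      by (intro cint_integrable exp_growth_add p q t)
    show "(?g \<longlongrightarrow> 0) at_top" by (rule lim) (rule filterlim_abs_real)
    show "(?g \<longlongrightarrow> 0) at_bot" by (rule lim)
      (rule filterlim_at_top_mono[OF filterlim_uminus_at_top_at_bot], intro always_eventually allI abs_ge_minus_self)
  qed
  hence "cint (\<lambda>x. p' x + - t * (of_real (sinh x) * p x)) t = 0" unfolding cint_def .
  thus ?thesis by (subst (asm) cint_add[OF p(2) q t]) (simp only: cint_cmult, simp)
qed

lemma cint_tendsto:
  assumes meas: "\<And>n. p n \<in> borel_measurable borel" "q \<in> borel_measurable borel"
    and lim: "\<And>x. (\<lambda>n. p n x) \<longlonglongrightarrow> q x" and bound: "\<And>n x. norm (p n x) \<le> C * exp (B * \<bar>x\<bar>)"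
    and t: "Re t > 0"
  shows "(\<lambda>n. cint (p n) t) \<longlonglongrightarrow> cint q t"
  unfolding cint_def
proof (rule Bochner_Integration.integral_dominated_convergence)
  have e: "(\<lambda>x. exp (- t * of_real (cosh x))) \<in> borel_measurable lborel"
    by (simp, intro borel_measurable_continuous_onI continuous_intros)
  show "(\<lambda>x. q x * exp (- t * of_real (cosh x))) \<in> borel_measurable lborel"
       "(\<lambda>x. p n x * exp (- t * of_real (cosh x))) \<in> borel_measurable lborel" for n
    by (intro borel_measurable_times e; use meas in simp)+
  show "integrable lborel (\<lambda>x::real. C * exp ((B + 1)\<^sup>2 / Re t) * exp (- 1 * \<bar>x\<bar>))"
    using integrable_exp_neg_abs[of 1] by (intro Bochner_Integration.integrable_mult_right) auto
  show "AE x in lborel. (\<lambda>n. p n x * exp (- t * of_real (cosh x))) \<longlonglongrightarrow> q x * exp (- t * of_real (cosh x))"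
    by (intro AE_I2 tendsto_mult_right lim)
  show "AE x in lborel. norm (p n x * exp (- t * of_real (cosh x))) \<le> C * exp ((B + 1)\<^sup>2 / Re t) * exp (- 1 * \<bar>x\<bar>)" for n
    by (rule AE_I2, rule cint_integrand_bound[of "p n" _ C B "Re t" t, OF bound t order_refl])
qed

section \<open>The Macdonald integral and its first moment: recurrences and derivatives\<close>

definition kfun :: "complex \<Rightarrow> complex \<Rightarrow> complex" where
  "kfun \<nu> t = cint (\<lambda>x. exp (\<nu> * of_real x)) t / 2"

text \<open>The left-hand side of the theorem, and also twice the derivative of \<open>kfun\<close>
  in its index.\<close>

definition dfun :: "complex \<Rightarrow> complex \<Rightarrow> complex" where
  "dfun \<nu> t = cint (\<lambda>x. of_real x * exp (\<nu> * of_real x)) t"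

lemma has_vector_derivative_exp_mult:
  fixes \<nu> :: complex
  shows "((\<lambda>x. exp (\<nu> * of_real x)) has_vector_derivative \<nu> * exp (\<nu> * of_real x)) (at x)"
proof -
  have "((exp \<circ> (\<lambda>x. \<nu> * of_real x)) has_vector_derivative (\<nu> * 1) * exp (\<nu> * of_real x)) (at x)"
    by (rule field_vector_diff_chain_at)
       (auto intro!: derivative_eq_intros has_vector_derivative_mult_right has_vector_derivative_of_real)
  thus ?thesis by (simp add: o_def)
qed

text \<open>Since 2 sinh x = exp x - exp(-x), this is the classical recurrence K_(nu+1) - K_(nu-1) =
  (2 nu / t) K_nu.\<close>

lemma kfun_by_parts:
  assumes "Re t > 0"
  shows "cint (\<lambda>x. of_real (sinh x) * exp (\<nu> * of_real x)) t = 2 * \<nu> / t * kfun \<nu> t"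
proof -
  have "cint (\<lambda>x. \<nu> * exp (\<nu> * of_real x)) t = t * cint (\<lambda>x. of_real (sinh x) * exp (\<nu> * of_real x)) t"
    by (intro cint_by_parts has_vector_derivative_exp_mult exp_growth_intros assms)
  moreover have "t \<noteq> 0" using assms by auto
  ultimately show ?thesis by (simp add: cint_cmult kfun_def field_simps)
qed

text \<open>The index derivative, times 2, of \<open>kfun_by_parts\<close>; the term 2 K comes from
  differentiating the factor x of the weight.\<close>

lemma dfun_by_parts:
  assumes "Re t > 0"
  shows "cint (\<lambda>x. of_real (sinh x) * (of_real x * exp (\<nu> * of_real x))) t = (2 * kfun \<nu> t + \<nu> * dfun \<nu> t) / t"
proof -
  have "cint (\<lambda>x. exp (\<nu> * of_real x) + \<nu> * (of_real x * exp (\<nu> * of_real x))) t =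
          t * cint (\<lambda>x. of_real (sinh x) * (of_real x * exp (\<nu> * of_real x))) t"
  proof (intro cint_by_parts exp_growth_intros assms)
    fix x :: real
    have "((\<lambda>x. of_real x * exp (\<nu> * of_real x)) has_vector_derivative
             of_real x * (\<nu> * exp (\<nu> * of_real x)) + 1 * exp (\<nu> * of_real x)) (at x)"
      by (intro has_vector_derivative_mult has_vector_derivative_exp_mult)
         (auto intro!: has_vector_derivative_of_real[of "\<lambda>x. x" 1, simplified])
    thus "((\<lambda>x. of_real x * exp (\<nu> * of_real x)) has_vector_derivative
             exp (\<nu> * of_real x) + \<nu> * (of_real x * exp (\<nu> * of_real x))) (at x)"
      by (simp add: algebra_simps)
  qed
  also have "cint (\<lambda>x. exp (\<nu> * of_real x) + \<nu> * (of_real x * exp (\<nu> * of_real x))) t =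
               2 * kfun \<nu> t + \<nu> * dfun \<nu> t"
    by (subst cint_add) (auto intro!: exp_growth_intros assms simp: cint_cmult kfun_def dfun_def)
  finally show ?thesis using assms by (auto simp: field_simps)
qed

text \<open>Multiplication by cosh x would naturally involve the indices nu + 1 and nu - 1. Writing
  cosh x as exp x - sinh x, and as exp(-x) + sinh x in \<open>cosh_exp_down\<close>, leaves only nu
  and nu + 1, as the sinh term is removed by parts.\<close>

lemma cosh_exp_up:
  fixes \<nu> :: complex
  shows "of_real (cosh x) * exp (\<nu> * of_real x) =
           exp ((\<nu> + 1) * of_real x) - of_real (sinh x) * exp (\<nu> * of_real x)"
proof -
  have "cosh x = exp x - sinh x" using sinh_plus_cosh[of x] by linarith
  hence "complex_of_real (cosh x) = of_real (exp x - sinh x)" by (simp only:)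
  hence c: "complex_of_real (cosh x) = exp (of_real x) - of_real (sinh x)"
    by (simp only: of_real_diff exp_of_real)
  have "exp ((\<nu> + 1) * of_real x) = exp (of_real x) * exp (\<nu> * of_real x)"
    by (simp add: ring_distribs exp_add)
  thus ?thesis unfolding c left_diff_distrib by simp
qed

lemma cosh_exp_down:
  fixes \<nu> :: complex
  shows "of_real (cosh x) * exp ((\<nu> + 1) * of_real x) =
           exp (\<nu> * of_real x) + of_real (sinh x) * exp ((\<nu> + 1) * of_real x)"
proof -
  have "cosh x = exp (- x) + sinh x" using cosh_minus_sinh[of x] by linarith
  hence "complex_of_real (cosh x) = of_real (exp (- x) + sinh x)" by (simp only:)
  hence c: "complex_of_real (cosh x) = exp (- of_real x) + of_real (sinh x)"
    by (simp only: of_real_add flip: exp_of_real of_real_minus)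
  have "exp (- of_real x) * exp ((\<nu> + 1) * of_real x) = exp (\<nu> * of_real x)"
    by (simp add: ring_distribs flip: exp_add)
  thus ?thesis unfolding c ring_distribs by simp
qed

lemma kfun_deriv:
  assumes "Re t > 0"
  shows "(kfun \<nu> has_field_derivative \<nu> / t * kfun \<nu> t - kfun (\<nu> + 1) t) (at t)"
proof -
  have "(kfun \<nu> has_field_derivative (- cint (\<lambda>x. of_real (cosh x) * exp (\<nu> * of_real x)) t) / 2) (at t)"
    unfolding kfun_def [abs_def] by (intro DERIV_cdivide cint_deriv exp_growth_intros assms)
  moreover have "cint (\<lambda>x. of_real (cosh x) * exp (\<nu> * of_real x)) t = 2 * kfun (\<nu> + 1) t - 2 * \<nu> / t * kfun \<nu> t"
    unfolding cosh_exp_up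
    by (subst cint_diff) (simp_all add: exp_growth_intros assms kfun_by_parts kfun_def[of "\<nu> + 1"])
  ultimately show ?thesis by (simp add: diff_divide_distrib)
qed

lemma kfun_deriv_up:
  assumes "Re t > 0"
  shows "(kfun (\<nu> + 1) has_field_derivative - kfun \<nu> t - (\<nu> + 1) / t * kfun (\<nu> + 1) t) (at t)"
proof -
  have "(kfun (\<nu> + 1) has_field_derivative (- cint (\<lambda>x. of_real (cosh x) * exp ((\<nu> + 1) * of_real x)) t) / 2) (at t)"
    unfolding kfun_def [abs_def] by (intro DERIV_cdivide cint_deriv exp_growth_intros assms)
  moreover have "cint (\<lambda>x. of_real (cosh x) * exp ((\<nu> + 1) * of_real x)) t = 2 * kfun \<nu> t + 2 * (\<nu> + 1) / t * kfun (\<nu> + 1) t"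
    unfolding cosh_exp_down
    by (subst cint_add) (simp_all only: exp_growth_intros assms kfun_by_parts, simp add: kfun_def)
  ultimately show ?thesis by (simp only:) (auto elim!: DERIV_cong simp: field_simps)
qed

text \<open>Formally twice the index derivative of \<open>kfun_deriv\<close>, with (2 / t) K coming
  from the explicit nu there. The direct proof by parts avoids interchanging the derivatives in t
  and nu.\<close>

lemma dfun_deriv:
  assumes "Re t > 0"
  shows "(dfun \<nu> has_field_derivative \<nu> / t * dfun \<nu> t + 2 / t * kfun \<nu> t - dfun (\<nu> + 1) t) (at t)"
proof -
  have "(dfun \<nu> has_field_derivative (- cint (\<lambda>x. of_real (cosh x) * (of_real x * exp (\<nu> * of_real x))) t)) (at t)"
    unfolding dfun_def [abs_def] by (intro cint_deriv exp_growth_intros assms)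
  moreover have "of_real (cosh x) * (of_real x * exp (\<nu> * of_real x)) = of_real x * exp ((\<nu> + 1) * of_real x)
       - of_real (sinh x) * (of_real x * exp (\<nu> * of_real x))" for x
    unfolding mult.left_commute[of "of_real (cosh x)"] cosh_exp_up right_diff_distrib by simp
  moreover have "cint (\<lambda>x. of_real x * exp ((\<nu> + 1) * of_real x)
       - of_real (sinh x) * (of_real x * exp (\<nu> * of_real x))) t =
          dfun (\<nu> + 1) t - (2 * kfun \<nu> t + \<nu> * dfun \<nu> t) / t"
    by (subst cint_diff) (simp_all only: exp_growth_intros assms dfun_by_parts, simp add: dfun_def)
  ultimately show ?thesis by (simp only:) (auto elim!: DERIV_cong simp: add_divide_distrib)
qed

lemma dfun_deriv_up:
  assumes "Re t > 0"
  shows "(dfun (\<nu> + 1) has_field_derivative - dfun \<nu> t - 2 / t * kfun (\<nu> + 1) t - (\<nu> + 1) / t * dfun (\<nu> + 1) t) (at t)"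
proof -
  have "(dfun (\<nu> + 1) has_field_derivative (- cint (\<lambda>x. of_real (cosh x) * (of_real x * exp ((\<nu> + 1) * of_real x))) t)) (at t)"
    unfolding dfun_def [abs_def] by (intro cint_deriv exp_growth_intros assms)
  moreover have "of_real (cosh x) * (of_real x * exp ((\<nu> + 1) * of_real x)) = of_real x * exp (\<nu> * of_real x)
       + of_real (sinh x) * (of_real x * exp ((\<nu> + 1) * of_real x))" for x
    unfolding mult.left_commute[of "of_real (cosh x)"] cosh_exp_down distrib_left by simp
  moreover have "cint (\<lambda>x. of_real x * exp (\<nu> * of_real x)
       + of_real (sinh x) * (of_real x * exp ((\<nu> + 1) * of_real x))) t =
          dfun \<nu> t + (2 * kfun (\<nu> + 1) t + (\<nu> + 1) * dfun (\<nu> + 1) t) / t"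
    by (subst cint_add) (simp_all only: exp_growth_intros assms dfun_by_parts, simp add: dfun_def)
  ultimately show ?thesis by (simp only:) (auto elim!: DERIV_cong simp: add_divide_distrib ring_distribs)
qed

text \<open>Continuity in the index serves twice: for the limit that defines K at integers, and for
  the passage from generic nu to 2 nu integral.\<close>

lemma kfun_dfun_tendsto:
  assumes X: "X \<longlonglongrightarrow> \<nu>" and t: "Re t > 0"
  shows "(\<lambda>n. kfun (X n) t) \<longlonglongrightarrow> kfun \<nu> t" "(\<lambda>n. dfun (X n) t) \<longlonglongrightarrow> dfun \<nu> t"
proof -
  have "Bseq X" using X by (intro convergent_imp_Bseq convergentI)
  then obtain B where B: "\<And>n. norm (X n) \<le> B" unfolding Bseq_def by auto
  have m: "(\<lambda>x. exp (\<mu> * of_real x)) \<in> borel_measurable borel" for \<mu> :: complex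
    by (intro borel_measurable_continuous_onI continuous_intros)
  have e: "(\<lambda>n. exp (X n * of_real x)) \<longlonglongrightarrow> exp (\<nu> * of_real x)" for x
    by (intro tendsto_intros X)
  have "(\<lambda>n. cint (\<lambda>x. exp (X n * of_real x)) t) \<longlonglongrightarrow> cint (\<lambda>x. exp (\<nu> * of_real x)) t"
    by (rule cint_tendsto[OF m m e norm_exp_mult_le[OF B] t])
  thus "(\<lambda>n. kfun (X n) t) \<longlonglongrightarrow> kfun \<nu> t" unfolding kfun_def by (intro tendsto_intros) auto
  show "(\<lambda>n. dfun (X n) t) \<longlonglongrightarrow> dfun \<nu> t" unfolding dfun_def
  proof (rule cint_tendsto[where C = 1 and B = "B + 1"])
    show "norm (of_real x * exp (X n * of_real x)) \<le> 1 * exp ((B + 1) * \<bar>x\<bar>)" for n x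
    proof -
      have "norm (of_real x * exp (X n * of_real x)) \<le> exp \<bar>x\<bar> * (1 * exp (B * \<bar>x\<bar>))"
        unfolding norm_mult by (intro mult_mono norm_exp_mult_le B) (use abs_le_exp_abs[of x] in auto)
      thus ?thesis by (simp add: algebra_simps flip: exp_add)
    qed
  qed (use m e t in \<open>auto intro!: tendsto_mult_left borel_measurable_times\<close>)
qed

section \<open>Real arguments: positivity, bounds and decay of K and D\<close>

definition rint :: "(real \<Rightarrow> real) \<Rightarrow> real \<Rightarrow> real" where
  "rint h t = (\<integral>x. h x * exp (- t * cosh x) \<partial>lborel)"

lemma cint_of_real: "cint (\<lambda>x. of_real (h x)) (of_real t) = of_real (rint h t)"
proof -
  have "complex_of_real (h x) * exp (- of_real t * of_real (cosh x)) = of_real (h x * exp (- t * cosh x))" for x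
    by (simp flip: exp_of_real)
  thus ?thesis unfolding cint_def rint_def by (simp only: integral_complex_of_real)
qed

lemma rint_integrable:
  assumes "exp_growth (\<lambda>x. of_real (h x))" "t > 0"
  shows "integrable lborel (\<lambda>x. h x * exp (- t * cosh x))"
proof -
  have "integrable lborel (\<lambda>x. of_real (h x) * exp (- complex_of_real t * of_real (cosh x)))"
    using cint_integrable[OF assms(1), of "of_real t"] assms(2) by simp
  hence "integrable lborel (\<lambda>x. Re (of_real (h x) * exp (- complex_of_real t * of_real (cosh x))))"
    by (rule integrable_Re)
  moreover have "of_real (h x) * exp (- complex_of_real t * of_real (cosh x)) = of_real (h x * exp (- t * cosh x))" for x
    by (simp flip: exp_of_real)
  ultimately show ?thesis by (simp only: Re_complex_of_real)
qed

text \<open>The weight exp(-t cosh x) is even, so only the even part of \<open>h\<close>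
  contributes.\<close>

lemma rint_nonneg_symmetrized:
  assumes h: "exp_growth (\<lambda>x. of_real (h x))" "t > 0" and pos: "\<And>x. h x + h (- x) \<ge> 0"
  shows "rint h t \<ge> 0"
proof -
  let ?f = "\<lambda>x. h x * exp (- t * cosh x)"
  have int: "integrable lborel ?f" by (rule rint_integrable[OF h])
  have int': "integrable lborel (\<lambda>x. ?f (- x))"
    using lborel_integrable_real_affine[OF int, of "-1" 0] by simp
  have "rint h t = (\<integral>x. ?f (- x) \<partial>lborel)"
    unfolding rint_def using lborel_integral_real_affine[of "-1" ?f 0] by simp
  hence "2 * rint h t = (\<integral>x. ?f x \<partial>lborel) + (\<integral>x. ?f (- x) \<partial>lborel)"
    unfolding rint_def by simp
  also have "\<dots> = (\<integral>x. ?f x + ?f (- x) \<partial>lborel)" using int int' by simp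
  also have "\<dots> = (\<integral>x. (h x + h (- x)) * exp (- t * cosh x) \<partial>lborel)" by (simp add: algebra_simps)
  also have "\<dots> \<ge> 0" by (intro Bochner_Integration.integral_nonneg) (simp add: pos)
  finally show ?thesis by simp
qed

lemma rint_diff:
  assumes "exp_growth (\<lambda>x. of_real (h x))" "exp_growth (\<lambda>x. of_real (g x))" "t > 0"
  shows "rint (\<lambda>x. h x - g x) t = rint h t - rint g t"
  unfolding rint_def left_diff_distrib
  by (intro Bochner_Integration.integral_diff rint_integrable assms)

definition kr :: "real \<Rightarrow> real \<Rightarrow> real" where "kr \<nu> t = rint (\<lambda>x. exp (\<nu> * x)) t / 2"
definition dr :: "real \<Rightarrow> real \<Rightarrow> real" where "dr \<nu> t = rint (\<lambda>x. x * exp (\<nu> * x)) t"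

lemma kfun_of_real: "kfun (of_real \<nu>) (of_real t) = of_real (kr \<nu> t)"
  unfolding kfun_def kr_def using cint_of_real[of "\<lambda>x. exp (\<nu> * x)" t] by (simp flip: exp_of_real)

lemma dfun_of_real: "dfun (of_real \<nu>) (of_real t) = of_real (dr \<nu> t)"
  unfolding dfun_def dr_def using cint_of_real[of "\<lambda>x. x * exp (\<nu> * x)" t] by (simp flip: exp_of_real)

lemma exp_growth_of_real_exp: "exp_growth (\<lambda>x. of_real (exp (\<nu> * x)))"
  using exp_growth_exp[of "of_real \<nu>"] by (simp flip: exp_of_real)

lemma exp_growth_of_real_diff:
  "exp_growth (\<lambda>x. of_real (h x)) \<Longrightarrow> exp_growth (\<lambda>x. of_real (g x)) \<Longrightarrow> exp_growth (\<lambda>x. of_real (h x - g x))"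
  using exp_growth_add[OF _ exp_growth_mult[OF exp_growth_const[of "-1"]], of "\<lambda>x. of_real (h x)" "\<lambda>x. of_real (g x)"]
  by simp

lemma exp_growth_of_real_mult:
  "exp_growth (\<lambda>x. of_real (h x)) \<Longrightarrow> exp_growth (\<lambda>x. of_real (g x)) \<Longrightarrow> exp_growth (\<lambda>x. of_real (h x * g x))"
  using exp_growth_mult[of "\<lambda>x. of_real (h x)" "\<lambda>x. of_real (g x)"] by simp

lemmas exp_growth_real_intros = exp_growth_of_real_diff exp_growth_of_real_mult exp_growth_of_real_exp
  exp_growth_ident exp_growth_sinh

lemma kr_nonneg: "t > 0 \<Longrightarrow> kr \<nu> t \<ge> 0"
  unfolding kr_def rint_def by (intro divide_nonneg_pos Bochner_Integration.integral_nonneg) auto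

lemma sinh_real_ge: "x \<ge> 0 \<Longrightarrow> x \<le> sinh (x::real)"
proof -
  assume "x \<ge> 0"
  have "sinh 0 - 0 \<le> sinh x - x"
  proof (rule DERIV_nonneg_imp_nondecreasing[OF \<open>x \<ge> 0\<close>, of "\<lambda>x. sinh x - x"])
    fix y :: real
    show "\<exists>d. ((\<lambda>x. sinh x - x) has_real_derivative d) (at y) \<and> 0 \<le> d"
      by (intro exI[of _ "cosh y - 1"]) (auto intro!: derivative_eq_intros cosh_real_ge_1)
  qed
  thus ?thesis by simp
qed

lemma odd_mult_exp_nonneg:
  fixes h :: "real \<Rightarrow> real"
  assumes "\<And>x. h (- x) = - h x" "\<And>x. x \<ge> 0 \<Longrightarrow> h x \<ge> 0" "\<nu> \<ge> 0"
  shows "h x * exp (\<nu> * x) + h (- x) * exp (\<nu> * - x) \<ge> 0"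
proof -
  have *: "h x * (exp (\<nu> * x) - exp (- (\<nu> * x))) \<ge> 0" if "x \<ge> 0" for x
    using that assms(2)[OF that] assms(3) by (intro mult_nonneg_nonneg) (auto simp: mult_nonneg_nonneg order_trans[of _ 0])
  show ?thesis using *[of x] *[of "-x"] assms(1)[of x] by (cases "x \<ge> 0") (auto simp: algebra_simps)
qed

text \<open>The integral of (sinh x - x) exp(nu x) is nonnegative because x <= sinh x for x >= 0,
  and the sinh part is known from \<open>kfun_by_parts\<close>. The gain of a factor 1/t over K is
  what makes the later limits at infinity work.\<close>

lemma dr_bounds:
  assumes "\<nu> \<ge> 0" "t > 0"
  shows "0 \<le> dr \<nu> t" "dr \<nu> t \<le> 2 * \<nu> / t * kr \<nu> t"
proof -
  show "0 \<le> dr \<nu> t" unfolding dr_def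
    by (intro rint_nonneg_symmetrized odd_mult_exp_nonneg[of "\<lambda>x. x"] exp_growth_real_intros assms) auto
  have "0 \<le> rint (\<lambda>x. (sinh x - x) * exp (\<nu> * x)) t"
    by (intro rint_nonneg_symmetrized odd_mult_exp_nonneg exp_growth_real_intros assms)
       (auto simp: sinh_real_ge)
  also have "\<dots> = rint (\<lambda>x. sinh x * exp (\<nu> * x)) t - dr \<nu> t"
    unfolding dr_def left_diff_distrib by (intro rint_diff exp_growth_real_intros assms)
  also have "complex_of_real (rint (\<lambda>x. sinh x * exp (\<nu> * x)) t) = of_real (2 * \<nu> / t * kr \<nu> t)"
    using kfun_by_parts[of "of_real t" "of_real \<nu>"] assms cint_of_real[of "\<lambda>x. sinh x * exp (\<nu> * x)" t]
    by (simp add: kfun_of_real flip: exp_of_real)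
  hence "rint (\<lambda>x. sinh x * exp (\<nu> * x)) t = 2 * \<nu> / t * kr \<nu> t" by (simp only: of_real_eq_iff)
  finally show "dr \<nu> t \<le> 2 * \<nu> / t * kr \<nu> t" by simp
qed

text \<open>Pairing x with -x turns the exponentials into cosh(nu x) and cosh((nu + 1) x).\<close>

lemma kr_mono:
  assumes "\<nu> \<ge> 0" "t > 0"
  shows "kr \<nu> t \<le> kr (\<nu> + 1) t"
proof -
  have "0 \<le> rint (\<lambda>x. exp ((\<nu> + 1) * x) - exp (\<nu> * x)) t"
  proof (intro rint_nonneg_symmetrized exp_growth_real_intros assms)
    fix x :: real
    have "cosh \<bar>\<nu> * x\<bar> \<le> cosh \<bar>(\<nu> + 1) * x\<bar>"
      using assms(1) by (subst cosh_real_nonneg_le_iff) (auto simp: abs_mult intro!: mult_right_mono)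
    hence "cosh (\<nu> * x) \<le> cosh ((\<nu> + 1) * x)"
      by (metis abs_if cosh_minus)
    thus "0 \<le> exp ((\<nu> + 1) * x) - exp (\<nu> * x) + (exp ((\<nu> + 1) * - x) - exp (\<nu> * - x))"
      by (simp add: cosh_def)
  qed
  also have "\<dots> = 2 * kr (\<nu> + 1) t - 2 * kr \<nu> t"
    unfolding kr_def by (subst rint_diff) (auto intro!: exp_growth_real_intros assms)
  finally show ?thesis by simp
qed

lemma kr_decay:
  assumes "t \<ge> 1"
  shows "kr \<nu> t \<le> exp (- (t - 1)) * kr \<nu> 1"
proof -
  have "rint (\<lambda>x. exp (\<nu> * x)) t \<le> exp (- (t - 1)) * rint (\<lambda>x. exp (\<nu> * x)) 1"
    unfolding rint_def
  proof (subst Bochner_Integration.integral_mult_right_zero[symmetric], rule integral_mono)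
    fix x :: real
    have "(t - 1) * 1 \<le> (t - 1) * cosh x" using assms cosh_real_ge_1[of x] by (intro mult_left_mono) auto
    hence "exp (- t * cosh x) \<le> exp (- (t - 1)) * exp (- 1 * cosh x)"
      by (simp add: algebra_simps flip: exp_add)
    hence "exp (\<nu> * x) * exp (- t * cosh x) \<le> exp (\<nu> * x) * (exp (- (t - 1)) * exp (- 1 * cosh x))"
      by (intro mult_left_mono) auto
    thus "exp (\<nu> * x) * exp (- t * cosh x) \<le> exp (- (t - 1)) * (exp (\<nu> * x) * exp (- 1 * cosh x))"
      by (simp add: mult_ac)
  next
    show "integrable lborel (\<lambda>x. exp (\<nu> * x) * exp (- t * cosh x))"
      using assms by (intro rint_integrable exp_growth_of_real_exp) auto
    show "integrable lborel (\<lambda>x. exp (- (t - 1)) * (exp (\<nu> * x) * exp (- 1 * cosh x)))"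
      by (intro Bochner_Integration.integrable_mult_right rint_integrable exp_growth_of_real_exp) auto
  qed
  thus ?thesis unfolding kr_def by simp
qed

lemma kr_tendsto_0: "(kr \<nu> \<longlongrightarrow> 0) at_top"
proof (rule Lim_null_comparison)
  show "\<forall>\<^sub>F t in at_top. norm (kr \<nu> t) \<le> exp (- (t - 1)) * kr \<nu> 1"
    using eventually_ge_at_top[of 1] by eventually_elim (use kr_decay kr_nonneg in auto)
  show "((\<lambda>t. exp (- (t - 1)) * kr \<nu> 1) \<longlongrightarrow> 0) at_top"
  proof (rule tendsto_mult_left_zero)
    have "filterlim (\<lambda>t::real. - 1 + t) at_top at_top"
      by (rule filterlim_tendsto_add_at_top[OF tendsto_const filterlim_ident])
    thus "((\<lambda>t::real. exp (- (t - 1))) \<longlongrightarrow> 0) at_top"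
      by (intro filterlim_compose[OF exp_at_bot] filterlim_compose[OF filterlim_uminus_at_bot_at_top]) simp
  qed
qed

section \<open>The Bessel series\<close>

text \<open>The Bessel-Clifford function: I_nu(t) = (t/2)^nu besB nu (t^2/4). Separating it from the
  power leaves a function entire in w, with differentiation in w acting as a shift of the
  index.\<close>

definition besB :: "complex \<Rightarrow> complex \<Rightarrow> complex" where
  "besB \<nu> w = (\<Sum>k. rGamma (\<nu> + of_nat k + 1) / fact k * w ^ k)"

lemma norm_pochhammer_ge_1:
  assumes "Re z \<ge> 1"
  shows "norm (pochhammer z n) \<ge> 1"
proof -
  have "1 \<le> norm (z + of_nat i)" for i
    using assms complex_Re_le_cmod[of "z + of_nat i"] by simp
  hence "1 \<le> (\<Prod>i<n. norm (z + of_nat i))" by (intro prod_ge_1) auto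
  thus ?thesis by (simp add: pochhammer_prod prod_norm lessThan_atLeast0)
qed

text \<open>Beyond a fixed m, 1/Gamma(z + m) equals 1/Gamma(z + k) times a product of factors of
  modulus at least 1, so the finitely many k <= m already give the bound, on a compact disc.\<close>

lemma rGamma_add_nat_bounded:
  fixes R :: real
  shows "\<exists>C\<ge>0. \<forall>z k. norm z \<le> R \<longrightarrow> norm (rGamma (z + of_nat k) :: complex) \<le> C"
proof -
  obtain m :: nat where m: "\<bar>R\<bar> + 1 \<le> m" using real_arch_simple by blast
  have "bounded ((rGamma :: complex \<Rightarrow> complex) ` cball 0 (\<bar>R\<bar> + m))"
    by (intro compact_imp_bounded compact_continuous_image compact_cball)
       (auto intro: holomorphic_on_imp_continuous_on holomorphic_intros)
  then obtain C where "\<forall>x\<in>(rGamma :: complex \<Rightarrow> complex) ` cball 0 (\<bar>R\<bar> + m). norm x \<le> C"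
    unfolding bounded_iff by blast
  hence C: "norm (rGamma z :: complex) \<le> C" if "norm z \<le> \<bar>R\<bar> + m" for z using that by auto
  show ?thesis
  proof (intro exI[of _ C] conjI allI impI)
    show "C \<ge> 0" using C[of 0] norm_ge_zero[of "rGamma 0 :: complex"] by auto
    fix z :: complex and k :: nat assume z: "norm z \<le> R"
    have small: "norm (rGamma (z + of_nat j)) \<le> C" if "j \<le> m" for j
      using that z norm_triangle_ineq[of z "of_nat j"] by (intro C) auto
    show "norm (rGamma (z + of_nat k)) \<le> C"
    proof (cases "k \<le> m")
      case True thus ?thesis by (rule small)
    next
      case False
      have "rGamma (z + of_nat m) = pochhammer (z + of_nat m) (k - m) * rGamma (z + of_nat m + of_nat (k - m))"
        by (rule pochhammer_rGamma)
      also have "z + of_nat m + of_nat (k - m) = z + of_nat k" using False by simp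
      finally have eq: "norm (rGamma (z + of_nat m)) = norm (pochhammer (z + of_nat m) (k - m)) * norm (rGamma (z + of_nat k))"
        by (simp add: norm_mult)
      have "1 \<le> norm (pochhammer (z + of_nat m) (k - m))"
        using z m abs_Re_le_cmod[of z] by (intro norm_pochhammer_ge_1) auto
      hence "1 * norm (rGamma (z + of_nat k)) \<le> norm (rGamma (z + of_nat m))"
        unfolding eq by (intro mult_right_mono) auto
      thus ?thesis using small[of m] by simp
    qed
  qed
qed

text \<open>Uniform in nu on discs: an exponential series dominates, which yields both convergence
  and, by Tannery's theorem, continuity in nu.\<close>

lemma besB_term_bound:
  fixes R :: real and w :: complex
  shows "\<exists>C\<ge>0. \<forall>\<nu> k. norm \<nu> \<le> R \<longrightarrow> norm (rGamma (\<nu> + of_nat k + 1) / fact k * w ^ k) \<le> C * (inverse (fact k) * norm w ^ k)"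
proof -
  obtain C where C: "C \<ge> 0" "\<And>z k. norm z \<le> \<bar>R\<bar> + 1 \<Longrightarrow> norm (rGamma (z + of_nat k) :: complex) \<le> C"
    using rGamma_add_nat_bounded[of "\<bar>R\<bar> + 1"] by blast
  show ?thesis
  proof (intro exI[of _ C] conjI allI impI C(1))
    fix \<nu> :: complex and k :: nat assume "norm \<nu> \<le> R"
    hence "norm (\<nu> + 1) \<le> \<bar>R\<bar> + 1" using norm_triangle_ineq[of \<nu> 1] by simp
    from C(2)[OF this, of k] have "norm (rGamma (\<nu> + of_nat k + 1)) \<le> C" by (simp add: add_ac)
    thus "norm (rGamma (\<nu> + of_nat k + 1) / fact k * w ^ k) \<le> C * (inverse (fact k) * norm w ^ k)"
      by (simp add: norm_mult norm_divide norm_power divide_inverse mult_right_mono mult.assoc norm_inverse)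
  qed
qed

lemma besB_summable:
  fixes \<nu> w :: complex
  shows "summable (\<lambda>k. norm (rGamma (\<nu> + of_nat k + 1) / fact k * w ^ k))"
proof -
  obtain C where C: "C \<ge> 0"
    "\<And>\<mu> k. norm \<mu> \<le> norm \<nu> \<Longrightarrow> norm (rGamma (\<mu> + of_nat k + 1) / fact k * w ^ k) \<le> C * (inverse (fact k) * norm w ^ k)"
    using besB_term_bound[of "norm \<nu>" w] by blast
  have "summable (\<lambda>k. C * (inverse (fact k) * norm w ^ k))"
    by (intro summable_mult summable_exp)
  thus ?thesis
    by (rule summable_comparison_test'[where N = 0]) (simp only: real_norm_def abs_norm_cancel C(2) order_refl)
qed

lemma besB_sums: "(\<lambda>k. rGamma (\<nu> + of_nat k + 1) / fact k * w ^ k) sums besB \<nu> w"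
  unfolding besB_def by (rule summable_sums[OF summable_norm_cancel[OF besB_summable]])

lemma Suc_mult_divide_fact: "of_nat (Suc k) * (x / fact (Suc k)) = (x :: complex) / fact k"
  by (simp add: fact_Suc del: of_nat_Suc)

lemma besB_deriv: "(besB \<nu> has_field_derivative besB (\<nu> + 1) w) (at w)"
proof -
  let ?c = "\<lambda>k. rGamma (\<nu> + of_nat k + 1) / fact k"
  have "((\<lambda>w. \<Sum>k. ?c k * w ^ k) has_field_derivative (\<Sum>k. diffs ?c k * w ^ k)) (at w)"
    by (rule termdiffs_strong_converges_everywhere) (rule summable_norm_cancel[OF besB_summable])
  moreover have "diffs ?c k = rGamma (\<nu> + 1 + of_nat k + 1) / fact k" for k
  proof -
    have "\<nu> + of_nat (Suc k) + 1 = \<nu> + 1 + of_nat k + 1" by simp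
    thus ?thesis unfolding diffs_def by (simp only: Suc_mult_divide_fact)
  qed
  ultimately show ?thesis by (simp add: besB_def [abs_def])
qed

text \<open>Splits the factor nu + 1 + k in 1/Gamma(nu + k + 1) = (nu + 1 + k) / Gamma(nu + k + 2);
  the part with k cancels against k! and shifts the series by one.\<close>

lemma besB_rec: "besB \<nu> w = (\<nu> + 1) * besB (\<nu> + 1) w + w * besB (\<nu> + 2) w"
proof -
  let ?f = "\<lambda>k. of_nat k * (rGamma (\<nu> + 1 + of_nat k + 1) / fact k * w ^ k)"
  have "(\<lambda>k. w * (rGamma (\<nu> + 2 + of_nat k + 1) / fact k * w ^ k)) sums (w * besB (\<nu> + 2) w)"
    by (intro sums_mult besB_sums)
  also have "(\<lambda>k. w * (rGamma (\<nu> + 2 + of_nat k + 1) / fact k * w ^ k)) = (\<lambda>k. ?f (Suc k))"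
  proof
    fix k
    have e: "\<nu> + 1 + of_nat (Suc k) + 1 = \<nu> + 2 + of_nat k + 1" by simp
    show "w * (rGamma (\<nu> + 2 + of_nat k + 1) / fact k * w ^ k) = ?f (Suc k)"
      unfolding mult.assoc[symmetric] e times_divide_eq_right[symmetric]
      unfolding Suc_mult_divide_fact by simp
  qed
  finally have "?f sums (w * besB (\<nu> + 2) w + ?f 0)" by (subst (asm) sums_Suc_iff) simp
  hence "(\<lambda>k. (\<nu> + 1) * (rGamma (\<nu> + 1 + of_nat k + 1) / fact k * w ^ k) + ?f k) sums
           ((\<nu> + 1) * besB (\<nu> + 1) w + w * besB (\<nu> + 2) w)"
    by (intro sums_add sums_mult besB_sums) simp
  also have "(\<lambda>k. (\<nu> + 1) * (rGamma (\<nu> + 1 + of_nat k + 1) / fact k * w ^ k) + ?f k) =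
             (\<lambda>k. rGamma (\<nu> + of_nat k + 1) / fact k * w ^ k)"
  proof
    fix k
    have "rGamma (\<nu> + of_nat k + 1) = (\<nu> + of_nat k + 1) * rGamma (\<nu> + 1 + of_nat k + 1)"
      using rGamma_plus1[of "\<nu> + of_nat k + 1"] by (simp add: add_ac)
    thus "(\<nu> + 1) * (rGamma (\<nu> + 1 + of_nat k + 1) / fact k * w ^ k) + ?f k = rGamma (\<nu> + of_nat k + 1) / fact k * w ^ k"
      by (simp add: algebra_simps add_divide_distrib)
  qed
  finally show ?thesis using besB_sums[of \<nu> w] sums_unique2 by blast
qed

lemma besB_tendsto:
  assumes "X \<longlonglongrightarrow> \<nu>"
  shows "(\<lambda>n. besB (X n) w) \<longlonglongrightarrow> besB \<nu> w"
proof -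
  have "Bseq X" using assms by (intro convergent_imp_Bseq convergentI)
  then obtain B where B: "\<And>n. norm (X n) \<le> B" unfolding Bseq_def by auto
  obtain C where C: "C \<ge> 0"
    "\<And>\<mu> k. norm \<mu> \<le> B \<Longrightarrow> norm (rGamma (\<mu> + of_nat k + 1) / fact k * w ^ k) \<le> C * (inverse (fact k) * norm w ^ k)"
    using besB_term_bound[of B w] by blast
  have "isCont rGamma z" for z :: complex
    by (intro field_differentiable_imp_continuous_at field_differentiable_rGamma)
  hence "(\<lambda>n. rGamma (X n + of_nat k + 1) / fact k * w ^ k) \<longlonglongrightarrow> rGamma (\<nu> + of_nat k + 1) / fact k * w ^ k" for k
    by (intro tendsto_intros assms isCont_tendsto_compose[of _ rGamma]) auto
  moreover have "eventually (\<lambda>(k,n). norm (rGamma (X n + of_nat k + 1) / fact k * w ^ k) \<le> C * (inverse (fact k) * norm w ^ k)) (at_top \<times>\<^sub>F sequentially)"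
    using C(2)[OF B] by (intro always_eventually) auto
  moreover have "summable (\<lambda>k. C * (inverse (fact k) * norm w ^ k))"
    by (intro summable_mult summable_exp)
  ultimately show ?thesis unfolding besB_def by (intro tannerys_theorem[THEN conjunct2, THEN conjunct2]) auto
qed

text \<open>Up to a constant factor, this is the Wronskian of \<open>I\<^sub>\<nu>\<close> and \<open>I\<^sub>-\<^sub>\<nu>\<close>.\<close>

lemma besB_wronskian:
  "w * besB (\<nu> + 1) w * besB (- \<nu>) w - besB \<nu> w * besB (- \<nu> - 1) w = sin (of_real pi * \<nu>) / of_real pi"
proof -
  let ?V = "\<lambda>w. w * besB (\<nu> + 1) w * besB (- \<nu>) w - besB \<nu> w * besB (- \<nu> - 1) w"
  have "(?V has_field_derivative 0) (at w within UNIV)" for w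
  proof -
    have r1: "w * besB (\<nu> + 2) w = besB \<nu> w - (\<nu> + 1) * besB (\<nu> + 1) w" using besB_rec[of \<nu> w] by simp
    have r2: "w * besB (1 - \<nu>) w = besB (- \<nu> - 1) w + \<nu> * besB (- \<nu>) w"
      using besB_rec[of "- \<nu> - 1" w] by simp
    have d: "(besB (\<nu> + 1) has_field_derivative besB (\<nu> + 2) w) (at w)"
         "(besB (- \<nu>) has_field_derivative besB (1 - \<nu>) w) (at w)"
         "(besB (- \<nu> - 1) has_field_derivative besB (- \<nu>) w) (at w)"
      using besB_deriv[of "\<nu> + 1" w] besB_deriv[of "- \<nu>" w] besB_deriv[of "- \<nu> - 1" w] by (simp_all add: add_ac)
    have "(?V has_field_derivative
       (1 * besB (\<nu> + 1) w + besB (\<nu> + 2) w * w) * besB (- \<nu>) w + besB (1 - \<nu>) w * (w * besB (\<nu> + 1) w) -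
       (besB (\<nu> + 1) w * besB (- \<nu> - 1) w + besB (- \<nu>) w * besB \<nu> w)) (at w)"
      by (intro DERIV_diff DERIV_mult d besB_deriv DERIV_ident)
    also have "(1 * besB (\<nu> + 1) w + besB (\<nu> + 2) w * w) * besB (- \<nu>) w + besB (1 - \<nu>) w * (w * besB (\<nu> + 1) w) -
       (besB (\<nu> + 1) w * besB (- \<nu> - 1) w + besB (- \<nu>) w * besB \<nu> w) =
       (besB (\<nu> + 1) w + w * besB (\<nu> + 2) w) * besB (- \<nu>) w + (w * besB (1 - \<nu>) w) * besB (\<nu> + 1) w -
       (besB (\<nu> + 1) w * besB (- \<nu> - 1) w + besB (- \<nu>) w * besB \<nu> w)" by (simp add: mult_ac)
    also have "\<dots> = 0" unfolding r1 r2 by (simp add: algebra_simps)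
    finally show ?thesis by simp
  qed
  hence "?V constant_on UNIV"
    by (intro has_field_derivative_0_imp_constant_on) auto
  hence "?V w = ?V 0" unfolding constant_on_def by (metis UNIV_I)
  \<comment> \<open>The expression is constant in w, and at w = 0 only a product of two reciprocal
    Gamma values is left, to which the reflection formula applies.\<close>
  also have "besB \<mu> 0 = rGamma (\<mu> + 1)" for \<mu> unfolding besB_def by (subst powser_zero) simp
  hence "?V 0 = - (rGamma (- \<nu>) * rGamma (1 - (- \<nu>)))" by (simp add: add.commute)
  also have "\<dots> = sin (of_real pi * \<nu>) / of_real pi"
    unfolding rGamma_reflection_complex by simp
  finally show ?thesis .
qed

text \<open>Cauchy product; after extracting the two reciprocal Gamma factors of index n, the inner
  sum is a Chu-Vandermonde convolution.\<close>

lemma besB_mult_sums: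
  "(\<lambda>n. ((\<mu> + \<nu> + 2 * of_nat n) gchoose n) * rGamma (\<mu> + of_nat n + 1) * rGamma (\<nu> + of_nat n + 1) * w ^ n)
     sums (besB \<mu> w * besB \<nu> w)"
proof -
  have "(\<lambda>n. \<Sum>i\<le>n. (rGamma (\<mu> + of_nat i + 1) / fact i * w ^ i) * (rGamma (\<nu> + of_nat (n - i) + 1) / fact (n - i) * w ^ (n - i)))
     sums (besB \<mu> w * besB \<nu> w)"
    unfolding besB_def by (intro Cauchy_product_sums besB_summable)
  also have "(\<lambda>n. \<Sum>i\<le>n. (rGamma (\<mu> + of_nat i + 1) / fact i * w ^ i) * (rGamma (\<nu> + of_nat (n - i) + 1) / fact (n - i) * w ^ (n - i)))
     = (\<lambda>n. ((\<mu> + \<nu> + 2 * of_nat n) gchoose n) * rGamma (\<mu> + of_nat n + 1) * rGamma (\<nu> + of_nat n + 1) * w ^ n)"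
  proof
    fix n
    have "(rGamma (\<mu> + of_nat i + 1) / fact i * w ^ i) * (rGamma (\<nu> + of_nat (n - i) + 1) / fact (n - i) * w ^ (n - i))
        = (((\<nu> + of_nat n) gchoose i) * ((\<mu> + of_nat n) gchoose (n - i))) * (rGamma (\<mu> + of_nat n + 1) * rGamma (\<nu> + of_nat n + 1) * w ^ n)"
      if "i \<le> n" for i
    proof -
      have "rGamma (\<mu> + of_nat i + 1) = pochhammer (\<mu> + of_nat i + 1) (n - i) * rGamma (\<mu> + of_nat n + 1)"
        using pochhammer_rGamma[of "\<mu> + of_nat i + 1" "n - i"] that by (simp add: of_nat_diff add_ac)
      moreover have "((\<mu> + of_nat n) gchoose (n - i)) = pochhammer (\<mu> + of_nat i + 1) (n - i) / fact (n - i)"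
        using that by (simp add: gbinomial_pochhammer' of_nat_diff)
      ultimately have 1: "rGamma (\<mu> + of_nat i + 1) / fact (n - i) = ((\<mu> + of_nat n) gchoose (n - i)) * rGamma (\<mu> + of_nat n + 1)"
        by simp
      have "rGamma (\<nu> + of_nat (n - i) + 1) = pochhammer (\<nu> + of_nat (n - i) + 1) i * rGamma (\<nu> + of_nat n + 1)"
        using pochhammer_rGamma[of "\<nu> + of_nat (n - i) + 1" i] that by (simp add: of_nat_diff add_ac)
      moreover have "((\<nu> + of_nat n) gchoose i) = pochhammer (\<nu> + of_nat (n - i) + 1) i / fact i"
        using that by (simp add: gbinomial_pochhammer' of_nat_diff algebra_simps)
      ultimately have 2: "rGamma (\<nu> + of_nat (n - i) + 1) / fact i = ((\<nu> + of_nat n) gchoose i) * rGamma (\<nu> + of_nat n + 1)"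
        by simp
      have "(rGamma (\<mu> + of_nat i + 1) / fact i * w ^ i) * (rGamma (\<nu> + of_nat (n - i) + 1) / fact (n - i) * w ^ (n - i))
         = (rGamma (\<mu> + of_nat i + 1) / fact (n - i)) * (rGamma (\<nu> + of_nat (n - i) + 1) / fact i) * (w ^ i * w ^ (n - i))"
        by (simp add: field_simps)
      also have "w ^ i * w ^ (n - i) = w ^ n" using that by (simp flip: power_add)
      finally show ?thesis unfolding 1 2 by (simp add: mult_ac)
    qed
    hence "(\<Sum>i\<le>n. (rGamma (\<mu> + of_nat i + 1) / fact i * w ^ i) * (rGamma (\<nu> + of_nat (n - i) + 1) / fact (n - i) * w ^ (n - i)))
       = (\<Sum>i\<le>n. ((\<nu> + of_nat n) gchoose i) * ((\<mu> + of_nat n) gchoose (n - i))) * (rGamma (\<mu> + of_nat n + 1) * rGamma (\<nu> + of_nat n + 1) * w ^ n)"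
      by (simp add: sum_distrib_right)
    also have "(\<Sum>i\<le>n. ((\<nu> + of_nat n) gchoose i) * ((\<mu> + of_nat n) gchoose (n - i))) = (\<nu> + of_nat n + (\<mu> + of_nat n)) gchoose n"
      by (subst atMost_atLeast0) (rule gbinomial_Vandermonde)
    also have "\<nu> + of_nat n + (\<mu> + of_nat n) = \<mu> + \<nu> + 2 * of_nat n" by simp
    finally show "(\<Sum>i\<le>n. (rGamma (\<mu> + of_nat i + 1) / fact i * w ^ i) * (rGamma (\<nu> + of_nat (n - i) + 1) / fact (n - i) * w ^ (n - i)))
       = ((\<mu> + \<nu> + 2 * of_nat n) gchoose n) * rGamma (\<mu> + of_nat n + 1) * rGamma (\<nu> + of_nat n + 1) * w ^ n"
      by (simp add: mult_ac)
  qed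
  finally show ?thesis .
qed

text \<open>Legendre's duplication formula splits Gamma(2a + 2n + 1) into the Gamma values at a + n
  + 1/2 and a + n + 1. The half-integer shift is the one that occurs in the Meijer
  parameters.\<close>

lemma gbinomial_central:
  fixes a :: complex
  assumes "a + of_nat n + 1/2 \<notin> \<int>\<^sub>\<le>\<^sub>0" "a + of_nat n + 1 \<notin> \<int>\<^sub>\<le>\<^sub>0"
  shows "((2 * a + 2 * of_nat n) gchoose n) = exp ((2 * a + 2 * of_nat n) * of_real (ln 2)) / of_real (sqrt pi) *
           Gamma (a + of_nat n + 1/2) * Gamma (a + of_nat n + 1) * rGamma (2 * a + of_nat n + 1) / fact n"
proof -
  let ?z = "a + of_nat n + 1/2"
  have z: "?z + 1/2 = a + of_nat n + 1" by simp
  have z2: "2 * ?z = 2 * a + 2 * of_nat n + 1" by (simp add: algebra_simps)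
  have leg: "Gamma ?z * Gamma (a + of_nat n + 1) = exp ((1 - 2 * ?z) * of_real (ln 2)) * of_real (sqrt pi) * Gamma (2 * a + 2 * of_nat n + 1)"
    using Gamma_legendre_duplication[of ?z] assms unfolding z z2 by blast
  have "Gamma ?z \<noteq> 0" "Gamma (a + of_nat n + 1) \<noteq> 0" using assms by (auto simp: Gamma_eq_zero_iff)
  hence nz: "Gamma (2 * a + 2 * of_nat n + 1) \<noteq> 0" using leg by auto
  have "exp ((2 * a + 2 * of_nat n) * of_real (ln 2)) * exp ((1 - 2 * ?z) * of_real (ln 2)) = 1"
    by (simp add: algebra_simps flip: exp_add)
  hence "Gamma (2 * a + 2 * of_nat n + 1) * (exp ((2 * a + 2 * of_nat n) * of_real (ln 2)) * exp ((1 - 2 * ?z) * of_real (ln 2))) =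
     Gamma (2 * a + 2 * of_nat n + 1)" by simp
  hence G: "Gamma (2 * a + 2 * of_nat n + 1) = exp ((2 * a + 2 * of_nat n) * of_real (ln 2)) / of_real (sqrt pi) *
           Gamma ?z * Gamma (a + of_nat n + 1)"
    unfolding mult.assoc leg by (simp add: mult_ac)
  have "rGamma (2 * a + of_nat n + 1) = pochhammer (2 * a + of_nat n + 1) n * rGamma (2 * a + 2 * of_nat n + 1)"
    using pochhammer_rGamma[of "2 * a + of_nat n + 1" n] by (simp add: algebra_simps)
  hence "pochhammer (2 * a + of_nat n + 1) n = rGamma (2 * a + of_nat n + 1) * Gamma (2 * a + 2 * of_nat n + 1)"
    using nz by (simp add: Gamma_def field_simps)
  moreover have "((2 * a + 2 * of_nat n) gchoose n) = pochhammer (2 * a + of_nat n + 1) n / fact n"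
    by (simp add: gbinomial_pochhammer' algebra_simps)
  ultimately show ?thesis unfolding G by (simp add: mult_ac)
qed

lemma exp_two_ln2: "exp ((2 * a + 2 * of_nat n) * of_real (ln 2)) = exp (2 * a * of_real (ln 2)) * (4 ^ n :: complex)"
proof -
  have "exp (of_nat n * (2 * complex_of_real (ln 2))) = exp (2 * complex_of_real (ln 2)) ^ n"
    by (rule exp_of_nat_mult)
  also have "exp (2 * complex_of_real (ln 2)) = of_real (exp (ln 4))"
    using ln_realpow[of 2 2] by (simp flip: exp_of_real)
  finally have "exp (of_nat n * (2 * complex_of_real (ln 2))) = 4 ^ n" by simp
  thus ?thesis by (simp add: ring_distribs exp_add mult_ac)
qed

text \<open>The terms have the shape of the residues at s = n in \<open>barnes_IK\<close> and
  \<open>barnes_KK\<close> with w = exp l. The 4^n of the central binomial coefficient is cancelled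
  by evaluating at w / 4.\<close>

lemma besB_mult_minus_sums:
  "(\<lambda>n. Gamma (of_nat n + 1/2) / fact n * rGamma (of_nat n + 1 - \<nu>) * rGamma (of_nat n + 1 + \<nu>) * w ^ n)
     sums (of_real (sqrt pi) * (besB (- \<nu>) (w / 4) * besB \<nu> (w / 4)))"
proof -
  have g: "((2 * of_nat n :: complex) gchoose n) = 4 ^ n / of_real (sqrt pi) * Gamma (of_nat n + 1/2) / fact n" for n
  proof -
    have n: "(0 + of_nat n + 1/2 :: complex) \<notin> \<int>\<^sub>\<le>\<^sub>0" "(0 + of_nat n + 1 :: complex) \<notin> \<int>\<^sub>\<le>\<^sub>0"
      by (auto elim!: nonpos_Ints_cases simp: complex_eq_iff)
    hence AR: "Gamma (of_nat n + 1) * rGamma (of_nat n + 1 :: complex) = 1"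
      by (simp add: rGamma_inverse_Gamma Gamma_eq_zero_iff)
    have E: "exp (2 * of_nat n * complex_of_real (ln 2)) = 4 ^ n"
      using exp_two_ln2[of 0 n] by simp
    have "((2 * of_nat n :: complex) gchoose n) = exp (2 * of_nat n * of_real (ln 2)) / of_real (sqrt pi) *
           Gamma (of_nat n + 1/2) * Gamma (of_nat n + 1) * rGamma (of_nat n + 1) / fact n"
      using gbinomial_central[OF n] by (simp only: mult_zero_right add_0_left)
    thus ?thesis unfolding E by (simp only: mult.assoc AR mult_1_right)
  qed
  have "(\<lambda>n. of_real (sqrt pi) * (((- \<nu> + \<nu> + 2 * of_nat n) gchoose n) * rGamma (- \<nu> + of_nat n + 1) * rGamma (\<nu> + of_nat n + 1) * (w / 4) ^ n))
     sums (of_real (sqrt pi) * (besB (- \<nu>) (w / 4) * besB \<nu> (w / 4)))"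
    by (intro sums_mult besB_mult_sums)
  also have "(\<lambda>n. of_real (sqrt pi) * (((- \<nu> + \<nu> + 2 * of_nat n) gchoose n) * rGamma (- \<nu> + of_nat n + 1) * rGamma (\<nu> + of_nat n + 1) * (w / 4) ^ n))
     = (\<lambda>n. Gamma (of_nat n + 1/2) / fact n * rGamma (of_nat n + 1 - \<nu>) * rGamma (of_nat n + 1 + \<nu>) * w ^ n)"
  proof
    fix n
    have a: "- \<nu> + \<nu> + 2 * of_nat n = 2 * of_nat n" "- \<nu> + of_nat n + 1 = of_nat n + 1 - \<nu>"
            "\<nu> + of_nat n + 1 = of_nat n + 1 + \<nu>" by simp_all
    have "P * (F / P * G / f * r * q * (W / F)) = G / f * r * q * W" if "P \<noteq> 0" "F \<noteq> 0" for P F G f r q W :: complex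
      using that by (simp add: divide_inverse) (simp add: field_simps)
    from this[of "of_real (sqrt pi)" "4 ^ n"]
    show "of_real (sqrt pi) * (((- \<nu> + \<nu> + 2 * of_nat n) gchoose n) * rGamma (- \<nu> + of_nat n + 1) * rGamma (\<nu> + of_nat n + 1) * (w / 4) ^ n)
       = Gamma (of_nat n + 1/2) / fact n * rGamma (of_nat n + 1 - \<nu>) * rGamma (of_nat n + 1 + \<nu>) * w ^ n"
      unfolding a g power_divide by simp
  qed
  finally show ?thesis .
qed

text \<open>Counterpart for the residues at s = nu + n. Here the duplication formula also yields
  4^nu, hence the compensating factor exp(-2 nu ln 2); the hypothesis keeps its Gamma arguments off
  the poles.\<close>

lemma besB_square_sums:
  assumes "2 * \<nu> \<notin> \<int>"
  shows "(\<lambda>n. Gamma (of_nat n + 1/2 + \<nu>) / fact n * rGamma (of_nat n + 1 + \<nu>) * rGamma (of_nat n + 1 + 2 * \<nu>) * w ^ n)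
     sums (of_real (sqrt pi) * exp (- (2 * \<nu> * of_real (ln 2))) * (besB \<nu> (w / 4))\<^sup>2)"
proof -
  have n: "\<nu> + of_nat n + 1/2 \<notin> \<int>\<^sub>\<le>\<^sub>0" "\<nu> + of_nat n + 1 \<notin> \<int>\<^sub>\<le>\<^sub>0" for n
  proof -
    have "2 * \<nu> \<in> \<int>" if "\<nu> + of_nat n + 1/2 = of_int k \<or> \<nu> + of_nat n + 1 = of_int k" for k
    proof -
      have "2 * \<nu> = 2 * (\<nu> + of_nat n + 1/2) - of_int (2 * int n + 1)"
           "2 * \<nu> = 2 * (\<nu> + of_nat n + 1) - of_int (2 * int n + 2)"
        by (simp_all add: algebra_simps)
      hence "2 * \<nu> = 2 * of_int k - of_int (2 * int n + 1) \<or> 2 * \<nu> = 2 * of_int k - of_int (2 * int n + 2)"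
        using that by metis
      thus ?thesis by (metis Ints_diff Ints_mult Ints_of_int Ints_numeral)
    qed
    thus "\<nu> + of_nat n + 1/2 \<notin> \<int>\<^sub>\<le>\<^sub>0" "\<nu> + of_nat n + 1 \<notin> \<int>\<^sub>\<le>\<^sub>0"
      using assms by (auto elim!: nonpos_Ints_cases)
  qed
  let ?E = "exp (2 * \<nu> * of_real (ln 2))"
  have g: "((\<nu> + \<nu> + 2 * of_nat n) gchoose n) * rGamma (\<nu> + of_nat n + 1) =
     ?E * 4 ^ n / of_real (sqrt pi) * Gamma (\<nu> + of_nat n + 1/2) * rGamma (2 * \<nu> + of_nat n + 1) / fact n" for n
  proof -
    have AR: "Gamma (\<nu> + of_nat n + 1) * rGamma (\<nu> + of_nat n + 1) = 1"
      using n(2)[of n] by (simp add: rGamma_inverse_Gamma Gamma_eq_zero_iff)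
    have "X * G * A * R2 / F * R1 = X * G * R2 / F * (A * R1)" for X G A R2 F R1 :: complex
      by (simp add: divide_inverse mult_ac)
    moreover have "\<nu> + \<nu> + 2 * of_nat n = 2 * \<nu> + 2 * of_nat n" by simp
    ultimately show ?thesis
      by (simp only: gbinomial_central[OF n] exp_two_ln2 AR mult_1_right)
  qed
  let ?c = "of_real (sqrt pi) * exp (- (2 * \<nu> * of_real (ln 2)))"
  have e: "exp (- (2 * \<nu> * of_real (ln 2))) * ?E = 1" by (simp only: exp_minus_inverse mult.commute)
  have "(\<lambda>n. ?c * (((\<nu> + \<nu> + 2 * of_nat n) gchoose n) * rGamma (\<nu> + of_nat n + 1) * rGamma (\<nu> + of_nat n + 1) * (w / 4) ^ n))
     sums (?c * (besB \<nu> (w / 4) * besB \<nu> (w / 4)))"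
    by (intro sums_mult besB_mult_sums)
  also have "(\<lambda>n. ?c * (((\<nu> + \<nu> + 2 * of_nat n) gchoose n) * rGamma (\<nu> + of_nat n + 1) * rGamma (\<nu> + of_nat n + 1) * (w / 4) ^ n))
     = (\<lambda>n. Gamma (of_nat n + 1/2 + \<nu>) / fact n * rGamma (of_nat n + 1 + \<nu>) * rGamma (of_nat n + 1 + 2 * \<nu>) * w ^ n)"
  proof
    fix n
    have a: "\<nu> + of_nat n + 1/2 = of_nat n + 1/2 + \<nu>" "\<nu> + of_nat n + 1 = of_nat n + 1 + \<nu>"
            "2 * \<nu> + of_nat n + 1 = of_nat n + 1 + 2 * \<nu>" by simp_all
    have rearr: "P * e * (E * F / P * G * R / f * r * (W / F)) = G / f * r * R * W"
      if "P \<noteq> 0" "F \<noteq> 0" "e * E = 1" for P e E F G R f r W :: complex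
    proof -
      have "P * e * (E * F / P * G * R / f * r * (W / F)) = (e * E) * (G / f * r * R * W)"
        using that(1,2) by (simp add: divide_inverse) (simp add: field_simps)
      thus ?thesis using that(3) by simp
    qed
    show "?c * (((\<nu> + \<nu> + 2 * of_nat n) gchoose n) * rGamma (\<nu> + of_nat n + 1) * rGamma (\<nu> + of_nat n + 1) * (w / 4) ^ n) =
      Gamma (of_nat n + 1/2 + \<nu>) / fact n * rGamma (of_nat n + 1 + \<nu>) * rGamma (of_nat n + 1 + 2 * \<nu>) * w ^ n"
      unfolding g unfolding a power_divide by (rule rearr[OF _ _ e]) simp_all
  qed
  finally show ?thesis by (simp only: power2_eq_square)
qed

section \<open>The modified Bessel function and its Wronskian with K\<close>

definition besI :: "complex \<Rightarrow> complex \<Rightarrow> complex" where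
  "besI \<nu> t = exp (\<nu> * Ln (t / 2)) * besB \<nu> (t\<^sup>2 / 4)"

lemma bessel_I_eq:
  assumes "t \<noteq> 0"
  shows "bessel_I \<nu> t = besI \<nu> t"
proof -
  have "(t / 2) ^ (2 * k) / (fact k * Gamma (\<nu> + of_nat k + 1)) = rGamma (\<nu> + of_nat k + 1) / fact k * (t\<^sup>2 / 4) ^ k" for k
  proof -
    have "(t / 2) ^ (2 * k) = (t\<^sup>2 / 4) ^ k" by (simp add: power_mult power_divide)
    moreover have "x / (f * g) = inverse g / f * x" for x f g :: complex by (simp add: divide_inverse)
    ultimately show ?thesis unfolding rGamma_inverse_Gamma by (simp only:)
  qed
  thus ?thesis unfolding bessel_I_def besI_def besB_def using assms by (simp add: powr_def)
qed

lemma exp_Ln_half_shift: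
  "t \<noteq> 0 \<Longrightarrow> exp ((\<nu> + 1) * Ln (t / 2)) = exp (\<nu> * Ln (t / 2)) * (t / 2)"
  by (simp add: distrib_right exp_add)

lemma besI_deriv:
  assumes "Re t > 0"
  shows "(besI \<nu> has_field_derivative \<nu> / t * besI \<nu> t + besI (\<nu> + 1) t) (at t)"
proof -
  have t: "t / 2 \<notin> \<real>\<^sub>\<le>\<^sub>0" "t \<noteq> 0" using assms by (auto simp: complex_nonpos_Reals_iff)
  have "((\<lambda>t. exp (\<nu> * Ln (t / 2))) has_field_derivative exp (\<nu> * Ln (t / 2)) * (\<nu> / t)) (at t)"
    using t by (auto intro!: derivative_eq_intros simp: field_simps)
  moreover have "((\<lambda>t. besB \<nu> (t\<^sup>2 / 4)) has_field_derivative besB (\<nu> + 1) (t\<^sup>2 / 4) * (t / 2)) (at t)"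
    by (rule DERIV_chain2[OF besB_deriv]) (auto intro!: derivative_eq_intros)
  ultimately have "(besI \<nu> has_field_derivative exp (\<nu> * Ln (t / 2)) * (\<nu> / t) * besB \<nu> (t\<^sup>2 / 4) +
      besB (\<nu> + 1) (t\<^sup>2 / 4) * (t / 2) * exp (\<nu> * Ln (t / 2))) (at t)"
    unfolding besI_def [abs_def] by (rule DERIV_mult)
  thus ?thesis
    by (rule DERIV_cong) (simp only: besI_def exp_Ln_half_shift[OF t(2)] mult_ac)
qed

lemma besI_deriv_up:
  assumes "Re t > 0"
  shows "(besI (\<nu> + 1) has_field_derivative besI \<nu> t - (\<nu> + 1) / t * besI (\<nu> + 1) t) (at t)"
proof -
  have t: "t \<noteq> 0" using assms by auto
  have b: "besB \<nu> (t\<^sup>2 / 4) = (\<nu> + 1) * besB (\<nu> + 1) (t\<^sup>2 / 4) + t\<^sup>2 / 4 * besB (\<nu> + 1 + 1) (t\<^sup>2 / 4)"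
    using besB_rec[of \<nu> "t\<^sup>2 / 4"] by (simp add: add_ac)
  have "(n + 1) / t * (E * (t / 2) * b1) + E * (t / 2) * (t / 2) * b2 =
          E * ((n + 1) * b1 + t\<^sup>2 / 4 * b2) - (n + 1) / t * (E * (t / 2) * b1)" for n E b1 b2 :: complex
    using t by (simp add: field_simps power2_eq_square)
  hence "(\<nu> + 1) / t * besI (\<nu> + 1) t + besI (\<nu> + 1 + 1) t = besI \<nu> t - (\<nu> + 1) / t * besI (\<nu> + 1) t"
    unfolding besI_def exp_Ln_half_shift[OF t] b by blast
  thus ?thesis using besI_deriv[OF assms, of "\<nu> + 1"] by (simp only:)
qed

lemma besI_tendsto:
  assumes "X \<longlonglongrightarrow> \<nu>"
  shows "(\<lambda>n. besI (X n) t) \<longlonglongrightarrow> besI \<nu> t"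
  unfolding besI_def by (intro tendsto_intros assms besB_tendsto)

lemma besI_real_nonneg:
  assumes "\<nu> \<ge> 0" "t > 0"
  shows "\<exists>r\<ge>0. besI (of_real \<nu>) (of_real t) = of_real r"
proof -
  have "rGamma (of_real \<nu> + of_nat k + 1) = complex_of_real (rGamma (\<nu> + of_nat k + 1))" for k
    using rGamma_complex_of_real[of "\<nu> + of_nat k + 1"] by simp
  hence eq: "rGamma (of_real \<nu> + of_nat k + 1) / fact k * ((of_real t)\<^sup>2 / 4) ^ k =
      complex_of_real (rGamma (\<nu> + of_nat k + 1) / fact k * (t\<^sup>2 / 4) ^ k)" for k by simp
  have s: "(\<lambda>k. complex_of_real (rGamma (\<nu> + of_nat k + 1) / fact k * (t\<^sup>2 / 4) ^ k)) sums besB (of_real \<nu>) ((of_real t)\<^sup>2 / 4)"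
    using besB_sums[of "of_real \<nu>" "(of_real t)\<^sup>2 / 4"] unfolding eq .
  hence r: "(\<lambda>k. rGamma (\<nu> + of_nat k + 1) / fact k * (t\<^sup>2 / 4) ^ k) sums Re (besB (of_real \<nu>) ((of_real t)\<^sup>2 / 4))"
    using sums_Re[OF s] by (simp only: Re_complex_of_real)
  hence B: "besB (of_real \<nu>) ((of_real t)\<^sup>2 / 4) = of_real (Re (besB (of_real \<nu>) ((of_real t)\<^sup>2 / 4)))"
    using s sums_of_real[OF r] sums_unique2 by blast
  have "rGamma (\<nu> + of_nat k + 1) \<ge> 0" for k
    using assms by (auto simp: rGamma_inverse_Gamma intro!: less_imp_le Gamma_real_pos)
  hence "0 \<le> Re (besB (of_real \<nu>) ((of_real t)\<^sup>2 / 4))"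
    using r assms by (intro sums_le[OF _ sums_zero r]) auto
  moreover have "exp (of_real \<nu> * Ln (of_real t / 2)) = complex_of_real (exp (\<nu> * ln (t / 2)))"
    using Ln_of_real[of "t/2"] assms by (simp flip: exp_of_real)
  ultimately show ?thesis unfolding besI_def
    by (subst B, intro exI[of _ "exp (\<nu> * ln (t / 2)) * Re (besB (of_real \<nu>) ((of_real t)\<^sup>2 / 4))"]) auto
qed

definition knon :: "complex \<Rightarrow> complex \<Rightarrow> complex" where
  "knon \<nu> t = of_real pi / 2 * ((besI (- \<nu>) t - besI \<nu> t) / sin (of_real pi * \<nu>))"

lemma sin_pi_eq_0_iff: "sin (of_real pi * \<nu>) = 0 \<longleftrightarrow> (\<nu> :: complex) \<in> \<int>"
proof -
  have "sin (of_real pi * \<nu>) = 0 \<longleftrightarrow> (\<exists>n::int. of_real pi * \<nu> = of_real (n * pi))" by (rule sin_eq_0)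
  also have "\<dots> \<longleftrightarrow> (\<exists>n::int. \<nu> = of_int n)" by (auto simp: mult.commute)
  finally show ?thesis by (auto elim: Ints_cases)
qed

text \<open>The sines at nu and nu + 1 are opposite, so the products I_nu I_(nu+1) cancel. In the
  remaining products the powers of t/2 combine to (t/2)^(-1) and t/2, leaving
  \<open>besB_wronskian\<close>.\<close>

lemma knon_wronskian:
  assumes "\<nu> \<notin> \<int>" "t \<noteq> 0"
  shows "t * (besI \<nu> t * knon (\<nu> + 1) t + besI (\<nu> + 1) t * knon \<nu> t) = 1"
proof -
  let ?s = "sin (of_real pi * \<nu>)"
  have s: "?s \<noteq> 0" using assms by (simp add: sin_pi_eq_0_iff)
  have s1: "sin (of_real pi * (\<nu> + 1)) = - ?s" by (simp add: ring_distribs sin_add)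
  have e1: "besI \<nu> t * besI (- \<nu> - 1) t = 2 / t * (besB \<nu> (t\<^sup>2/4) * besB (- \<nu> - 1) (t\<^sup>2/4))"
  proof -
    have "exp (\<nu> * Ln (t / 2)) * exp ((- \<nu> - 1) * Ln (t / 2)) = exp (- Ln (t / 2))"
      by (simp add: algebra_simps flip: exp_add)
    also have "\<dots> = 2 / t" using assms by (simp add: exp_minus)
    finally have E: "exp (\<nu> * Ln (t / 2)) * exp ((- \<nu> - 1) * Ln (t / 2)) = 2 / t" .
    have rearr: "(X * p) * (Y * q) = (X * Y) * (p * q)" for X Y p q :: complex by (simp add: mult_ac)
    show ?thesis unfolding besI_def by (subst rearr) (simp only: E)
  qed
  have e2: "besI (\<nu> + 1) t * besI (- \<nu>) t = t / 2 * (besB (\<nu> + 1) (t\<^sup>2/4) * besB (- \<nu>) (t\<^sup>2/4))"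
  proof -
    have "exp ((\<nu> + 1) * Ln (t / 2)) * exp (- \<nu> * Ln (t / 2)) = exp (Ln (t / 2))"
      by (simp add: algebra_simps flip: exp_add)
    also have "\<dots> = t / 2" using assms by simp
    finally have E: "exp ((\<nu> + 1) * Ln (t / 2)) * exp (- \<nu> * Ln (t / 2)) = t / 2" .
    have rearr: "(X * p) * (Y * q) = (X * Y) * (p * q)" for X Y p q :: complex by (simp add: mult_ac)
    show ?thesis unfolding besI_def by (subst rearr) (simp only: E)
  qed
  have "t * (besI \<nu> t * knon (\<nu> + 1) t + besI (\<nu> + 1) t * knon \<nu> t) =
          of_real pi / (2 * ?s) * (t * (besI (\<nu> + 1) t * besI (- \<nu>) t) - t * (besI \<nu> t * besI (- \<nu> - 1) t))"
    unfolding knon_def s1 minus_add_distrib diff_conv_add_uminus using s by (simp add: field_simps)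
  also have "t * (besI (\<nu> + 1) t * besI (- \<nu>) t) - t * (besI \<nu> t * besI (- \<nu> - 1) t) =
         2 * (t\<^sup>2/4 * besB (\<nu> + 1) (t\<^sup>2/4) * besB (- \<nu>) (t\<^sup>2/4) - besB \<nu> (t\<^sup>2/4) * besB (- \<nu> - 1) (t\<^sup>2/4))"
    unfolding e1 e2 using assms by (simp add: field_simps power2_eq_square)
  also have "\<dots> = 2 * (?s / of_real pi)" by (simp only: besB_wronskian)
  finally show ?thesis using s by simp
qed

section \<open>Evaluation of Mellin--Barnes integrals\<close>

lemma Gamma_minus_analytic:
  fixes b p :: complex
  assumes "b - p \<notin> \<int>\<^sub>\<le>\<^sub>0"
  shows "(\<lambda>s. Gamma (b - s)) analytic_on {p}"
proof -
  have "Gamma \<circ> (\<lambda>s. b - s) analytic_on {p}"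
    by (intro analytic_on_compose analytic_Gamma analytic_intros) (use assms in auto)
  thus ?thesis by (simp add: o_def)
qed

lemma rGamma_analytic_compose:
  fixes g :: "complex \<Rightarrow> complex"
  assumes "g analytic_on {p}"
  shows "(\<lambda>s. rGamma (g s)) analytic_on {p}"
proof -
  have "rGamma \<circ> g analytic_on {p}"
    by (intro analytic_on_compose assms) (auto simp: analytic_on_holomorphic intro!: exI[of _ UNIV] holomorphic_rGamma)
  thus ?thesis by (simp add: o_def)
qed

text \<open>The leading minus sign comes from the reversed orientation s -> b - s. The cofactor only
  has to be analytic at the pole, so that other Gamma factors may be part of it.\<close>

lemma residue_Gamma_minus_mult:
  fixes b :: complex
  assumes h: "h analytic_on {b + of_nat k}"
  shows "residue (\<lambda>s. Gamma (b - s) * h s) (b + of_nat k) = - ((-1) ^ k / fact k * h (b + of_nat k))"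
proof -
  let ?p = "b + of_nat k"
  obtain e where e: "e > 0" "h holomorphic_on ball ?p e" using h unfolding analytic_on_def by auto
  \<comment> \<open>The poles are spaced by 1, so radius at most 1 excludes all the others.\<close>
  define U where "U = ball ?p (min e 1)"
  show ?thesis
  proof (rule residue_simple')
    show "open U" "?p \<in> U" using e by (auto simp: U_def)
    have "b - s \<notin> \<int>\<^sub>\<le>\<^sub>0" if "s \<in> U - {?p}" for s
    proof
      assume "b - s \<in> \<int>\<^sub>\<le>\<^sub>0"
      then obtain m where "b - s = - of_nat m" by (auto elim!: nonpos_Ints_cases')
      hence s: "s = b + of_nat m" by (simp add: algebra_simps)
      have "?p - s = of_int (int k - int m)" unfolding s by simp
      hence "dist ?p s = of_int \<bar>int k - int m\<bar>" unfolding dist_norm by (simp only: norm_of_int of_int_abs)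
      moreover have "int k \<noteq> int m" using that s by auto
      ultimately show False using that by (auto simp: U_def)
    qed
    thus "(\<lambda>s. Gamma (b - s) * h s) holomorphic_on U - {?p}"
      by (intro holomorphic_intros holomorphic_on_subset[OF e(2)]) (auto simp: U_def)
    have f: "filterlim (\<lambda>s. b - s) (at (- of_nat k)) (at ?p)"
    proof (rule filterlim_atI)
      have "((\<lambda>s. b - s) \<longlongrightarrow> b - ?p) (at ?p)" by (intro tendsto_intros)
      thus "((\<lambda>s. b - s) \<longlongrightarrow> - of_nat k) (at ?p)" by simp
      show "\<forall>\<^sub>F s in at ?p. b - s \<noteq> - of_nat k"
        using eventually_neq_at_within[of ?p ?p UNIV]
        by eventually_elim (auto simp: algebra_simps)
    qed
    have "((\<lambda>s. Gamma (b - s) * (b - s + of_nat k)) \<longlongrightarrow> (-1) ^ k / fact k) (at ?p)"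
      by (rule filterlim_compose[OF Gamma_residues f])
    moreover have "(h \<longlongrightarrow> h ?p) (at ?p)"
      using analytic_at_imp_isCont[OF h] by (simp add: isCont_def)
    ultimately have "((\<lambda>s. - (Gamma (b - s) * (b - s + of_nat k) * h s)) \<longlongrightarrow> - ((-1) ^ k / fact k * h ?p)) (at ?p)"
      by (intro tendsto_intros)
    thus "((\<lambda>s. Gamma (b - s) * h s * (s - ?p)) \<longlongrightarrow> - ((-1) ^ k / fact k * h ?p)) (at ?p)"
      by (rule Lim_transform_eventually) (intro always_eventually allI, simp add: algebra_simps)
  qed
qed

text \<open>Holds without exception thanks to the conventions: at a nonpositive integer the left
  side is 0, and on the right either Gamma(z + 1) = 0 or, for z = 0, the division is by 0. Step
  formulas for the Barnes integrands thus need no case distinction.\<close>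

lemma Gamma_div_plus1: "Gamma (z::complex) = Gamma (z + 1) / z"
proof (cases "z \<in> \<int>\<^sub>\<le>\<^sub>0")
  case True
  show ?thesis
  proof (cases "z = 0")
    case False
    obtain n where n: "z = - of_nat n" using True by (auto elim!: nonpos_Ints_cases')
    with False obtain m where "n = Suc m" by (cases n) auto
    hence "z + 1 = - of_nat m" using n by simp
    hence "z + 1 \<in> \<int>\<^sub>\<le>\<^sub>0" by (metis minus_of_nat_in_nonpos_Ints)
    hence "Gamma (z + 1) = 0" "Gamma z = 0" using True by (simp_all only: Gamma_eq_zero_iff)
    thus ?thesis by (simp only: div_0)
  qed (simp add: Gamma_eq_zero_iff)
next
  case False
  hence "z \<noteq> 0" by auto
  thus ?thesis using Gamma_plus1[OF False] by simp
qed

lemma Gamma_minus_step: "Gamma (b - (s + 1)) = Gamma (b - s) / (b - s - (1::complex))"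
  using Gamma_div_plus1[of "b - s - 1"] by (simp add: algebra_simps)

lemma sin_pi_minus_nat: "sin (of_real pi * (\<nu> - of_nat k)) = (-1) ^ k * sin (of_real pi * (\<nu>::complex))"
proof -
  have "sin (of_real pi * of_nat k :: complex) = 0" "cos (of_real pi * of_nat k :: complex) = (-1) ^ k"
  proof -
    have e: "of_real pi * of_nat k = complex_of_real (real k * pi)" by simp
    show "sin (of_real pi * of_nat k :: complex) = 0" "cos (of_real pi * of_nat k :: complex) = (-1) ^ k"
      unfolding e sin_of_real cos_of_real sin_npi cos_npi by simp_all
  qed
  thus ?thesis by (simp add: right_diff_distrib sin_diff)
qed

text \<open>Reflection turns the Gamma factors evaluated along a sequence of poles into the
  reciprocal Gamma factors of the Bessel series. The sign (-1)^k cancels the one in the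
  residue.\<close>

lemma Gamma_minus_nat:
  fixes \<nu> :: complex
  assumes "\<nu> \<notin> \<int>"
  shows "Gamma (\<nu> - of_nat k) = (-1) ^ k * (of_real pi / sin (of_real pi * \<nu>) * rGamma (of_nat k + 1 - \<nu>))"
proof -
  have "1 - (\<nu> - of_nat k) \<notin> \<int>\<^sub>\<le>\<^sub>0"
  proof
    assume "1 - (\<nu> - of_nat k) \<in> \<int>\<^sub>\<le>\<^sub>0"
    then obtain m where "1 - (\<nu> - of_nat k) = of_int m" by (auto elim!: nonpos_Ints_cases)
    hence "\<nu> = of_int (int k + 1 - m)" by (simp add: algebra_simps)
    thus False using assms by (metis Ints_of_int)
  qed
  hence nz: "Gamma (1 - (\<nu> - of_nat k)) \<noteq> 0" by (simp add: Gamma_eq_zero_iff)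
  have "Gamma (\<nu> - of_nat k) = of_real pi / ((-1) ^ k * sin (of_real pi * \<nu>)) * rGamma (1 - (\<nu> - of_nat k))"
  proof -
    have "A = C * inverse B" if "A * B = C" "B \<noteq> 0" for A B C :: complex
      using that by (auto simp: field_simps)
    from this[OF Gamma_reflection_complex nz] show ?thesis
      unfolding sin_pi_minus_nat rGamma_inverse_Gamma .
  qed
  also have "of_real pi / ((-1) ^ k * sin (of_real pi * \<nu>)) = (-1) ^ k * (of_real pi / sin (of_real pi * \<nu>))"
    by (cases "even k") auto
  finally show ?thesis by (simp add: algebra_simps)
qed

lemma rGamma_half_minus:
  "rGamma (1/2 - \<nu> - of_nat k) = (-1) ^ k * cos (of_real pi * \<nu>) / of_real pi * Gamma (of_nat k + 1/2 + \<nu>)"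
  if "of_nat k + 1/2 + \<nu> \<notin> \<int>\<^sub>\<le>\<^sub>0" for \<nu> :: complex
proof -
  let ?z = "of_nat k + 1/2 + \<nu>"
  have "rGamma ?z * rGamma (1 - ?z) = sin (of_real pi * ?z) / of_real pi" by (rule rGamma_reflection_complex)
  moreover have "1 - ?z = 1/2 - \<nu> - of_nat k" by (simp add: algebra_simps)
  moreover have "sin (of_real pi * ?z) = (-1) ^ k * cos (of_real pi * \<nu>)"
  proof -
    have "sin (of_real pi * ?z) = (-1) ^ k * sin (of_real pi * (?z - of_nat k))"
      unfolding sin_pi_minus_nat by (simp flip: mult.assoc power_mult_distrib)
    also have "of_real pi * (?z - of_nat k) = of_real (pi / 2) + of_real pi * \<nu>" by (simp add: algebra_simps)
    also have "sin \<dots> = cos (of_real pi * \<nu>)"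
      by (simp only: sin_add sin_of_real cos_of_real sin_pi_half cos_pi_half) simp
    finally show ?thesis .
  qed
  ultimately have "rGamma ?z * rGamma (1/2 - \<nu> - of_nat k) = (-1) ^ k * cos (of_real pi * \<nu>) / of_real pi" by simp
  hence "Gamma ?z * rGamma ?z * rGamma (1/2 - \<nu> - of_nat k) = (-1) ^ k * cos (of_real pi * \<nu>) / of_real pi * Gamma ?z"
    by (simp add: mult_ac)
  moreover have "Gamma ?z * rGamma ?z = 1" using that by (simp add: rGamma_inverse_Gamma Gamma_eq_zero_iff)
  ultimately show ?thesis by simp
qed

lemma exp_int_pole:
  fixes b l :: complex
  shows "exp ((b + of_nat k) * l) = exp (b * l) * exp l ^ k"
  by (simp add: distrib_right exp_add exp_of_nat_mult)

lemma sign_cancel: "(-1) ^ k / f * ((-1) ^ k * x) = x / (f :: complex)"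
  by (cases "even k") auto

lemma half_quotient_le: "0 < e \<Longrightarrow> 2 * e \<le> d \<Longrightarrow> e / d \<le> (1/2 :: real)"
  by (simp add: field_simps)

text \<open>The Cahen-Mellin integral: the residues at s = k sum to the exponential series of
  exp(-exp l). The condition on Im l makes the type -pi/2 + |Im l| negative.\<close>

lemma barnes_exp:
  fixes l :: complex
  assumes l: "\<bar>Im l\<bar> < pi / 2" and c: "c < 0" "c \<notin> \<int>"
  shows "(\<integral>y. Gamma (- Complex c y) * exp (Complex c y * l) \<partial>lborel) = 2 * pi * exp (- exp l)"
    and "integrable lborel (\<lambda>y. Gamma (- Complex c y) * exp (Complex c y * l))"
proof -
  let ?f = "\<lambda>s. Gamma (0 - s) * exp (s * l)"
  let ?r = "\<lambda>(i::unit) k. - ((-1) ^ k / fact k * exp l ^ k)"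
  have hol: "?f holomorphic_on {s. c - 1 < Re s} - {0 + of_nat k |(i::unit) k. i \<in> {()}}"
  proof (intro holomorphic_intros)
    fix s :: complex assume s: "s \<in> {s. c - 1 < Re s} - {0 + of_nat k |(i::unit) k. i \<in> {()}}"
    show "0 - s \<notin> \<int>\<^sub>\<le>\<^sub>0" using s by (auto elim!: nonpos_Ints_cases')
  qed
  have ty: "strip_type ?f (- pi / 2 + \<bar>Im l\<bar>)" by (intro strip_type_mult strip_type_Gamma_minus strip_type_exp)
  have ra: "?f (s + 1) = (exp l / (0 - s - 1)) * ?f s" for s
    unfolding Gamma_minus_step by (simp add: distrib_right exp_add)
  have qb: "norm (exp l / (0 - s - 1)) \<le> 1/2" if "Re s \<ge> 2 * norm (exp l)" for s
  proof -
    have "2 * norm (exp l) \<le> norm (s + 1)" using that complex_Re_le_cmod[of "s + 1"] by simp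
    moreover have "norm (0 - s - 1) = norm (s + 1)" by (metis minus_diff_eq diff_0 diff_minus_eq_add norm_minus_cancel add.commute diff_conv_add_uminus minus_add_distrib)
    moreover have "norm (exp l) > 0" by simp
    ultimately have "norm (0 - s - 1) > 0" "2 * norm (exp l) \<le> norm (0 - s - 1)" by linarith+
    thus ?thesis unfolding norm_divide by (simp add: divide_le_eq del: norm_exp_eq_Re)
  qed
  have re: "residue ?f (0 + of_nat k) = ?r i k" for i k
    by (subst residue_Gamma_minus_mult) (auto intro!: analytic_intros simp: exp_of_nat_mult)
  have su: "?r i sums (- exp (- exp l))" for i
  proof -
    have "(\<lambda>k. (- exp l) ^ k /\<^sub>R fact k) sums exp (- exp l)" by (rule exp_converges)
    moreover have "(- exp l) ^ k /\<^sub>R fact k = (-1) ^ k / fact k * exp l ^ k" for k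
      by (simp add: power_minus[of "exp l"] scaleR_conv_of_real field_simps)
    ultimately show ?thesis by (simp add: sums_minus)
  qed
  note B = barnes_series[where J = "{()}" and b = "\<lambda>_. 0" and c = c and ?c0.0 = "c - 1" and f = ?f
      and q = "\<lambda>s. exp l / (0 - s - 1)" and X = "2 * norm (exp l)" and r = ?r and S = "\<lambda>_. - exp (- exp l)",
      OF _ _ _ _ hol ty _ ra qb re su]
  have c': "- c \<notin> \<int>" using c(2) by simp
  show "(\<integral>y. Gamma (- Complex c y) * exp (Complex c y * l) \<partial>lborel) = 2 * pi * exp (- exp l)"
    using B(1) c c' l by simp
  show "integrable lborel (\<lambda>y. Gamma (- Complex c y) * exp (Complex c y * l))"
    using B(2) c c' l by simp
qed

text \<open>The poles at k and at nu + k give the two Bessel series. Times exp(-nu l / 2), the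
  bracket is I_(-nu) - I_nu at 2 exp(l / 2), so this is a Mellin-Barnes integral for K.\<close>

lemma barnes_two:
  assumes l: "\<bar>Im l\<bar> < pi" and \<nu>: "Re \<nu> > 0" "\<nu> \<notin> \<int>"
    and c: "c < 0" "c \<notin> \<int>" "Re \<nu> - c \<notin> \<int>"
  shows "(\<integral>y. Gamma (- Complex c y) * Gamma (\<nu> - Complex c y) * exp (Complex c y * l) \<partial>lborel) =
           2 * pi * (of_real pi / sin (of_real pi * \<nu>) * (besB (- \<nu>) (exp l) - exp (\<nu> * l) * besB \<nu> (exp l)))"
proof -
  let ?f = "\<lambda>s. Gamma (0 - s) * (Gamma (\<nu> - s) * exp (s * l))"
  let ?f' = "\<lambda>s. Gamma (\<nu> - s) * (Gamma (0 - s) * exp (s * l))"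
  \<comment> \<open>The index i = 0, 1 selects the family of poles starting at 0 or at nu;
    non-integrality of nu keeps the two disjoint.\<close>
  let ?b = "\<lambda>i::nat. of_nat i * \<nu>"
  let ?K = "of_real pi / sin (of_real pi * \<nu>)"
  let ?r = "\<lambda>i k. if i = 0 then - ?K * (rGamma (- \<nu> + of_nat k + 1) / fact k * exp l ^ k)
                    else ?K * exp (\<nu> * l) * (rGamma (\<nu> + of_nat k + 1) / fact k * exp l ^ k)"
  let ?S = "\<lambda>i::nat. if i = 0 then - ?K * besB (- \<nu>) (exp l) else ?K * exp (\<nu> * l) * besB \<nu> (exp l)"
  let ?q = "\<lambda>s. exp l / ((0 - s - 1) * (\<nu> - s - 1))"
  have sinneg: "sin (of_real pi * - \<nu>) = - sin (of_real pi * \<nu>)" by simp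
  have \<nu>': "- \<nu> \<notin> \<int>" using \<nu>(2) by simp
  have hol: "?f holomorphic_on {s. c - 1 < Re s} - {?b i + of_nat k |i k. i \<in> {0,1::nat}}"
  proof (intro holomorphic_intros)
    fix s :: complex assume s: "s \<in> {s. c - 1 < Re s} - {?b i + of_nat k |i k. i \<in> {0,1::nat}}"
    show "0 - s \<notin> \<int>\<^sub>\<le>\<^sub>0"
    proof
      assume "0 - s \<in> \<int>\<^sub>\<le>\<^sub>0"
      then obtain m where "0 - s = - of_nat m" by (auto elim!: nonpos_Ints_cases')
      hence "s = ?b 0 + of_nat m" by simp
      thus False using s by blast
    qed
    show "\<nu> - s \<notin> \<int>\<^sub>\<le>\<^sub>0"
    proof
      assume "\<nu> - s \<in> \<int>\<^sub>\<le>\<^sub>0"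
      then obtain m where "\<nu> - s = - of_nat m" by (auto elim!: nonpos_Ints_cases')
      hence "s = ?b 1 + of_nat m" by (simp add: algebra_simps)
      thus False using s by blast
    qed
  qed
  have ty: "strip_type ?f (- pi / 2 + (- pi / 2 + \<bar>Im l\<bar>))"
    by (intro strip_type_mult strip_type_Gamma_minus strip_type_exp)
  have ra: "?f (s + 1) = ?q s * ?f s" for s
    unfolding Gamma_minus_step by (simp add: distrib_right exp_add)
  \<comment> \<open>At this abscissa one denominator has modulus at least 1 and the other at least 2
    |exp l|.\<close>
  have qb: "norm (?q s) \<le> 1/2" if "Re s \<ge> norm \<nu> + 2 * norm (exp l)" for s
  proof -
    have "0 \<le> Re s" using that norm_ge_zero[of \<nu>] norm_ge_zero[of "exp l"] by linarith
    moreover have "Re (- (0 - s - 1)) = Re s + 1" "Re (- (\<nu> - s - 1)) = Re s + 1 - Re \<nu>" by simp_all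
    ultimately have "Re (- (0 - s - 1)) \<ge> 1" "Re (- (\<nu> - s - 1)) \<ge> 2 * norm (exp l)"
      using that complex_Re_le_cmod[of \<nu>] by linarith+
    hence 1: "norm (0 - s - 1) \<ge> 1" "norm (\<nu> - s - 1) \<ge> 2 * norm (exp l)"
      using complex_Re_le_cmod[of "- (0 - s - 1)"] complex_Re_le_cmod[of "- (\<nu> - s - 1)"]
      unfolding norm_minus_cancel by linarith+
    have "1 * (2 * norm (exp l)) \<le> norm (0 - s - 1) * norm (\<nu> - s - 1)"
      by (intro mult_mono 1) auto
    moreover have "norm (exp l) > 0" by simp
    ultimately have "norm (0 - s - 1) * norm (\<nu> - s - 1) > 0" "2 * norm (exp l) \<le> norm (0 - s - 1) * norm (\<nu> - s - 1)"
      by linarith+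
    thus ?thesis unfolding norm_divide norm_mult by (simp add: divide_le_eq del: norm_exp_eq_Re)
  qed
  have re: "residue ?f (?b i + of_nat k) = ?r i k" if "i \<in> {0,1}" for i k
  proof (cases "i = 0")
    case True
    have n: "\<nu> - of_nat k \<notin> \<int>\<^sub>\<le>\<^sub>0"
    proof
      assume "\<nu> - of_nat k \<in> \<int>\<^sub>\<le>\<^sub>0"
      then obtain m where "\<nu> - of_nat k = of_int m" by (auto elim!: nonpos_Ints_cases)
      hence "\<nu> = of_int (m + int k)" by (simp add: algebra_simps)
      thus False using \<nu>(2) by (metis Ints_of_int)
    qed
    have "residue ?f (0 + of_nat k) = - ((-1) ^ k / fact k * (Gamma (\<nu> - (0 + of_nat k)) * exp ((0 + of_nat k) * l)))"
      by (rule residue_Gamma_minus_mult) (use n in \<open>auto intro!: analytic_intros Gamma_minus_analytic\<close>)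
    also have "Gamma (\<nu> - (0 + of_nat k)) * exp ((0 + of_nat k) * l) = (-1) ^ k * (?K * rGamma (of_nat k + 1 - \<nu>) * exp l ^ k)"
      unfolding add_0_left Gamma_minus_nat[OF \<nu>(2)] exp_of_nat_mult by (simp add: mult_ac)
    finally show ?thesis using True unfolding sign_cancel by (simp add: algebra_simps)
  next
    case False
    hence i: "?b i = \<nu>" using that by auto
    have n: "0 - (\<nu> + of_nat k) \<notin> \<int>\<^sub>\<le>\<^sub>0"
    proof
      assume "0 - (\<nu> + of_nat k) \<in> \<int>\<^sub>\<le>\<^sub>0"
      then obtain m where m: "0 - (\<nu> + of_nat k) = of_int m" by (auto elim!: nonpos_Ints_cases)
      have "\<nu> = - (0 - (\<nu> + of_nat k)) - of_nat k" by simp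
      hence "\<nu> = of_int (- m - int k)" unfolding m by simp
      thus False using \<nu>(2) by (metis Ints_of_int)
    qed
    have "?f = ?f'" by (simp add: mult_ac)
    moreover have "residue ?f' (\<nu> + of_nat k) = - ((-1) ^ k / fact k * (Gamma (0 - (\<nu> + of_nat k)) * exp ((\<nu> + of_nat k) * l)))"
      by (rule residue_Gamma_minus_mult) (use n in \<open>auto intro!: analytic_intros Gamma_minus_analytic\<close>)
    moreover have "Gamma (0 - (\<nu> + of_nat k)) * exp ((\<nu> + of_nat k) * l) = (-1) ^ k * (- ?K * rGamma (of_nat k + 1 + \<nu>) * (exp (\<nu> * l) * exp l ^ k))"
    proof -
      have "Gamma (0 - (\<nu> + of_nat k)) = (-1) ^ k * (of_real pi / sin (of_real pi * - \<nu>) * rGamma (of_nat k + 1 - - \<nu>))"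
        using Gamma_minus_nat[OF \<nu>', of k] by (simp add: algebra_simps)
      thus ?thesis unfolding sinneg exp_int_pole by simp
    qed
    ultimately show ?thesis using False unfolding i sign_cancel by (simp add: algebra_simps)
  qed
  have su: "?r i sums ?S i" for i
    by (cases "i = 0") (simp_all only: simp_thms if_True if_False sums_mult besB_sums)
  have inj: "i = j" if "i \<in> {0,1::nat}" "j \<in> {0,1}" "?b i + of_nat k = ?b j + of_nat m" for i j k m
  proof (rule ccontr)
    assume "i \<noteq> j"
    hence "i = 0 \<and> j = 1 \<or> i = 1 \<and> j = 0" using that(1,2) by auto
    hence "\<nu> = of_int (int k - int m) \<or> \<nu> = of_int (int m - int k)"
      using that(3) by (auto simp: algebra_simps)
    thus False using \<nu>(2) by (metis Ints_of_int)
  qed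
  have bc: "Re (?b i) > c \<and> Re (?b i) - c \<notin> \<int>" if "i \<in> {0,1}" for i
    using that c \<nu>(1) Ints_minus[of "- c"] by auto
  have "(\<integral>y. ?f (Complex c y) \<partial>lborel) = - 2 * pi * (\<Sum>i\<in>{0,1}. ?S i)"
    by (rule barnes_series(1)[where J = "{0,1::nat}" and b = ?b and c = c and ?c0.0 = "c - 1" and f = ?f and q = ?q
            and X = "norm \<nu> + 2 * norm (exp l)" and r = ?r and S = ?S,
          OF _ bc inj _ hol ty _ ra qb re su]) (use l in auto)
  also have "\<dots> = 2 * pi * (?K * (besB (- \<nu>) (exp l) - exp (\<nu> * l) * besB \<nu> (exp l)))"
    by (simp add: algebra_simps)
  finally show ?thesis by (simp add: mult.assoc)
qed

text \<open>The poles at k produce I_nu I_(-nu) and those at nu + k produce I_nu^2, so the result is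
  a multiple of I_nu K_nu. The line has to stay to the right of -1/2, the first pole of Gamma(1/2 +
  s).\<close>

lemma barnes_IK:
  fixes \<nu> :: real
  assumes l: "\<bar>Im l\<bar> < pi" and \<nu>: "\<nu> > 0" "2 * \<nu> \<notin> \<int>"
    and c: "- 1/2 < c" "c < 0" "\<nu> - c \<notin> \<int>"
  shows "(\<integral>y. Gamma (- Complex c y) * Gamma (of_real \<nu> - Complex c y) * Gamma (1/2 + Complex c y) *
             rGamma (1 + of_real \<nu> + Complex c y) * exp (Complex c y * l) \<partial>lborel) =
           2 * pi * (of_real pi / sin (of_real pi * of_real \<nu>) * of_real (sqrt pi) *
             (besB (- of_real \<nu>) (exp l / 4) * besB (of_real \<nu>) (exp l / 4) -
              exp (of_real \<nu> * l) * exp (- (2 * of_real \<nu> * of_real (ln 2))) * (besB (of_real \<nu>) (exp l / 4))\<^sup>2))"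
proof -
  define n where "n = complex_of_real \<nu>"
  have n2: "2 * n \<notin> \<int>" using \<nu>(2) unfolding n_def
    using of_real_in_Ints_iff[of "2 * \<nu>", where ?'a = complex] by simp
  have n1: "n \<notin> \<int>" using n2 Ints_mult[of 2 n] by auto
  have n1': "- n \<notin> \<int>" using n1 by simp
  let ?g = "\<lambda>s. Gamma (1/2 + s) * (rGamma (1 + n + s) * exp (s * l))"
  let ?f = "\<lambda>s. Gamma (0 - s) * (Gamma (n - s) * ?g s)"
  let ?f' = "\<lambda>s. Gamma (n - s) * (Gamma (0 - s) * ?g s)"
  let ?b = "\<lambda>i::nat. of_nat i * n"
  let ?K = "of_real pi / sin (of_real pi * n)"
  let ?A = "\<lambda>k. Gamma (of_nat k + 1/2) / fact k * rGamma (of_nat k + 1 - n) * rGamma (of_nat k + 1 + n) * exp l ^ k"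
  let ?B = "\<lambda>k. Gamma (of_nat k + 1/2 + n) / fact k * rGamma (of_nat k + 1 + n) * rGamma (of_nat k + 1 + 2 * n) * exp l ^ k"
  let ?SA = "of_real (sqrt pi) * (besB (- n) (exp l / 4) * besB n (exp l / 4))"
  let ?SB = "of_real (sqrt pi) * exp (- (2 * n * of_real (ln 2))) * (besB n (exp l / 4))\<^sup>2"
  let ?r = "\<lambda>i k. if i = 0 then - ?K * ?A k else ?K * exp (n * l) * ?B k"
  let ?S = "\<lambda>i::nat. if i = 0 then - ?K * ?SA else ?K * exp (n * l) * ?SB"
  let ?q = "\<lambda>s. exp l * ((1/2 + s) / (0 - s - 1)) / ((n - s - 1) * (1 + n + s))"
  have sinneg: "sin (of_real pi * - n) = - sin (of_real pi * n)" by simp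
  have half: "1/2 + s \<notin> \<int>\<^sub>\<le>\<^sub>0" if "- 1/2 < Re s" for s :: complex
    using that by (auto elim!: nonpos_Ints_cases simp: complex_eq_iff)
  have holG: "(\<lambda>s. Gamma (1/2 + s)) analytic_on {p}" if "- 1/2 < Re p" for p :: complex
  proof -
    have "Gamma \<circ> (\<lambda>s::complex. 1/2 + s) analytic_on {p}"
      by (intro analytic_on_compose analytic_Gamma analytic_intros) (use half[OF that] in auto)
    thus ?thesis by (simp add: o_def)
  qed
  have hol: "?f holomorphic_on {s. - 1/2 < Re s} - {?b i + of_nat k |i k. i \<in> {0,1::nat}}"
  proof (intro holomorphic_intros)
    fix s :: complex assume s: "s \<in> {s. - 1/2 < Re s} - {?b i + of_nat k |i k. i \<in> {0,1::nat}}"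
    show "0 - s \<notin> \<int>\<^sub>\<le>\<^sub>0"
    proof
      assume "0 - s \<in> \<int>\<^sub>\<le>\<^sub>0"
      then obtain m where "0 - s = - of_nat m" by (auto elim!: nonpos_Ints_cases')
      hence "s = ?b 0 + of_nat m" by simp
      thus False using s by blast
    qed
    show "n - s \<notin> \<int>\<^sub>\<le>\<^sub>0"
    proof
      assume "n - s \<in> \<int>\<^sub>\<le>\<^sub>0"
      then obtain m where "n - s = - of_nat m" by (auto elim!: nonpos_Ints_cases')
      hence "s = ?b 1 + of_nat m" by (simp add: algebra_simps)
      thus False using s by blast
    qed
    show "1/2 + s \<notin> \<int>\<^sub>\<le>\<^sub>0" using half s by auto
  qed
  have ty: "strip_type ?f (- pi / 2 + (- pi / 2 + (- pi / 2 + (pi / 2 + \<bar>Im l\<bar>))))"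
    by (intro strip_type_mult strip_type_Gamma_minus strip_type_Gamma_plus strip_type_rGamma_plus strip_type_exp)
  have ra: "?f (s + 1) = ?q s * ?f s" if "c \<le> Re s" for s
  proof -
    have s: "- 1/2 < Re s" using that c by simp
    have 1: "Gamma (1/2 + (s + 1)) = (1/2 + s) * Gamma (1/2 + s)"
      using Gamma_plus1[OF half[OF s]] by (simp add: add_ac)
    have "1 + n + s \<noteq> 0" using s \<nu>(1) by (auto simp: n_def complex_eq_iff)
    hence 2: "rGamma (1 + n + (s + 1)) = rGamma (1 + n + s) / (1 + n + s)"
      using rGamma_plus1[of "1 + n + s"] by (simp add: field_simps)
    have 3: "exp ((s + 1) * l) = exp (s * l) * exp l" by (simp add: distrib_right exp_add)
    have "(A / a) * ((B / b) * ((h * C) * ((R / d) * (E * L)))) = (L * (h / a) / (b * d)) * (A * (B * (C * (R * E))))"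
      for A a B b h C R d E L :: complex by (simp add: divide_inverse mult_ac)
    thus ?thesis unfolding Gamma_minus_step 1 2 3 .
  qed
  have qb: "norm (?q s) \<le> 1/2" if "Re s \<ge> \<nu> + 2 * norm (exp l)" for s
  proof -
    have s0: "Re s \<ge> 0" using that \<nu>(1) norm_ge_zero[of "exp l"] by linarith
    have "Re (- (n - s - 1)) \<ge> 2 * norm (exp l)"
      using that \<nu>(1) by (simp add: n_def del: norm_exp_eq_Re)
    moreover have "Re (1 + n + s) \<ge> 1"
      using s0 \<nu>(1) by (simp add: n_def)
    ultimately have 1: "norm (n - s - 1) \<ge> 2 * norm (exp l)" "norm (1 + n + s) \<ge> 1"
      using complex_Re_le_cmod[of "1 + n + s"] complex_Re_le_cmod[of "- (n - s - 1)"]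
      unfolding norm_minus_cancel by linarith+
    \<comment> \<open>The quotient of the linear factors has modulus at most 1 since Re s >= 0, so
      the other two denominators alone provide the factor 1/2.\<close>
    have "norm (1/2 + s) \<le> norm (s + 1)"
    proof -
      have "(Re (1/2 + s))\<^sup>2 \<le> (Re (s + 1))\<^sup>2" using s0 by (intro power_mono) auto
      thus ?thesis unfolding cmod_def by (intro real_sqrt_le_mono) simp
    qed
    also have "norm (s + 1) = norm (- (s + 1))" by (rule norm_minus_cancel[symmetric])
    also have "- (s + 1) = 0 - s - 1" by simp
    finally have 2: "norm ((1/2 + s) / (0 - s - 1)) \<le> 1"
      unfolding norm_divide by (simp add: divide_le_eq_1)
    have "(2 * norm (exp l)) * 1 \<le> norm (n - s - 1) * norm (1 + n + s)"
      by (intro mult_mono 1) auto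
    moreover have e: "norm (exp l) > 0" by simp
    ultimately have "norm (exp l) / (norm (n - s - 1) * norm (1 + n + s)) \<le> 1/2"
      by (intro half_quotient_le) (simp_all only: mult_1_right)
    moreover have "norm (?q s) = norm ((1/2 + s) / (0 - s - 1)) * (norm (exp l) / (norm (n - s - 1) * norm (1 + n + s)))"
      by (simp only: norm_mult norm_divide) simp
    ultimately show ?thesis
      using mult_mono[OF 2, of "norm (exp l) / (norm (n - s - 1) * norm (1 + n + s))" "1/2"] by simp
  qed
  have re: "residue ?f (?b i + of_nat k) = ?r i k" if "i \<in> {0,1}" for i k
  proof (cases "i = 0")
    case True
    have nn: "n - of_nat k \<notin> \<int>\<^sub>\<le>\<^sub>0"
    proof
      assume "n - of_nat k \<in> \<int>\<^sub>\<le>\<^sub>0"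
      then obtain m where "n - of_nat k = of_int m" by (auto elim!: nonpos_Ints_cases)
      hence "n = of_int (m + int k)" by (simp add: algebra_simps)
      thus False using n1 by (metis Ints_of_int)
    qed
    have "residue ?f (0 + of_nat k) = - ((-1) ^ k / fact k * (Gamma (n - (0 + of_nat k)) * ?g (0 + of_nat k)))"
      by (rule residue_Gamma_minus_mult)
         (use nn in \<open>auto intro!: analytic_intros Gamma_minus_analytic rGamma_analytic_compose holG\<close>)
    also have "Gamma (n - (0 + of_nat k)) * ?g (0 + of_nat k) =
       (-1) ^ k * (?K * (Gamma (of_nat k + 1/2) * rGamma (of_nat k + 1 - n) * rGamma (of_nat k + 1 + n) * exp l ^ k))"
      unfolding add_0_left Gamma_minus_nat[OF n1] exp_of_nat_mult by (simp add: mult_ac add_ac)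
    finally show ?thesis using True unfolding sign_cancel by simp
  next
    case False
    hence i: "?b i = n" using that by auto
    have nn: "0 - (n + of_nat k) \<notin> \<int>\<^sub>\<le>\<^sub>0"
    proof
      assume "0 - (n + of_nat k) \<in> \<int>\<^sub>\<le>\<^sub>0"
      then obtain m where m: "0 - (n + of_nat k) = of_int m" by (auto elim!: nonpos_Ints_cases)
      have "n = - (0 - (n + of_nat k)) - of_nat k" by simp
      hence "n = of_int (- m - int k)" unfolding m by simp
      thus False using n1 by (metis Ints_of_int)
    qed
    have "?f = ?f'" by (simp add: mult_ac)
    moreover have "residue ?f' (n + of_nat k) = - ((-1) ^ k / fact k * (Gamma (0 - (n + of_nat k)) * ?g (n + of_nat k)))"
      by (rule residue_Gamma_minus_mult)
         (use nn \<nu>(1) in \<open>auto intro!: analytic_intros Gamma_minus_analytic rGamma_analytic_compose holG simp: n_def\<close>)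
    moreover have "Gamma (0 - (n + of_nat k)) * ?g (n + of_nat k) =
       (-1) ^ k * (- ?K * exp (n * l) * (Gamma (of_nat k + 1/2 + n) * rGamma (of_nat k + 1 + n) * rGamma (of_nat k + 1 + 2 * n) * exp l ^ k))"
    proof -
      have 1: "Gamma (0 - (n + of_nat k)) = (-1) ^ k * (of_real pi / sin (of_real pi * - n) * rGamma (of_nat k + 1 + n))"
        using Gamma_minus_nat[OF n1', of k] by (simp add: algebra_simps)
      have 2: "1/2 + (n + of_nat k) = of_nat k + 1/2 + n" "1 + n + (n + of_nat k) = of_nat k + 1 + 2 * n" by simp_all
      show ?thesis unfolding 1 2 sinneg exp_int_pole by simp
    qed
    ultimately show ?thesis using False unfolding i sign_cancel by simp
  qed
  have su: "?r i sums ?S i" for i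
    by (cases "i = 0") (simp_all only: simp_thms if_True if_False sums_mult besB_mult_minus_sums besB_square_sums[OF n2])
  have inj: "i = j" if "i \<in> {0,1::nat}" "j \<in> {0,1}" "?b i + of_nat k = ?b j + of_nat m" for i j k m
  proof (rule ccontr)
    assume "i \<noteq> j"
    hence "i = 0 \<and> j = 1 \<or> i = 1 \<and> j = 0" using that(1,2) by auto
    hence "n = of_int (int k - int m) \<or> n = of_int (int m - int k)"
      using that(3) by (auto simp: algebra_simps)
    thus False using n1 by (metis Ints_of_int)
  qed
  have c0: "c \<notin> \<int>" using c by (auto elim!: Ints_cases)
  have bc: "Re (?b i) > c \<and> Re (?b i) - c \<notin> \<int>" if "i \<in> {0,1}" for i
    using that c c0 \<nu>(1) Ints_minus[of "- c"] by (auto simp: n_def)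
  have "(\<integral>y. ?f (Complex c y) \<partial>lborel) = - 2 * pi * (\<Sum>i\<in>{0,1}. ?S i)"
    by (rule barnes_series(1)[where J = "{0,1::nat}" and b = ?b and c = c and ?c0.0 = "- 1/2" and f = ?f and q = ?q
            and X = "\<nu> + 2 * norm (exp l)" and r = ?r and S = ?S,
          OF _ bc inj c(1) hol ty _ ra qb re su]) (use l in auto)
  also have "\<dots> = 2 * pi * (?K * of_real (sqrt pi) *
             (besB (- n) (exp l / 4) * besB n (exp l / 4) -
              exp (n * l) * exp (- (2 * n * of_real (ln 2))) * (besB n (exp l / 4))\<^sup>2))"
    by (simp add: algebra_simps)
  finally show ?thesis by (simp add: mult.assoc n_def)
qed

text \<open>Three families of poles, at k, nu + k and -nu + k, yield -2 I_nu I_(-nu), I_nu^2 and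
  I_(-nu)^2, that is (I_(-nu) - I_nu)^2 up to a factor. In the last two families the sin(2 pi nu)
  from reflection brings a cosine into the denominator, which cancels the cosine of
  \<open>rGamma_half_minus\<close>.\<close>

lemma barnes_KK:
  fixes \<nu> :: real
  assumes l: "\<bar>Im l\<bar> < pi" and \<nu>: "\<nu> > 0" "2 * \<nu> \<notin> \<int>"
    and c: "c < - \<nu>" "c \<notin> \<int>" "\<nu> - c \<notin> \<int>" "- \<nu> - c \<notin> \<int>"
  shows "(\<integral>y. Gamma (- Complex c y) * Gamma (of_real \<nu> - Complex c y) * Gamma (- of_real \<nu> - Complex c y) *
             rGamma (1/2 - Complex c y) * exp (Complex c y * l) \<partial>lborel) =
           2 * pi * (of_real pi / (2 * (sin (of_real pi * of_real \<nu>))\<^sup>2) * of_real (sqrt pi) *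
             (exp (of_real \<nu> * l) * exp (- (2 * of_real \<nu> * of_real (ln 2))) * (besB (of_real \<nu>) (exp l / 4))\<^sup>2 +
              exp (- of_real \<nu> * l) * exp (2 * of_real \<nu> * of_real (ln 2)) * (besB (- of_real \<nu>) (exp l / 4))\<^sup>2
              - 2 * (besB (- of_real \<nu>) (exp l / 4) * besB (of_real \<nu>) (exp l / 4))))"
proof -
  define n where "n = complex_of_real \<nu>"
  have n2: "2 * n \<notin> \<int>" using \<nu>(2) unfolding n_def
    using of_real_in_Ints_iff[of "2 * \<nu>", where ?'a = complex] by simp
  have n2': "2 * - n \<notin> \<int>" using n2 by simp
  have n1: "n \<notin> \<int>" using n2 Ints_mult[of 2 n] by auto
  let ?s = "sin (of_real pi * n)" and ?c = "cos (of_real pi * n)"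
  have s0: "?s \<noteq> 0" using n1 by (simp add: sin_pi_eq_0_iff)
  \<comment> \<open>Follows from 2 nu not being an integer, as sin(2 pi nu) = 2 sin(pi nu) cos(pi
    nu).\<close>
  have c0: "?c \<noteq> 0"
  proof
    assume "?c = 0"
    hence "sin (of_real pi * (2 * n)) = 0" using sin_double[of "of_real pi * n"] by (simp add: mult_ac)
    thus False using n2 by (simp add: sin_pi_eq_0_iff)
  qed
  let ?g = "\<lambda>s. rGamma (1/2 - s) * exp (s * l)"
  let ?f = "\<lambda>s. Gamma (0 - s) * (Gamma (n - s) * (Gamma (- n - s) * ?g s))"
  let ?b = "\<lambda>i::int. of_int i * n"
  let ?K = "of_real pi / (2 * ?s\<^sup>2)"
  let ?A = "\<lambda>k. Gamma (of_nat k + 1/2) / fact k * rGamma (of_nat k + 1 - n) * rGamma (of_nat k + 1 + n) * exp l ^ k"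
  let ?B = "\<lambda>n k. Gamma (of_nat k + 1/2 + n) / fact k * rGamma (of_nat k + 1 + n) * rGamma (of_nat k + 1 + 2 * n) * exp l ^ k"
  let ?SA = "of_real (sqrt pi) * (besB (- n) (exp l / 4) * besB n (exp l / 4))"
  let ?SB = "\<lambda>n. of_real (sqrt pi) * exp (- (2 * n * of_real (ln 2))) * (besB n (exp l / 4))\<^sup>2"
  let ?r = "\<lambda>i k. if i = 0 then 2 * ?K * ?A k else - ?K * exp (?b i * l) * ?B (?b i) k"
  let ?S = "\<lambda>i::int. if i = 0 then 2 * ?K * ?SA else - ?K * exp (?b i * l) * ?SB (?b i)"
  let ?q = "\<lambda>s. exp l * ((- 1/2 - s) / (0 - s - 1)) / ((n - s - 1) * (- n - s - 1))"
  let ?J = "{0, 1, - 1 :: int}"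
  have sinneg: "sin (of_real pi * - n) = - ?s" by simp
  have notP: "?b i - s \<notin> \<int>\<^sub>\<le>\<^sub>0" if "s \<notin> {?b i + of_nat k |i k. i \<in> ?J}" "i \<in> ?J" for s i
  proof
    assume "?b i - s \<in> \<int>\<^sub>\<le>\<^sub>0"
    then obtain m where "?b i - s = - of_nat m" by (auto elim!: nonpos_Ints_cases')
    hence "s = ?b i + of_nat m" by (simp add: algebra_simps)
    thus False using that by blast
  qed
  have inj: "i = j" if "i \<in> ?J" "j \<in> ?J" "?b i + of_nat k = ?b j + of_nat m" for i j k m
  proof (rule ccontr)
    assume ij: "i \<noteq> j"
    have e: "of_int (i - j) * n = of_int (int m - int k)"
      using that(3) by (simp add: algebra_simps)
    define d where "d = i - j"
    have "d = 1 \<or> d = - 1 \<or> d = 2 \<or> d = - 2" using that(1,2) ij by (auto simp: d_def)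
    define X where "X = complex_of_int (int m - int k)"
    have X: "X \<in> \<int>" "- X \<in> \<int>" by (simp_all add: X_def)
    have e': "of_int d * n = X" using e by (simp only: d_def X_def)
    from \<open>d = 1 \<or> d = - 1 \<or> d = 2 \<or> d = - 2\<close> have "n \<in> \<int> \<or> 2 * n \<in> \<int>"
    proof (elim disjE)
      assume "d = - 1"
      hence "- n = X" using e' by simp
      thus ?thesis using X by (metis minus_minus)
    next
      assume "d = - 2"
      hence "- (2 * n) = X" using e' by simp
      thus ?thesis using X by (metis minus_minus)
    qed (use X e' in simp_all)
    thus False using n1 n2 by blast
  qed
  have nonpos: "?b i - (?b j + of_nat k) \<notin> \<int>\<^sub>\<le>\<^sub>0" if "i \<in> ?J" "j \<in> ?J" "i \<noteq> j" for i j k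
  proof
    assume "?b i - (?b j + of_nat k) \<in> \<int>\<^sub>\<le>\<^sub>0"
    then obtain m where "?b i - (?b j + of_nat k) = - of_nat m" by (auto elim!: nonpos_Ints_cases')
    hence "?b i + of_nat m = ?b j + of_nat k" by (simp add: algebra_simps)
    from inj[OF that(1,2) this] show False using that(3) by simp
  qed
  have hol: "?f holomorphic_on {s. c - 1 < Re s} - {?b i + of_nat k |i k. i \<in> ?J}"
  proof (intro holomorphic_intros)
    fix s :: complex assume "s \<in> {s. c - 1 < Re s} - {?b i + of_nat k |i k. i \<in> ?J}"
    hence s: "s \<notin> {?b i + of_nat k |i k. i \<in> ?J}" by blast
    show "0 - s \<notin> \<int>\<^sub>\<le>\<^sub>0" "n - s \<notin> \<int>\<^sub>\<le>\<^sub>0" "- n - s \<notin> \<int>\<^sub>\<le>\<^sub>0"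
      using notP[OF s, of 0] notP[OF s, of 1] notP[OF s, of "-1"] by simp_all
  qed
  have ty: "strip_type ?f (- pi / 2 + (- pi / 2 + (- pi / 2 + (pi / 2 + \<bar>Im l\<bar>))))"
    by (intro strip_type_mult strip_type_Gamma_minus strip_type_rGamma_minus strip_type_exp)
  have ra: "?f (s + 1) = ?q s * ?f s" for s
  proof -
    have 1: "rGamma (1/2 - (s + 1)) = (- 1/2 - s) * rGamma (1/2 - s)"
    proof -
      have e: "1/2 - (s + 1) = - 1/2 - s" "1/2 - s = - 1/2 - s + 1" by simp_all
      show ?thesis unfolding e by (rule rGamma_plus1[symmetric])
    qed
    have 3: "exp ((s + 1) * l) = exp (s * l) * exp l" by (simp add: distrib_right exp_add)
    have "(A / a) * ((B / b) * ((C / d) * ((h * R) * (E * L)))) = (L * (h / a) / (b * d)) * (A * (B * (C * (R * E))))"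
      for A a B b h C R d E L :: complex by (simp add: divide_inverse mult_ac)
    thus ?thesis unfolding Gamma_minus_step 1 3 .
  qed
  have qb: "norm (?q s) \<le> 1/2" if "Re s \<ge> \<nu> + 2 * norm (exp l)" for s
  proof -
    have s0: "Re s \<ge> 0" using that \<nu>(1) norm_ge_zero[of "exp l"] by linarith
    have "Re (- (n - s - 1)) \<ge> 2 * norm (exp l)"
      using that \<nu>(1) by (simp add: n_def del: norm_exp_eq_Re)
    moreover have "Re (- (- n - s - 1)) \<ge> 1"
      using s0 \<nu>(1) by (simp add: n_def)
    ultimately have 1: "norm (n - s - 1) \<ge> 2 * norm (exp l)" "norm (- n - s - 1) \<ge> 1"
      using complex_Re_le_cmod[of "- (- n - s - 1)"] complex_Re_le_cmod[of "- (n - s - 1)"]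
      unfolding norm_minus_cancel by linarith+
    have "norm (- 1/2 - s) \<le> norm (0 - s - 1)"
    proof -
      have "\<bar>Re (- 1/2 - s)\<bar> \<le> \<bar>Re (0 - s - 1)\<bar>" using s0 by simp
      hence "(Re (- 1/2 - s))\<^sup>2 \<le> (Re (0 - s - 1))\<^sup>2" by (simp only: abs_le_square_iff)
      thus ?thesis unfolding cmod_def by (intro real_sqrt_le_mono) simp
    qed
    hence 2: "norm ((- 1/2 - s) / (0 - s - 1)) \<le> 1"
      unfolding norm_divide by (simp add: divide_le_eq_1)
    have "(2 * norm (exp l)) * 1 \<le> norm (n - s - 1) * norm (- n - s - 1)"
      by (intro mult_mono 1) auto
    moreover have e: "norm (exp l) > 0" by simp
    ultimately have "norm (exp l) / (norm (n - s - 1) * norm (- n - s - 1)) \<le> 1/2"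
      by (intro half_quotient_le) (simp_all only: mult_1_right)
    moreover have "norm (?q s) = norm ((- 1/2 - s) / (0 - s - 1)) * (norm (exp l) / (norm (n - s - 1) * norm (- n - s - 1)))"
      by (simp only: norm_mult norm_divide) simp
    ultimately show ?thesis
      using mult_mono[OF 2, of "norm (exp l) / (norm (n - s - 1) * norm (- n - s - 1))" "1/2"] by simp
  qed
  have res0: "residue ?f (of_nat k) = 2 * ?K * ?A k" for k
  proof -
    have nn: "n - of_nat k \<notin> \<int>\<^sub>\<le>\<^sub>0" "- n - of_nat k \<notin> \<int>\<^sub>\<le>\<^sub>0"
      using nonpos[of 1 0 k] nonpos[of "-1" 0 k] by simp_all
    have "residue ?f (0 + of_nat k) = - ((-1) ^ k / fact k * (Gamma (n - (0 + of_nat k)) * (Gamma (- n - (0 + of_nat k)) * ?g (0 + of_nat k))))"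
      by (rule residue_Gamma_minus_mult)
         (use nn in \<open>auto intro!: analytic_intros Gamma_minus_analytic rGamma_analytic_compose\<close>)
    also have "Gamma (n - (0 + of_nat k)) * (Gamma (- n - (0 + of_nat k)) * ?g (0 + of_nat k)) =
       (-1) ^ k * (- 2 * ?K * (Gamma (of_nat k + 1/2) * rGamma (of_nat k + 1 - n) * rGamma (of_nat k + 1 + n) * exp l ^ k))"
    proof -
      have "of_nat k + 1/2 + (0::complex) \<notin> \<int>\<^sub>\<le>\<^sub>0" by (auto elim!: nonpos_Ints_cases simp: complex_eq_iff)
      from rGamma_half_minus[OF this] have 1: "rGamma (1/2 - of_nat k) = (-1) ^ k / of_real pi * Gamma (of_nat k + 1/2 :: complex)" by simp
      have 2: "Gamma (- n - of_nat k) = (-1) ^ k * (of_real pi / - ?s * rGamma (of_nat k + 1 + n))"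
        using Gamma_minus_nat[of "- n" k] n1 sinneg Ints_minus[of "- n"] by auto
      have "(e * (p / s * R1)) * ((e * (p / - s * R2)) * (e / p * G * X)) = e * (- 2 * (p / (2 * s\<^sup>2)) * (G * R1 * R2 * X))"
        if "e * e = 1" "p \<noteq> 0" "s \<noteq> 0" for e p s R1 R2 G X :: complex
      proof -
        have "(e * (p / s * R1)) * ((e * (p / - s * R2)) * (e / p * G * X)) = (e * e) * (e * (- 2 * (p / (2 * s\<^sup>2)) * (G * R1 * R2 * X)))"
          using that(2,3) by (simp add: field_simps power2_eq_square)
        thus ?thesis using that(1) by simp
      qed
      from this[OF _ _ s0] show ?thesis
        unfolding add_0_left Gamma_minus_nat[OF n1] 1 2 exp_of_nat_mult by (simp flip: power_mult_distrib)
    qed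
    finally show ?thesis unfolding sign_cancel by simp
  qed
  \<comment> \<open>The integrand is symmetric under nu -> -nu, so one computation with m = nu or m
    = -nu covers both families.\<close>
  have res1: "residue ?f (m + of_nat k) = - ?K * exp (m * l) * ?B m k" if m: "m = n \<or> m = - n" for m k
  proof -
    let ?f' = "\<lambda>s. Gamma (m - s) * (Gamma (0 - s) * (Gamma (- m - s) * ?g s))"
    have m0: "m \<notin> \<int>" and m2: "2 * m \<notin> \<int>" using m n1 n2 by auto
    have m1: "- m \<notin> \<int>" "- (2 * m) \<notin> \<int>" using m0 m2 minus_in_Ints_iff by blast+
    have ff: "?f = ?f'" using m by (auto simp: mult_ac)
    have nn: "0 - (m + of_nat k) \<notin> \<int>\<^sub>\<le>\<^sub>0" "- m - (m + of_nat k) \<notin> \<int>\<^sub>\<le>\<^sub>0"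
      using m nonpos[of 0 1 k] nonpos[of 0 "-1" k] nonpos[of 1 "-1" k] nonpos[of "-1" 1 k] by auto
    have sm: "sin (of_real pi * - m) = - sin (of_real pi * m)"
         "sin (of_real pi * - (2 * m)) = - (2 * sin (of_real pi * m) * cos (of_real pi * m))"
      using sin_double[of "of_real pi * m"] by (simp_all add: mult_ac)
    have smc: "(sin (of_real pi * m))\<^sup>2 = ?s\<^sup>2" "sin (of_real pi * m) \<noteq> 0" "cos (of_real pi * m) \<noteq> 0"
      using m s0 c0 by auto
    have "residue ?f' (m + of_nat k) = - ((-1) ^ k / fact k * (Gamma (0 - (m + of_nat k)) * (Gamma (- m - (m + of_nat k)) * ?g (m + of_nat k))))"
      by (rule residue_Gamma_minus_mult)
         (use nn in \<open>auto intro!: analytic_intros Gamma_minus_analytic rGamma_analytic_compose\<close>)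
    also have "Gamma (0 - (m + of_nat k)) * (Gamma (- m - (m + of_nat k)) * ?g (m + of_nat k)) =
       (-1) ^ k * (?K * exp (m * l) * (Gamma (of_nat k + 1/2 + m) * rGamma (of_nat k + 1 + m) * rGamma (of_nat k + 1 + 2 * m) * exp l ^ k))"
    proof -
      have "of_nat k + 1/2 + m \<notin> \<int>\<^sub>\<le>\<^sub>0"
      proof
        assume "of_nat k + 1/2 + m \<in> \<int>\<^sub>\<le>\<^sub>0"
        then obtain j where j: "of_nat k + 1/2 + m = of_int j" by (auto elim!: nonpos_Ints_cases)
        have "2 * m = 2 * (of_nat k + 1/2 + m) - 2 * of_nat k - 1" by (simp add: algebra_simps)
        hence "2 * m = of_int (2 * j - 2 * int k - 1)" unfolding j by simp
        thus False using m2 by (metis Ints_of_int)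
      qed
      from rGamma_half_minus[OF this] have 1: "rGamma (1/2 - (m + of_nat k)) = (-1) ^ k * cos (of_real pi * m) / of_real pi * Gamma (of_nat k + 1/2 + m)"
        by (simp add: diff_diff_add)
      have 2: "Gamma (0 - (m + of_nat k)) = (-1) ^ k * (of_real pi / - sin (of_real pi * m) * rGamma (of_nat k + 1 + m))"
        using Gamma_minus_nat[OF m1(1), of k] unfolding sm by (simp add: algebra_simps)
      have 3: "Gamma (- m - (m + of_nat k)) = (-1) ^ k * (of_real pi / - (2 * sin (of_real pi * m) * cos (of_real pi * m)) * rGamma (of_nat k + 1 + 2 * m))"
      proof -
        have e: "- m - (m + of_nat k) = - (2 * m) - of_nat k" by simp
        show ?thesis using Gamma_minus_nat[OF m1(2), of k] unfolding sm e by (simp only: diff_minus_eq_add)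
      qed
      have rearr: "(e * (p / - s * R1)) * ((e * (p / - (2 * s * c) * R2)) * (e * c / p * G * (X * Y))) = e * (p / (2 * s\<^sup>2) * X * (G * R1 * R2 * Y))"
        if "e * e = 1" "p \<noteq> 0" "s \<noteq> 0" "c \<noteq> 0" for e p s c R1 R2 G X Y :: complex
      proof -
        have "(e * (p / - s * R1)) * ((e * (p / - (2 * s * c) * R2)) * (e * c / p * G * (X * Y))) = (e * e) * (e * (p / (2 * s\<^sup>2) * X * (G * R1 * R2 * Y)))"
          using that(2-4) by (simp add: field_simps power2_eq_square)
        thus ?thesis using that(1) by simp
      qed
      have "(-1) ^ k * (-1) ^ k = (1::complex)" by (simp flip: power_mult_distrib)
      from rearr[OF this _ smc(2,3)] show ?thesis
        unfolding 1 2 3 exp_int_pole smc(1)[symmetric] by simp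
    qed
    finally show ?thesis unfolding ff sign_cancel by simp
  qed
  have re: "residue ?f (?b i + of_nat k) = ?r i k" if "i \<in> ?J" for i k
  proof (cases "i = 0")
    case True
    thus ?thesis using res0[of k] by simp
  next
    case False
    hence "?b i = n \<or> ?b i = - n" using that by auto
    from res1[OF this] show ?thesis using False by (simp only: if_False)
  qed
  have su: "?r i sums ?S i" if "i \<in> ?J" for i
  proof (cases "i = 0")
    case True
    thus ?thesis by (simp only: simp_thms if_True sums_mult besB_mult_minus_sums)
  next
    case False
    hence "2 * ?b i \<notin> \<int>" using that n2 n2' by auto
    from sums_mult[OF besB_square_sums[OF this, of "exp l"], of "- ?K * exp (?b i * l)"]
    show ?thesis using False by (simp only: if_False)
  qed
  have bc: "Re (?b i) > c \<and> Re (?b i) - c \<notin> \<int>" if "i \<in> ?J" for i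
    using that c \<nu>(1) Ints_minus[of "- c"] by (auto simp: n_def)
  have "(\<integral>y. ?f (Complex c y) \<partial>lborel) = - 2 * pi * (\<Sum>i\<in>?J. ?S i)"
    by (rule barnes_series(1)[where J = ?J and b = ?b and c = c and ?c0.0 = "c - 1" and f = ?f and q = ?q
            and X = "\<nu> + 2 * norm (exp l)" and r = ?r and S = ?S,
          OF _ bc inj _ hol ty _ ra qb re su]) (use l in auto)
  also have "(\<Sum>i\<in>?J. ?S i) = ?S 0 + (?S 1 + ?S (- 1))" by simp
  also have "- 2 * pi * \<dots> = 2 * pi * (?K * of_real (sqrt pi) *
             (exp (n * l) * exp (- (2 * n * of_real (ln 2))) * (besB n (exp l / 4))\<^sup>2 +
              exp (- n * l) * exp (2 * n * of_real (ln 2)) * (besB (- n) (exp l / 4))\<^sup>2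
              - 2 * (besB (- n) (exp l / 4) * besB n (exp l / 4))))"
  proof -
    have "complex_of_real (- 2 * p) * (2 * K * (q * S) + (- K * X * (q * Y * B) + - K * X' * (q * Y' * B'))) =
          complex_of_real (2 * p) * (K * q * (X * Y * B + X' * Y' * B' - 2 * S))" for p :: real and K q S X Y B X' Y' B' :: complex
      by (simp add: algebra_simps)
    moreover have "?S 0 = 2 * ?K * ?SA" by (simp only: simp_thms if_True)
    moreover have "?S 1 = - ?K * exp (n * l) * ?SB n"
      by (simp only: of_int_1 mult_1_left one_neq_zero if_False)
    moreover have "?S (- 1) = - ?K * exp (- n * l) * (of_real (sqrt pi) * exp (2 * n * of_real (ln 2)) * (besB (- n) (exp l / 4))\<^sup>2)"
    proof -
      have "of_int (- 1) * n = - n" "- (2 * - n * of_real (ln 2)) = 2 * n * of_real (ln 2)" "(- 1 :: int) \<noteq> 0" by simp_all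
      thus ?thesis by (simp only: if_False)
    qed
    ultimately show ?thesis by (simp only:)
  qed
  finally show ?thesis by (simp only: mult.assoc diff_0 n_def)
qed

section \<open>The Macdonald function as an integral\<close>

text \<open>Euler's integral after the substitution u = exp x, which makes it an integral over the
  whole line, as in \<open>kfun\<close>.\<close>

lemma Gamma_exp_integral:
  assumes "Re a > 0"
  shows "integrable lborel (\<lambda>x. exp (a * of_real x) * of_real (exp (- exp x)))" (is ?A)
    and "(\<integral>x. exp (a * of_real x) * of_real (exp (- exp x)) \<partial>lborel) = Gamma a" (is ?B)
proof -
  let ?f = "\<lambda>u::real. of_real u powr (a - 1) / complex_of_real (exp u)"
  let ?h = "\<lambda>x. exp (a * of_real x) * complex_of_real (exp (- exp x))"
  have img: "exp ` UNIV = {0::real<..}" 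
  proof (intro equalityI subsetI)
    fix x :: real assume "x \<in> {0<..}"
    thus "x \<in> range exp" by (metis exp_ln greaterThan_iff rangeI)
  qed auto
  have "?f absolutely_integrable_on exp ` UNIV \<and> integral (exp ` UNIV) ?f = Gamma a"
    unfolding img using absolutely_integrable_Gamma_integral'[OF assms] Gamma_integral_complex'[OF assms]
    by (auto intro: integral_unique)
  hence *: "(\<lambda>x. \<bar>exp x\<bar> *\<^sub>R ?f (exp x)) absolutely_integrable_on UNIV \<and> integral UNIV (\<lambda>x. \<bar>exp x\<bar> *\<^sub>R ?f (exp x)) = Gamma a"
    by (subst has_absolute_integral_change_of_variables_real) (auto intro!: derivative_eq_intros simp: inj_on_def)
  have eq: "\<bar>exp x\<bar> *\<^sub>R ?f (exp x) = ?h x" for x :: real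
  proof -
    have "of_real (exp x) powr (a - 1) = exp ((a - 1) * of_real x)"
      by (simp add: powr_def Ln_of_real flip: exp_of_real)
    hence "\<bar>exp x\<bar> *\<^sub>R ?f (exp x) = (exp (of_real x) * exp ((a - 1) * of_real x)) * inverse (of_real (exp (exp x)))"
      by (simp add: scaleR_conv_of_real divide_inverse flip: exp_of_real)
    also have "exp (of_real x) * exp ((a - 1) * of_real x) = exp (a * of_real x)"
      by (simp add: algebra_simps flip: exp_add)
    also have "inverse (of_real (exp (exp x))) = complex_of_real (exp (- exp x))"
      by (simp only: exp_minus of_real_inverse)
    finally show ?thesis .
  qed
  have ai: "?h absolutely_integrable_on UNIV" and iv: "integral UNIV ?h = Gamma a"
    using * unfolding eq by auto
  have meas: "?h \<in> borel_measurable lborel" by simp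
  have il: "integrable lebesgue ?h" using ai unfolding set_integrable_def by simp
  show ?A using il integrable_completion[OF meas] by simp
  have "(\<integral>x. ?h x \<partial>lborel) = (\<integral>x. ?h x \<partial>lebesgue)" using integral_completion[OF meas] by simp
  also have "\<dots> = integral UNIV ?h"
    using set_lebesgue_integral_eq_integral(2)[OF ai] by (simp add: set_lebesgue_integral_def)
  finally show ?B using iv by simp
qed

lemma Gamma_exp_integral_scaled:
  fixes \<tau> :: real
  assumes "Re a > 0" "\<tau> > 0"
  shows "integrable lborel (\<lambda>x. exp (a * of_real x) * of_real (exp (- \<tau> * exp x)))" (is ?A)
    and "(\<integral>x. exp (a * of_real x) * of_real (exp (- \<tau> * exp x)) \<partial>lborel) = Gamma a * exp (- a * of_real (ln \<tau>))" (is ?B)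
proof -
  let ?h = "\<lambda>x. exp (a * of_real x) * complex_of_real (exp (- \<tau> * exp x))"
  let ?g = "\<lambda>x. exp (a * of_real x) * complex_of_real (exp (- exp x))"
  have eq: "?h (- ln \<tau> + 1 * x) = exp (- a * of_real (ln \<tau>)) * ?g x" for x
  proof -
    have "exp (- ln \<tau> + 1 * x) = exp x / \<tau>" using assms by (simp add: exp_diff)
    hence "- \<tau> * exp (- ln \<tau> + 1 * x) = - exp x" using assms by simp
    moreover have "exp (a * of_real (- ln \<tau> + 1 * x)) = exp (- a * of_real (ln \<tau>)) * exp (a * of_real x)"
      by (simp add: algebra_simps flip: exp_add)
    ultimately show ?thesis by (simp only: mult.assoc)
  qed
  have i: "integrable lborel (\<lambda>x. exp (- a * of_real (ln \<tau>)) * ?g x)"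
    using Gamma_exp_integral(1)[OF assms(1)] by simp
  show ?A
    using lborel_integrable_real_affine_iff[of 1 ?h "- ln \<tau>"] i unfolding eq by simp
  have "(\<integral>x. ?h x \<partial>lborel) = (\<integral>x. exp (- a * of_real (ln \<tau>)) * ?g x \<partial>lborel)"
    using lborel_integral_real_affine[of 1 ?h "- ln \<tau>"] unfolding eq by simp
  also have "\<dots> = exp (- a * of_real (ln \<tau>)) * Gamma a"
    using Gamma_exp_integral(2)[OF assms(1)] by simp
  finally show ?B by (simp add: mult.commute)
qed

text \<open>Only countably many abscissas are excluded. This supplies lines that stay off all poles
  after any number of unit shifts.\<close>

lemma exists_generic_abscissa:
  fixes a b :: real
  assumes "finite F" "a < b"
  obtains c where "a < c" "c < b" "\<And>x. x \<in> F \<Longrightarrow> x - c \<notin> \<int>"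
proof -
  have "countable (\<Union>x\<in>F. range (\<lambda>n::int. x - of_int n))" using assms(1) by (intro countable_UN) (auto intro: countable_finite)
  moreover have "uncountable {a<..<b}" using assms(2) by (simp add: uncountable_open_interval)
  ultimately have "\<not> {a<..<b} \<subseteq> (\<Union>x\<in>F. range (\<lambda>n::int. x - of_int n))" using countable_subset by blast
  then obtain c where c: "c \<in> {a<..<b}" "c \<notin> (\<Union>x\<in>F. range (\<lambda>n::int. x - of_int n))" by blast
  have "x - c \<notin> \<int>" if "x \<in> F" for x
  proof
    assume "x - c \<in> \<int>"
    then obtain n where "x - c = of_int n" by (elim Ints_cases)
    hence "c = x - of_int n" by simp
    thus False using c(2) that by blast
  qed
  thus ?thesis using c(1) that by auto
qed

text \<open>For t = 2 tau, exp(-t cosh x) = exp(-tau exp x) exp(-tau exp(-x)). The second factor is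
  written as a Cahen-Mellin integral and the order of integration exchanged; the x-integral becomes
  Gamma(nu - s) times a power of tau, and \<open>barnes_two\<close> evaluates the rest.\<close>

lemma kfun_eq_knon_real:
  fixes \<tau> :: real
  assumes \<nu>: "Re \<nu> > 0" "\<nu> \<notin> \<int>" and \<tau>: "\<tau> > 0"
  shows "kfun \<nu> (of_real (2 * \<tau>)) = knon \<nu> (of_real (2 * \<tau>))"
proof -
  obtain c where c: "- 1 < c" "c < 0" "\<And>x. x \<in> {0, Re \<nu>} \<Longrightarrow> x - c \<notin> \<int>"
    using exists_generic_abscissa[of "{0, Re \<nu>}" "-1" 0] by auto
  have cn: "c \<notin> \<int>" "Re \<nu> - c \<notin> \<int>" using c(3)[of 0] c(3)[of "Re \<nu>"] by auto
  define A where "A = (\<lambda>x::real. exp (\<nu> * of_real x) * complex_of_real (exp (- \<tau> * exp x)))"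
  define H where "H = (\<lambda>y::real. Gamma (- Complex c y) * exp (Complex c y * of_real (ln \<tau>)))"
  \<comment> \<open>The joint integrand on the line Re s = c: integrating over y restores the
    exponential, integrating over x gives the Gamma function.\<close>
  define F where "F = (\<lambda>x y. A x * (H y * exp (- Complex c y * of_real x)))"
  have shiftA: "A x * exp (- Complex c y * of_real x) = exp ((\<nu> - Complex c y) * of_real x) * complex_of_real (exp (- \<tau> * exp x))" for x y
    unfolding A_def by (simp add: algebra_simps exp_diff exp_minus divide_inverse)
  have Hexp: "H y * exp (- Complex c y * of_real x) = Gamma (- Complex c y) * exp (Complex c y * of_real (ln \<tau> - x))" for x y
    unfolding H_def by (simp add: algebra_simps exp_diff exp_minus divide_inverse)
  have inner_y: "(\<integral>y. F x y \<partial>lborel) = 2 * pi * (exp (\<nu> * of_real x) * exp (- of_real (2 * \<tau>) * of_real (cosh x)))" for x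
  proof -
    have "(\<integral>y. F x y \<partial>lborel) = A x * (\<integral>y. Gamma (- Complex c y) * exp (Complex c y * of_real (ln \<tau> - x)) \<partial>lborel)"
      unfolding F_def Hexp by simp
    also have "(\<integral>y. Gamma (- Complex c y) * exp (Complex c y * of_real (ln \<tau> - x)) \<partial>lborel) = complex_of_real (2 * pi) * exp (- exp (complex_of_real (ln \<tau> - x)))"
      by (rule barnes_exp(1)) (use c cn in auto)
    also have "exp (- exp (complex_of_real (ln \<tau> - x))) = of_real (exp (- (\<tau> * exp (- x))))"
    proof -
      have "exp (complex_of_real (ln \<tau> - x)) = of_real (exp (ln \<tau> - x))" by (rule exp_of_real)
      also have "exp (ln \<tau> - x) = \<tau> * exp (- x)" using \<tau> by (simp add: exp_diff exp_minus divide_inverse)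
      finally show ?thesis by (simp flip: exp_of_real)
    qed
    also have "A x * (complex_of_real (2 * pi) * of_real (exp (- (\<tau> * exp (- x))))) =
        complex_of_real (2 * pi) * (exp (\<nu> * of_real x) * of_real (exp (- \<tau> * exp x) * exp (- (\<tau> * exp (- x)))))"
      unfolding A_def by simp
    also have "exp (- \<tau> * exp x) * exp (- (\<tau> * exp (- x))) = exp (- (2 * \<tau>) * cosh x)"
      by (simp add: cosh_def algebra_simps flip: exp_add)
    also have "complex_of_real (exp (- (2 * \<tau>) * cosh x)) = exp (- of_real (2 * \<tau>) * of_real (cosh x))"
      by (simp flip: exp_of_real)
    finally show ?thesis .
  qed
  have FA: "F x y = H y * (exp ((\<nu> - Complex c y) * of_real x) * complex_of_real (exp (- \<tau> * exp x)))" for x y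
  proof -
    have "F x y = H y * (A x * exp (- Complex c y * of_real x))" unfolding F_def by (rule mult.left_commute)
    thus ?thesis by (simp only: shiftA)
  qed
  have inner_x: "(\<integral>x. F x y \<partial>lborel) = exp (- \<nu> * of_real (ln \<tau>)) *
      (Gamma (- Complex c y) * Gamma (\<nu> - Complex c y) * exp (Complex c y * (2 * of_real (ln \<tau>))))" for y
  proof -
    have "(\<integral>x. F x y \<partial>lborel) = (\<integral>x. H y * (exp ((\<nu> - Complex c y) * of_real x) * complex_of_real (exp (- \<tau> * exp x))) \<partial>lborel)"
      by (simp only: FA)
    also have "\<dots> = H y * (Gamma (\<nu> - Complex c y) * exp (- (\<nu> - Complex c y) * of_real (ln \<tau>)))"
      using Gamma_exp_integral_scaled(2)[of "\<nu> - Complex c y" \<tau>] \<nu> c \<tau> by simp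
    also have "\<dots> = Gamma (- Complex c y) * Gamma (\<nu> - Complex c y) *
        (exp (Complex c y * of_real (ln \<tau>)) * exp (- (\<nu> - Complex c y) * of_real (ln \<tau>)))"
      unfolding H_def by (simp only: mult_ac)
    also have "exp (Complex c y * of_real (ln \<tau>)) * exp (- (\<nu> - Complex c y) * of_real (ln \<tau>)) =
        exp (- \<nu> * of_real (ln \<tau>)) * exp (Complex c y * (2 * of_real (ln \<tau>)))"
      by (simp add: algebra_simps flip: exp_add)
    finally show ?thesis by (simp only: mult_ac)
  qed
  have contG: "continuous_on UNIV (\<lambda>y. Gamma (- Complex c y))"
  proof (rule continuous_on_compose2[of "{s. 0 < Re s}" Gamma])
    show "continuous_on {s. 0 < Re s} (Gamma :: complex \<Rightarrow> complex)"
      by (intro holomorphic_on_imp_continuous_on holomorphic_Gamma) (auto elim!: nonpos_Ints_cases)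
  qed (use c in \<open>auto intro!: continuous_intros\<close>)
  have contF: "continuous_on UNIV (\<lambda>p. F (fst p) (snd p))"
    unfolding F_def A_def H_def
    by (intro continuous_intros continuous_on_compose2[OF contG continuous_on_snd[OF continuous_on_id]]) auto
  have H: "integrable lborel H"
    unfolding H_def by (rule barnes_exp(2)) (use c cn in auto)
  \<comment> \<open>On a vertical line the modulus factorises into a function of y and a function of
    x, which makes absolute integrability on the plane immediate.\<close>
  have normF: "norm (F x y) = norm (H y) * norm (exp (of_real (Re \<nu> - c) * of_real x) * complex_of_real (exp (- \<tau> * exp x)))" for x y
    unfolding F_def A_def by (simp add: norm_mult algebra_simps flip: exp_add)
  have gi: "integrable lborel (\<lambda>x. exp (of_real (Re \<nu> - c) * of_real x) * complex_of_real (exp (- \<tau> * exp x)))"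
    by (rule Gamma_exp_integral_scaled(1)) (use \<nu> c \<tau> in auto)
  have "integrable (lborel \<Otimes>\<^sub>M lborel) (\<lambda>p. F (fst p) (snd p))"
  proof (rule lborel_pair.Fubini_integrable)
    show "(\<lambda>p. F (fst p) (snd p)) \<in> borel_measurable (lborel \<Otimes>\<^sub>M lborel)"
      unfolding lborel_prod using borel_measurable_continuous_onI[OF contF] by simp
    show "integrable lborel (\<lambda>x. \<integral>y. norm (F (fst (x, y)) (snd (x, y))) \<partial>lborel)"
      unfolding fst_conv snd_conv normF using gi by simp
    show "AE x in lborel. integrable lborel (\<lambda>y. F (fst (x, y)) (snd (x, y)))"
    proof (rule AE_I2, unfold fst_conv snd_conv)
      fix x
      have "integrable lborel (\<lambda>y. Gamma (- Complex c y) * exp (Complex c y * of_real (ln \<tau> - x)))"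
        by (rule barnes_exp(2)) (use c cn in auto)
      thus "integrable lborel (F x)" unfolding F_def Hexp by simp
    qed
  qed
  hence fub: "(\<integral>y. (\<integral>x. F x y \<partial>lborel) \<partial>lborel) = (\<integral>x. (\<integral>y. F x y \<partial>lborel) \<partial>lborel)"
    by (intro lborel_pair.Fubini_integral) (simp add: case_prod_unfold)
  have l: "\<bar>Im (2 * complex_of_real (ln \<tau>))\<bar> < pi" by simp
  have e1: "exp (2 * complex_of_real (ln \<tau>)) = of_real (\<tau>\<^sup>2)"
    using \<tau> by (simp add: exp_double exp_of_real flip: exp_of_real) (simp add: exp_of_real)
  have rearrange: "E * (2 * P * (P / S * (A - q * B))) = 4 * P * (P / 2 * ((E * A - (E * q) * B) / S))" for E P S A B q :: complex
    by (cases "S = 0") (simp_all add: field_simps)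
  have "4 * pi * kfun \<nu> (of_real (2 * \<tau>)) = (\<integral>x. (\<integral>y. F x y \<partial>lborel) \<partial>lborel)"
    unfolding inner_y kfun_def cint_def by simp
  also have "\<dots> = exp (- \<nu> * of_real (ln \<tau>)) * (2 * pi * (of_real pi / sin (of_real pi * \<nu>) *
      (besB (- \<nu>) (of_real (\<tau>\<^sup>2)) - exp (\<nu> * (2 * of_real (ln \<tau>))) * besB \<nu> (of_real (\<tau>\<^sup>2)))))"
    unfolding fub[symmetric] inner_x using barnes_two[OF l \<nu> c(2) cn] unfolding e1 by simp
  also have "\<dots> = 4 * pi * (of_real pi / 2 * ((exp (- \<nu> * of_real (ln \<tau>)) * besB (- \<nu>) (of_real (\<tau>\<^sup>2)) -
      (exp (- \<nu> * of_real (ln \<tau>)) * exp (\<nu> * (2 * of_real (ln \<tau>)))) * besB \<nu> (of_real (\<tau>\<^sup>2))) / sin (of_real pi * \<nu>)))"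
    unfolding of_real_mult of_real_numeral by (rule rearrange)
  also have "exp (- \<nu> * of_real (ln \<tau>)) * exp (\<nu> * (2 * of_real (ln \<tau>))) = exp (\<nu> * of_real (ln \<tau>))"
    by (simp add: algebra_simps flip: exp_add)
  also have "of_real pi / 2 * ((exp (- \<nu> * of_real (ln \<tau>)) * besB (- \<nu>) (of_real (\<tau>\<^sup>2)) -
      exp (\<nu> * of_real (ln \<tau>)) * besB \<nu> (of_real (\<tau>\<^sup>2))) / sin (of_real pi * \<nu>)) = knon \<nu> (of_real (2 * \<tau>))"
  proof -
    have "Ln (of_real (2 * \<tau>) / 2) = complex_of_real (ln \<tau>)" using Ln_of_real[OF \<tau>] by simp
    moreover have "(complex_of_real (2 * \<tau>))\<^sup>2 / 4 = of_real (\<tau>\<^sup>2)" by (simp add: power_mult_distrib)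
    ultimately show ?thesis unfolding knon_def besI_def by (simp only:)
  qed
  finally show ?thesis by simp
qed

text \<open>Both sides are holomorphic in the right half-plane and agree on the positive axis, so
  the identity theorem extends \<open>kfun_eq_knon_real\<close> to complex t.\<close>

lemma kfun_eq_knon:
  assumes \<nu>: "Re \<nu> > 0" "\<nu> \<notin> \<int>" and t: "Re t > 0"
  shows "kfun \<nu> t = knon \<nu> t"
proof -
  let ?S = "{t. 0 < Re t}" and ?U = "complex_of_real ` {0<..}"
  have "(\<lambda>t. kfun \<nu> t - knon \<nu> t) holomorphic_on ?S"
  proof (rule holomorphic_on_diff)
    show "kfun \<nu> holomorphic_on ?S"
      unfolding holomorphic_on_def field_differentiable_def
      using kfun_deriv has_field_derivative_at_within by fastforce
    have "besI \<mu> holomorphic_on ?S" for \<mu>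
      unfolding holomorphic_on_def field_differentiable_def
      using besI_deriv has_field_derivative_at_within by fastforce
    thus "knon \<nu> holomorphic_on ?S"
      unfolding knon_def [abs_def] divide_inverse by (intro holomorphic_intros)
  qed
  moreover have "open ?S" by (intro open_Collect_less continuous_intros)
  moreover have "connected ?S" by (intro convex_connected convex_halfspace_Re_gt)
  moreover have "?U \<subseteq> ?S" "1 \<in> ?S" by auto
  moreover have "(1::complex) islimpt ?U"
    unfolding islimpt_approachable
  proof (intro allI impI)
    fix e :: real assume "e > 0"
    hence "dist (complex_of_real (1 + e / 2)) 1 < e" by (simp add: dist_norm)
    thus "\<exists>x'\<in>?U. x' \<noteq> 1 \<and> dist x' 1 < e" using \<open>e > 0\<close>
      by (intro bexI[of _ "complex_of_real (1 + e / 2)"]) (auto simp: complex_eq_iff)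
  qed
  moreover have "kfun \<nu> z - knon \<nu> z = 0" if z: "z \<in> ?U" for z
  proof -
    obtain x :: real where x: "x > 0" "z = of_real x" using z by auto
    hence "z = of_real (2 * (x / 2))" by simp
    with x(1) show ?thesis using kfun_eq_knon_real[OF \<nu>, of "x / 2"] by simp
  qed
  ultimately have "kfun \<nu> t - knon \<nu> t = 0"
    using t by (intro analytic_continuation[of "\<lambda>t. kfun \<nu> t - knon \<nu> t" ?S ?U 1 t]) auto
  thus ?thesis by simp
qed

text \<open>At an integer index the defining limit is taken through the punctured unit disc, which
  contains no integer and has positive real part because the index is at least 1; there
  \<open>kfun\<close> agrees with the quotient, and it is continuous in the index.\<close>

lemma macdonald_K_eq_kfun:
  fixes \<nu> :: real
  assumes "\<nu> > 0" and t: "Re t > 0"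
  shows "macdonald_K (of_real \<nu>) t = kfun (of_real \<nu>) t"
proof -
  have t0: "t \<noteq> 0" using t by auto
  have nonint: "macdonald_K_nonint \<mu> t = kfun \<mu> t" if "Re \<mu> > 0" "\<mu> \<notin> \<int>" for \<mu>
    using kfun_eq_knon[OF that t] by (simp add: macdonald_K_nonint_def knon_def bessel_I_eq[OF t0])
  show ?thesis
  proof (cases "complex_of_real \<nu> \<in> \<int>")
    case False
    thus ?thesis using nonint[of "of_real \<nu>"] assms by (simp add: macdonald_K_def)
  next
    case True
    then obtain m where m: "complex_of_real \<nu> = of_int m" by (elim Ints_cases)
    hence \<nu>m: "\<nu> = of_int m" by (metis of_real_of_int_eq of_real_eq_iff)
    with assms(1) have m1: "m \<ge> 1" by simp
    have "((\<lambda>\<mu>. kfun \<mu> t) \<longlongrightarrow> kfun (of_real \<nu>) t) (at (of_real \<nu>))"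
      unfolding tendsto_at_iff_sequentially using kfun_dfun_tendsto(1)[OF _ t] by (auto simp: o_def)
    moreover have "\<forall>\<^sub>F \<mu> in at (complex_of_real \<nu>). kfun \<mu> t = macdonald_K_nonint \<mu> t"
      using eventually_at_ball'[OF zero_less_one, of "complex_of_real \<nu>" UNIV]
    proof eventually_elim
      case (elim \<mu>)
      hence \<mu>: "\<mu> \<noteq> complex_of_real \<nu>" "dist (complex_of_real \<nu>) \<mu> < 1" by auto
      have "\<bar>Re (of_real \<nu> - \<mu>)\<bar> < 1" using \<mu>(2) abs_Re_le_cmod[of "of_real \<nu> - \<mu>"] by (simp add: dist_norm)
      moreover have "\<nu> \<ge> 1" using \<nu>m m1 by simp
      ultimately have "Re \<mu> > 0" by simp
      moreover have "\<mu> \<notin> \<int>"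
      proof
        assume "\<mu> \<in> \<int>"
        then obtain j where "\<mu> = of_int j" by (elim Ints_cases)
        hence "complex_of_real \<nu> - \<mu> = of_int (m - j)" using m by simp
        hence "norm (complex_of_real \<nu> - \<mu>) = of_int \<bar>m - j\<bar>" by (simp only: norm_of_int of_int_abs)
        hence "m = j" using \<mu>(2) by (simp add: dist_norm)
        thus False using \<mu>(1) m \<open>\<mu> = of_int j\<close> by simp
      qed
      ultimately show "kfun \<mu> t = macdonald_K_nonint \<mu> t" using nonint by simp
    qed
    ultimately have "((\<lambda>\<mu>. macdonald_K_nonint \<mu> t) \<longlongrightarrow> kfun (of_real \<nu>) t) (at (of_real \<nu>))"
      by (rule Lim_transform_eventually)
    hence "Lim (at (of_real \<nu>)) (\<lambda>\<mu>. macdonald_K_nonint \<mu> t) = kfun (of_real \<nu>) t"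
      by (intro tendsto_Lim) auto
    thus ?thesis using True by (simp add: macdonald_K_def)
  qed
qed

section \<open>The two Meijer functions as functions of \<open>t\<close>\<close>

text \<open>Growth on one vertical line, uniform over the parameter set \<open>N\<close> and for all
  y. The uniformity permits limits in nu; a single function is treated as a constant family over
  {0}.\<close>

definition fam_type :: "(real \<Rightarrow> real \<Rightarrow> complex) \<Rightarrow> real set \<Rightarrow> real \<Rightarrow> bool" where
  "fam_type h N \<kappa> \<longleftrightarrow> (\<forall>e>0. \<exists>C>0. \<forall>\<nu>\<in>N. \<forall>y. norm (h \<nu> y) \<le> C * exp ((\<kappa> + e) * \<bar>y\<bar>))"

lemma fam_type_mult:
  assumes "fam_type f N \<kappa>" "fam_type g N \<kappa>'"
  shows "fam_type (\<lambda>\<nu> y. f \<nu> y * g \<nu> y) N (\<kappa> + \<kappa>')"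
  unfolding fam_type_def
proof (intro allI impI)
  fix e :: real assume e: "e > 0"
  hence e2: "e / 2 > 0" by simp
  obtain C where C: "C > 0" "\<forall>\<nu>\<in>N. \<forall>y. norm (f \<nu> y) \<le> C * exp ((\<kappa> + e/2) * \<bar>y\<bar>)"
    using assms(1) e2 unfolding fam_type_def by blast
  obtain C' where C': "C' > 0" "\<forall>\<nu>\<in>N. \<forall>y. norm (g \<nu> y) \<le> C' * exp ((\<kappa>' + e/2) * \<bar>y\<bar>)"
    using assms(2) e2 unfolding fam_type_def by blast
  show "\<exists>C>0. \<forall>\<nu>\<in>N. \<forall>y. norm (f \<nu> y * g \<nu> y) \<le> C * exp ((\<kappa> + \<kappa>' + e) * \<bar>y\<bar>)"
  proof (intro exI[of _ "C * C'"] conjI ballI allI)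
    fix \<nu> y assume n: "\<nu> \<in> N"
    have "norm (f \<nu> y * g \<nu> y) \<le> (C * exp ((\<kappa> + e/2) * \<bar>y\<bar>)) * (C' * exp ((\<kappa>' + e/2) * \<bar>y\<bar>))"
      unfolding norm_mult using n C C' by (intro mult_mono) auto
    also have "\<dots> = (C * C') * exp ((\<kappa> + \<kappa>' + e) * \<bar>y\<bar>)"
      by (simp add: algebra_simps flip: exp_add)
    finally show "norm (f \<nu> y * g \<nu> y) \<le> (C * C') * exp ((\<kappa> + \<kappa>' + e) * \<bar>y\<bar>)" .
  qed (use C(1) C'(1) in auto)
qed

lemma fam_type_Gamma:
  assumes "x0 > 0" "\<And>\<nu> y. \<nu> \<in> N \<Longrightarrow> x0 \<le> Re (z \<nu> y) \<and> Re (z \<nu> y) \<le> x1 \<and> \<bar>Im (z \<nu> y)\<bar> = \<bar>y\<bar>"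
  shows "fam_type (\<lambda>\<nu> y. Gamma (z \<nu> y)) N (- pi / 2)"
  unfolding fam_type_def
proof (intro allI impI)
  fix e :: real assume e: "e > 0"
  from Gamma_strip_bound[OF assms(1) e, of x1] obtain C where C: "C > 0" "\<And>s. x0 \<le> Re s \<Longrightarrow> Re s \<le> x1 \<Longrightarrow>
       norm (Gamma s :: complex) \<le> C * exp (- (pi/2 - e) * \<bar>Im s\<bar>)" by blast
  have "norm (Gamma (z \<nu> y)) \<le> C * exp ((- pi / 2 + e) * \<bar>y\<bar>)" if "\<nu> \<in> N" for \<nu> y
    using C(2)[of "z \<nu> y"] assms(2)[OF that, of y] by simp
  thus "\<exists>C>0. \<forall>\<nu>\<in>N. \<forall>y. norm (Gamma (z \<nu> y)) \<le> C * exp ((- pi / 2 + e) * \<bar>y\<bar>)"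
    using C(1) by blast
qed

lemma fam_type_rGamma:
  assumes "\<And>\<nu> y. \<nu> \<in> N \<Longrightarrow> x0 \<le> Re (z \<nu> y) \<and> Re (z \<nu> y) \<le> x1 \<and> \<bar>Im (z \<nu> y)\<bar> = \<bar>y\<bar>"
  shows "fam_type (\<lambda>\<nu> y. rGamma (z \<nu> y)) N (pi / 2)"
  unfolding fam_type_def
proof (intro allI impI)
  fix e :: real assume e: "e > 0"
  from rGamma_strip_bound[OF e, of x0 x1] obtain C where C: "C > 0" "\<And>s. x0 \<le> Re s \<Longrightarrow> Re s \<le> x1 \<Longrightarrow>
       norm (rGamma s :: complex) \<le> C * exp ((pi/2 + e) * \<bar>Im s\<bar>)" by blast
  have "norm (rGamma (z \<nu> y)) \<le> C * exp ((pi / 2 + e) * \<bar>y\<bar>)" if "\<nu> \<in> N" for \<nu> y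
    using C(2)[of "z \<nu> y"] assms[OF that, of y] by simp
  thus "\<exists>C>0. \<forall>\<nu>\<in>N. \<forall>y. norm (rGamma (z \<nu> y)) \<le> C * exp ((pi / 2 + e) * \<bar>y\<bar>)"
    using C(1) by blast
qed

definition g31 :: "real \<Rightarrow> complex \<Rightarrow> complex" where
  "g31 \<nu> s = Gamma (- s) * (Gamma (- s) * (Gamma (of_real \<nu> - s) * (Gamma (1/2 + s) *
     (rGamma (1 + of_real \<nu> + s) * rGamma (1 - s)))))"

definition g40 :: "real \<Rightarrow> complex \<Rightarrow> complex" where
  "g40 \<nu> s = Gamma (- s) * (Gamma (- s) * (Gamma (of_real \<nu> - s) * (Gamma (- of_real \<nu> - s) *
     (rGamma (1/2 - s) * rGamma (1 - s)))))"

text \<open>The exponential is (t^2)^s: the arguments of the Meijer functions are squares, and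
  Ln(t^2) = 2 Ln t in the right half-plane.\<close>

definition mint :: "(complex \<Rightarrow> complex) \<Rightarrow> real \<Rightarrow> complex \<Rightarrow> complex" where
  "mint g c t = (\<integral>y. g (Complex c y) * exp (Complex c y * (2 * Ln t)) \<partial>lborel)"

text \<open>Four Gamma factors and two reciprocal ones give -4 pi/2 + 2 pi/2 = -pi, which just
  outweighs the growth 2 |Im (Ln t)| < pi of the power for Re t > 0.\<close>

lemma g31_fam_type:
  assumes c: "- 1/2 < c" "c < 0" and N: "N \<subseteq> {\<nu>1..\<nu>2}" "\<nu>1 > 0"
  shows "fam_type (\<lambda>\<nu> y. g31 \<nu> (Complex c y)) N (- pi)"
proof -
  have "fam_type (\<lambda>\<nu> y. g31 \<nu> (Complex c y)) N (- pi / 2 + (- pi / 2 + (- pi / 2 + (- pi / 2 + (pi / 2 + pi / 2)))))"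
    unfolding g31_def
  proof (intro fam_type_mult)
    show "fam_type (\<lambda>\<nu> y. Gamma (- Complex c y)) N (- pi / 2)"
         "fam_type (\<lambda>\<nu> y. Gamma (- Complex c y)) N (- pi / 2)"
      by (rule fam_type_Gamma[of "-c" _ _ "-c"]; use c in force)+
    show "fam_type (\<lambda>\<nu> y. Gamma (of_real \<nu> - Complex c y)) N (- pi / 2)"
      by (rule fam_type_Gamma[of "-c" _ _ "\<nu>2 - c"]; use c N in force)
    show "fam_type (\<lambda>\<nu> y. Gamma (1/2 + Complex c y)) N (- pi / 2)"
      by (rule fam_type_Gamma[of "1/2 + c" _ _ "1/2 + c"]; use c in force)
    show "fam_type (\<lambda>\<nu> y. rGamma (1 + of_real \<nu> + Complex c y)) N (pi / 2)"
      by (rule fam_type_rGamma[of _ "1 + \<nu>1 + c" _ "1 + \<nu>2 + c"]; use c N in force)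
    show "fam_type (\<lambda>\<nu> y. rGamma (1 - Complex c y)) N (pi / 2)"
      by (rule fam_type_rGamma[of _ "1 - c" _ "1 - c"]; force)
  qed
  thus ?thesis by simp
qed

lemma g40_fam_type:
  assumes c: "c < - \<nu>2" and N: "N \<subseteq> {\<nu>1..\<nu>2}" "\<nu>1 > 0" "\<nu>2 > 0"
  shows "fam_type (\<lambda>\<nu> y. g40 \<nu> (Complex c y)) N (- pi)"
proof -
  have "fam_type (\<lambda>\<nu> y. g40 \<nu> (Complex c y)) N (- pi / 2 + (- pi / 2 + (- pi / 2 + (- pi / 2 + (pi / 2 + pi / 2)))))"
    unfolding g40_def
  proof (intro fam_type_mult)
    show "fam_type (\<lambda>\<nu> y. Gamma (- Complex c y)) N (- pi / 2)"
         "fam_type (\<lambda>\<nu> y. Gamma (- Complex c y)) N (- pi / 2)"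
      by (rule fam_type_Gamma[of "-c" _ _ "-c"]; use c N in force)+
    show "fam_type (\<lambda>\<nu> y. Gamma (of_real \<nu> - Complex c y)) N (- pi / 2)"
      by (rule fam_type_Gamma[of "-c" _ _ "\<nu>2 - c"]; use c N in force)
    show "fam_type (\<lambda>\<nu> y. Gamma (- of_real \<nu> - Complex c y)) N (- pi / 2)"
      by (rule fam_type_Gamma[of "- \<nu>2 - c" _ _ "- \<nu>1 - c"]; use c N in force)
    show "fam_type (\<lambda>\<nu> y. rGamma (1/2 - Complex c y)) N (pi / 2)"
      by (rule fam_type_rGamma[of _ "1/2 - c" _ "1/2 - c"]; force)
    show "fam_type (\<lambda>\<nu> y. rGamma (1 - Complex c y)) N (pi / 2)"
      by (rule fam_type_rGamma[of _ "1 - c" _ "1 - c"]; force)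
  qed
  thus ?thesis by simp
qed

lemma isCont_Gamma_complex: "z \<notin> \<int>\<^sub>\<le>\<^sub>0 \<Longrightarrow> isCont Gamma (z :: complex)"
  by (intro field_differentiable_imp_continuous_at field_differentiable_Gamma)

lemma isCont_rGamma_complex: "isCont rGamma (z :: complex)"
  by (intro field_differentiable_imp_continuous_at field_differentiable_rGamma)

lemma not_nonpos_Int_Re: "Re z > 0 \<Longrightarrow> z \<notin> \<int>\<^sub>\<le>\<^sub>0"
  by (auto elim!: nonpos_Ints_cases)

lemma tendsto_Gamma_Re_pos:
  fixes f :: "'a \<Rightarrow> complex"
  shows "(f \<longlongrightarrow> z) F \<Longrightarrow> Re z > 0 \<Longrightarrow> ((\<lambda>x. Gamma (f x)) \<longlongrightarrow> Gamma z) F"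
  by (rule isCont_tendsto_compose[OF isCont_Gamma_complex[OF not_nonpos_Int_Re]])

lemma tendsto_rGamma_complex:
  fixes f :: "'a \<Rightarrow> complex"
  shows "(f \<longlongrightarrow> z) F \<Longrightarrow> ((\<lambda>x. rGamma (f x)) \<longlongrightarrow> rGamma z) F"
  by (rule isCont_tendsto_compose[OF isCont_rGamma_complex])

lemma tendsto_Complex_line: "((\<lambda>y. Complex c y) \<longlongrightarrow> Complex c y) (at y)"
  by (intro tendsto_Complex tendsto_const tendsto_ident_at)

lemma g31_continuous:
  assumes "- 1/2 < c" "c < 0" "\<nu> > 0"
  shows "continuous_on UNIV (\<lambda>y. g31 \<nu> (Complex c y))"
  unfolding continuous_on_def g31_def using assms
  by (intro ballI tendsto_mult tendsto_Gamma_Re_pos tendsto_rGamma_complex tendsto_intros tendsto_Complex_line) auto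

lemma g40_continuous:
  assumes "c < - \<nu>" "\<nu> > 0"
  shows "continuous_on UNIV (\<lambda>y. g40 \<nu> (Complex c y))"
  unfolding continuous_on_def g40_def using assms
  by (intro ballI tendsto_mult tendsto_Gamma_Re_pos tendsto_rGamma_complex tendsto_intros tendsto_Complex_line) auto

lemma g31_tendsto:
  assumes "- 1/2 < c" "c < 0" "\<nu> > 0" "X \<longlonglongrightarrow> \<nu>"
  shows "(\<lambda>n. g31 (X n) (Complex c y)) \<longlonglongrightarrow> g31 \<nu> (Complex c y)"
  unfolding g31_def using assms
  by (intro tendsto_mult tendsto_Gamma_Re_pos tendsto_rGamma_complex tendsto_intros) auto

lemma g40_tendsto:
  assumes "c < - \<nu>" "\<nu> > 0" "X \<longlonglongrightarrow> \<nu>"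
  shows "(\<lambda>n. g40 (X n) (Complex c y)) \<longlonglongrightarrow> g40 \<nu> (Complex c y)"
  unfolding g40_def using assms
  by (intro tendsto_mult tendsto_Gamma_Re_pos tendsto_rGamma_complex tendsto_intros) auto

lemma norm_exp_line: "norm (exp (Complex c y * (2 * l))) = exp (2 * c * Re l - 2 * y * Im l)"
  by (simp add: algebra_simps)

lemma mint_bound:
  assumes g: "norm (g (Complex c y)) \<le> C * exp ((- pi + e) * \<bar>y\<bar>)"
    and l: "\<bar>Im l\<bar> \<le> \<theta>" "\<bar>Re l\<bar> \<le> R" and C: "C \<ge> 0"
  shows "norm (g (Complex c y) * exp (Complex c y * (2 * l))) \<le> C * exp (2 * \<bar>c\<bar> * R) * exp (- (pi - e - 2 * \<theta>) * \<bar>y\<bar>)"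
proof -
  have "c * Re l \<le> \<bar>c\<bar> * \<bar>Re l\<bar>" by (metis abs_ge_self abs_mult)
  also have "\<dots> \<le> \<bar>c\<bar> * R" using l by (intro mult_left_mono) auto
  finally have 1: "c * Re l \<le> \<bar>c\<bar> * R" .
  have "- (y * Im l) \<le> \<bar>y\<bar> * \<bar>Im l\<bar>" by (metis abs_ge_minus_self abs_mult)
  also have "\<dots> \<le> \<bar>y\<bar> * \<theta>" using l by (intro mult_left_mono) auto
  finally have 2: "- (y * Im l) \<le> \<theta> * \<bar>y\<bar>" by (simp add: mult.commute)
  have "norm (g (Complex c y) * exp (Complex c y * (2 * l))) \<le> (C * exp ((- pi + e) * \<bar>y\<bar>)) * exp (2 * (\<bar>c\<bar> * R) + 2 * (\<theta> * \<bar>y\<bar>))"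
    unfolding norm_mult[of "g (Complex c y)"] norm_exp_line using 1 2 g C by (intro mult_mono) auto
  also have "\<dots> = C * exp (2 * \<bar>c\<bar> * R) * exp (- (pi - e - 2 * \<theta>) * \<bar>y\<bar>)"
    by (simp add: algebra_simps flip: exp_add)
  finally show ?thesis .
qed

lemma Im_Ln_right_half_plane: "Re t > 0 \<Longrightarrow> \<bar>Im (Ln t)\<bar> < pi / 2"
  by (rule Re_Ln_pos_lt_imp)

lemma mint_integrable:
  assumes cont: "continuous_on UNIV (\<lambda>y. g (Complex c y))" and type: "fam_type (\<lambda>_ y. g (Complex c y)) {0} (- pi)"
    and t: "Re t > 0"
  shows "integrable lborel (\<lambda>y. g (Complex c y) * exp (Complex c y * (2 * Ln t)))"
proof -
  \<comment> \<open>The margin between the decay pi and the growth of the power; half of it is spent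
    on the loss \<open>e\<close>, the other half remains as decay.\<close>
  define d where "d = pi - 2 * \<bar>Im (Ln t)\<bar>"
  have d: "d > 0" using Im_Ln_right_half_plane[OF t] by (simp add: d_def)
  hence "d / 2 > 0" by simp
  then obtain C where C: "C > 0" "\<And>y. norm (g (Complex c y)) \<le> C * exp ((- pi + d / 2) * \<bar>y\<bar>)"
    using type unfolding fam_type_def by blast
  show ?thesis
  proof (rule integrable_exp_decay[of _ "d / 2" "C * exp (2 * \<bar>c\<bar> * \<bar>Re (Ln t)\<bar>)"])
    show "(\<lambda>y. g (Complex c y) * exp (Complex c y * (2 * Ln t))) \<in> borel_measurable borel"
      by (intro borel_measurable_continuous_onI continuous_intros cont)
    show "norm (g (Complex c y) * exp (Complex c y * (2 * Ln t))) \<le> C * exp (2 * \<bar>c\<bar> * \<bar>Re (Ln t)\<bar>) * exp (- (d / 2) * \<bar>y\<bar>)" for y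
    proof -
      have eq: "pi - d / 2 - 2 * \<bar>Im (Ln t)\<bar> = d / 2" by (simp add: d_def field_simps)
      show ?thesis
        by (rule mint_bound[where g = g and c = c and l = "Ln t" and e = "d / 2" and C = C and y = y, OF C(2) order_refl order_refl less_imp_le[OF C(1)], unfolded eq])
    qed
  qed (use d in auto)
qed

text \<open>Differentiating exp(2 s Ln t) produces 2 s / t. The dominating function must hold for
  all points near t at once, which requires a common margin between decay and growth.\<close>

lemma mint_deriv:
  assumes cont: "continuous_on UNIV (\<lambda>y. g (Complex c y))" and type: "fam_type (\<lambda>_ y. g (Complex c y)) {0} (- pi)"
    and t: "Re t > 0"
  shows "(mint g c has_field_derivative 2 / t * mint (\<lambda>s. s * g s) c t) (at t)"
proof -
  define r where "r = Re t / 2"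
  have r: "r > 0" using t by (simp add: r_def)
  have pos: "r \<le> Re w" if "w \<in> cball t r" for w
    using that abs_Re_le_cmod[of "t - w"] by (auto simp: dist_norm r_def)
  have nonpos: "w \<notin> \<real>\<^sub>\<le>\<^sub>0" if "w \<in> cball t r" for w
    using pos[OF that] r by (auto simp: complex_nonpos_Reals_iff)
  have contLn: "continuous_on (cball t r) Ln" by (intro continuous_on_Ln nonpos)
  have "compact (Ln ` cball t r)" by (intro compact_continuous_image contLn compact_cball)
  hence "bounded (Ln ` cball t r)" by (rule compact_imp_bounded)
  then obtain R where "\<forall>x\<in>Ln ` cball t r. norm x \<le> R" unfolding bounded_iff by blast
  hence R: "norm (Ln w) \<le> R" if "w \<in> cball t r" for w using that by blast
  \<comment> \<open>The worst argument on the compact disc is attained at a point of the right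
    half-plane, so the margin is still positive.\<close>
  have "\<exists>x\<in>cball t r. \<forall>w\<in>cball t r. \<bar>Im (Ln w)\<bar> \<le> \<bar>Im (Ln x)\<bar>"
    by (rule continuous_attains_sup) (use r in \<open>auto intro!: continuous_intros contLn\<close>)
  then obtain x where x: "x \<in> cball t r" "\<And>w. w \<in> cball t r \<Longrightarrow> \<bar>Im (Ln w)\<bar> \<le> \<bar>Im (Ln x)\<bar>" by blast
  define d where "d = pi - 2 * \<bar>Im (Ln x)\<bar>"
  have "Re x > 0" using pos[OF x(1)] r by linarith
  hence d: "d > 0" using Im_Ln_right_half_plane[of x] by (simp add: d_def)
  hence "d / 2 > 0" by simp
  then obtain C where C: "C > 0" "\<And>y. norm (g (Complex c y)) \<le> C * exp ((- pi + d / 2) * \<bar>y\<bar>)"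
    using type unfolding fam_type_def by blast
  \<comment> \<open>Half of the margin is left as decay; a quarter absorbs the new factor |s| and a
    quarter keeps the majorant integrable.\<close>
  obtain B where B: "B > 0" "\<And>u. u \<ge> 0 \<Longrightarrow> \<bar>c\<bar> + u \<le> B * exp (d / 4 * u)"
    using linear_le_exp[of "d / 4" "\<bar>c\<bar>"] d by auto
  let ?f' = "\<lambda>w y. 2 / w * ((Complex c y * g (Complex c y)) * exp (Complex c y * (2 * Ln w)))"
  let ?G = "\<lambda>y::real. 2 / r * (B * (C * exp (2 * \<bar>c\<bar> * R)) * exp (- (d / 4) * \<bar>y\<bar>))"
  have "((\<lambda>w. \<integral>y. g (Complex c y) * exp (Complex c y * (2 * Ln w)) \<partial>lborel) has_field_derivative (\<integral>y. ?f' t y \<partial>lborel)) (at t)"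
  proof (rule leibniz_integral[OF r])
    fix w y assume "w \<in> ball t r"
    hence w: "w \<in> cball t r" by auto
    have w0: "w \<noteq> 0" using nonpos[OF w] by auto
    show "((\<lambda>w. g (Complex c y) * exp (Complex c y * (2 * Ln w))) has_field_derivative ?f' w y) (at w)"
      using nonpos[OF w] w0 by (auto intro!: derivative_eq_intros simp: field_simps)
    have "r \<le> norm w" using pos[OF w] complex_Re_le_cmod[of w] by linarith
    hence 1: "norm (2 / w) \<le> 2 / r" using r by (simp add: norm_divide frac_le)
    have "norm (Complex c y) \<le> \<bar>c\<bar> + \<bar>y\<bar>" using cmod_le[of "Complex c y"] by simp
    also have "\<dots> \<le> B * exp (d / 4 * \<bar>y\<bar>)" by (rule B) auto
    finally have 2: "norm (Complex c y) \<le> B * exp (d / 4 * \<bar>y\<bar>)" .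
    have eq: "pi - d / 2 - 2 * \<bar>Im (Ln x)\<bar> = d / 2" by (simp add: d_def field_simps)
    have 3: "norm (g (Complex c y) * exp (Complex c y * (2 * Ln w))) \<le> C * exp (2 * \<bar>c\<bar> * R) * exp (- (d / 2) * \<bar>y\<bar>)"
      using mint_bound[where g = g and c = c and l = "Ln w" and e = "d / 2" and C = C and y = y and R = R, OF C(2) x(2)[OF w]] R[OF w] abs_Re_le_cmod[of "Ln w"] C(1) unfolding eq by simp
    have "norm (?f' w y) = norm (2 / w) * (norm (Complex c y) * norm (g (Complex c y) * exp (Complex c y * (2 * Ln w))))"
      by (simp only: norm_mult mult.assoc)
    also have "\<dots> \<le> 2 / r * ((B * exp (d / 4 * \<bar>y\<bar>)) * (C * exp (2 * \<bar>c\<bar> * R) * exp (- (d / 2) * \<bar>y\<bar>)))"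
      using 1 2 3 B(1) C(1) r by (intro mult_mono) auto
    also have "\<dots> = ?G y"
    proof -
      have "exp (d / 4 * \<bar>y\<bar>) * exp (- (d / 2) * \<bar>y\<bar>) = exp (- (d / 4) * \<bar>y\<bar>)"
        by (simp add: algebra_simps flip: exp_add)
      moreover have "a * ((b * e1) * (k * e2)) = a * (b * k * (e1 * e2))" for a b e1 k e2 :: real by simp
      ultimately show ?thesis by metis
    qed
    finally show "norm (?f' w y) \<le> ?G y" .
  next
    fix w assume "w \<in> ball t r"
    hence "Re w > 0" using pos[of w] r by auto
    thus "integrable lborel (\<lambda>y. g (Complex c y) * exp (Complex c y * (2 * Ln w)))"
      by (rule mint_integrable[OF cont type])
  next
    show "?f' t \<in> borel_measurable borel"
      by (intro borel_measurable_continuous_onI continuous_intros cont)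
    show "integrable lborel ?G"
      using integrable_exp_neg_abs[of "d / 4"] d by simp
  qed
  thus ?thesis unfolding mint_def [abs_def] by simp
qed

text \<open>For real t the modulus of the power is t^(2c) for all y, and c < 0. Placing the line to
  the left of 0 is what gives decay at infinity.\<close>

lemma mint_tendsto_0:
  assumes type: "fam_type (\<lambda>_ y. g (Complex c y)) {0} (- pi)" and cont: "continuous_on UNIV (\<lambda>y. g (Complex c y))" and c: "c < 0"
  shows "((\<lambda>t::real. mint g c (of_real t)) \<longlongrightarrow> 0) at_top"
proof (rule Lim_null_comparison)
  define M where "M = (\<integral>y. norm (g (Complex c y)) \<partial>lborel)"
  show "\<forall>\<^sub>F t in at_top. norm (mint g c (complex_of_real t)) \<le> M * exp (2 * c * ln t)"
    using eventually_gt_at_top[of "0::real"]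
  proof eventually_elim
    case (elim t)
    have "norm (mint g c (of_real t)) \<le> (\<integral>y. norm (g (Complex c y) * exp (Complex c y * (2 * Ln (of_real t)))) \<partial>lborel)"
      unfolding mint_def by (rule integral_norm_bound)
    also have "\<dots> = (\<integral>y. norm (g (Complex c y)) * exp (2 * c * ln t) \<partial>lborel)"
    proof (rule Bochner_Integration.integral_cong[OF refl])
      fix y
      show "norm (g (Complex c y) * exp (Complex c y * (2 * Ln (of_real t)))) = norm (g (Complex c y)) * exp (2 * c * ln t)"
        unfolding norm_mult[of "g (Complex c y)"] norm_exp_line using elim by (simp add: Ln_of_real)
    qed
    also have "\<dots> = M * exp (2 * c * ln t)"
      unfolding M_def by simp
    finally show ?case .
  qed
  have "filterlim (\<lambda>t::real. (- 2 * c) * ln t) at_top at_top"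
    by (rule filterlim_tendsto_pos_mult_at_top[OF tendsto_const _ ln_at_top]) (use c in auto)
  hence "((\<lambda>t::real. exp (- ((- 2 * c) * ln t))) \<longlongrightarrow> 0) at_top"
    by (intro filterlim_compose[OF exp_at_bot] filterlim_compose[OF filterlim_uminus_at_bot_at_top])
  thus "((\<lambda>t::real. M * exp (2 * c * ln t)) \<longlongrightarrow> 0) at_top"
    by (intro tendsto_mult_right_zero) simp
qed

lemma mint_tendsto_parameter:
  assumes cont: "\<And>n. continuous_on UNIV (\<lambda>y. h (X n) (Complex c y))" "continuous_on UNIV (\<lambda>y. h \<nu> (Complex c y))"
    and lim: "\<And>y. (\<lambda>n. h (X n) (Complex c y)) \<longlonglongrightarrow> h \<nu> (Complex c y)"
    and type: "fam_type (\<lambda>\<nu> y. h \<nu> (Complex c y)) N (- pi)" "\<And>n. X n \<in> N" and t: "Re t > 0"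
  shows "(\<lambda>n. mint (h (X n)) c t) \<longlonglongrightarrow> mint (h \<nu>) c t"
proof -
  define d where "d = pi - 2 * \<bar>Im (Ln t)\<bar>"
  have d: "d > 0" using Im_Ln_right_half_plane[OF t] by (simp add: d_def)
  hence "d / 2 > 0" by simp
  then obtain C where C: "C > 0" "\<And>n y. norm (h (X n) (Complex c y)) \<le> C * exp ((- pi + d / 2) * \<bar>y\<bar>)"
    using type unfolding fam_type_def by blast
  have eq: "pi - d / 2 - 2 * \<bar>Im (Ln t)\<bar> = d / 2" by (simp add: d_def field_simps)
  show ?thesis
    unfolding mint_def
  proof (rule Bochner_Integration.integral_dominated_convergence)
    show "(\<lambda>y. h \<nu> (Complex c y) * exp (Complex c y * (2 * Ln t))) \<in> borel_measurable lborel"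
         "(\<lambda>y. h (X n) (Complex c y) * exp (Complex c y * (2 * Ln t))) \<in> borel_measurable lborel" for n
      by (simp, intro borel_measurable_continuous_onI continuous_intros cont)+
    show "integrable lborel (\<lambda>y::real. C * exp (2 * \<bar>c\<bar> * \<bar>Re (Ln t)\<bar>) * exp (- (d / 2) * \<bar>y\<bar>))"
      using integrable_exp_neg_abs[of "d / 2"] d by (intro Bochner_Integration.integrable_mult_right) simp
    show "AE y in lborel. (\<lambda>n. h (X n) (Complex c y) * exp (Complex c y * (2 * Ln t))) \<longlonglongrightarrow> h \<nu> (Complex c y) * exp (Complex c y * (2 * Ln t))"
      by (intro AE_I2 tendsto_mult_right lim)
    show "AE y in lborel. norm (h (X n) (Complex c y) * exp (Complex c y * (2 * Ln t))) \<le>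
            C * exp (2 * \<bar>c\<bar> * \<bar>Re (Ln t)\<bar>) * exp (- (d / 2) * \<bar>y\<bar>)" for n
      using mint_bound[of "h (X n)" c, OF C(2) order_refl order_refl, of _ "Ln t"] C(1) unfolding eq by (intro AE_I2) simp
  qed
qed

text \<open>The argument of t is below pi/2 in modulus, so doubling it does not leave the principal
  branch.\<close>

lemma Ln_square_right_half_plane:
  assumes "Re t > 0"
  shows "Ln (t\<^sup>2) = 2 * Ln t"
proof -
  have "t \<noteq> 0" using assms by auto
  hence "exp (2 * Ln t) = t\<^sup>2" by (simp add: exp_double)
  moreover have "- pi < Im (2 * Ln t)" "Im (2 * Ln t) \<le> pi"
    using Im_Ln_right_half_plane[OF assms] by auto
  ultimately show ?thesis using Ln_exp[of "2 * Ln t"] by simp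
qed

text \<open>Valid for every abscissa between -1/2 and 0, hence also the means of moving
  \<open>mint\<close> from a generic line to a prescribed one.\<close>

lemma meijer_G_31:
  assumes c: "- 1/2 < c" "c < 0" and \<nu>: "\<nu> > 0" and t: "Re t > 0"
  shows "meijer_G 3 1 [1/2, 1] [0, 0, of_real \<nu>, - of_real \<nu>] (t\<^sup>2) = mint (g31 \<nu>) c t / (2 * pi)"
proof -
  let ?as = "[1/2, 1 :: complex]" and ?bs = "[0, 0, of_real \<nu>, - of_real \<nu> :: complex]"
  have t0: "t\<^sup>2 \<noteq> 0" using t by auto
  have eq: "meijer_integrand 3 1 ?as ?bs (t\<^sup>2) s = g31 \<nu> s * exp (s * (2 * Ln t))" for s
    unfolding meijer_integrand_eq[OF t0] Ln_square_right_half_plane[OF t] g31_def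
    by (simp add: numeral_3_eq_3 lessThan_Suc atLeastLessThanSuc mult_ac)
  have Gamma0: "strip_type (\<lambda>s. Gamma (- s)) (- pi / 2)" using strip_type_Gamma_minus[of 0] by simp
  have "strip_type (\<lambda>s. g31 \<nu> s * exp (s * (2 * Ln t))) ((- pi / 2 + (- pi / 2 + (- pi / 2 + (- pi / 2 + (pi / 2 + pi / 2))))) + \<bar>Im (2 * Ln t)\<bar>)"
    unfolding g31_def
    by (intro strip_type_mult strip_type_Gamma_minus Gamma0 strip_type_Gamma_plus
          strip_type_rGamma_plus strip_type_rGamma_minus strip_type_exp)
  hence ty: "strip_type (meijer_integrand 3 1 ?as ?bs (t\<^sup>2)) (- pi + \<bar>Im (2 * Ln t)\<bar>)"
    unfolding eq[abs_def] by simp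
  have "meijer_G 3 1 ?as ?bs (t\<^sup>2) = (\<integral>y. meijer_integrand 3 1 ?as ?bs (t\<^sup>2) (Complex c y) \<partial>lborel) / (2 * pi)"
  proof (rule meijer_G_line(1)[OF _ _ _ _ t0 ty])
    fix j :: nat assume "j < 3"
    hence "j = 0 \<or> j = 1 \<or> j = 2" by auto
    thus "?bs ! j \<in> \<real>" "c < Re (?bs ! j)" using c \<nu> by auto
  next
    show "- pi + \<bar>Im (2 * Ln t)\<bar> < 0" using Im_Ln_right_half_plane[OF t] by simp
  qed (use c in auto)
  thus ?thesis unfolding eq mint_def .
qed

lemma meijer_G_40:
  assumes c: "c < - \<nu>" and \<nu>: "\<nu> > 0" and t: "Re t > 0"
  shows "meijer_G 4 0 [1/2, 1] [0, 0, of_real \<nu>, - of_real \<nu>] (t\<^sup>2) = mint (g40 \<nu>) c t / (2 * pi)"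
proof -
  let ?as = "[1/2, 1 :: complex]" and ?bs = "[0, 0, of_real \<nu>, - of_real \<nu> :: complex]"
  have t0: "t\<^sup>2 \<noteq> 0" using t by auto
  have eq: "meijer_integrand 4 0 ?as ?bs (t\<^sup>2) s = g40 \<nu> s * exp (s * (2 * Ln t))" for s
    unfolding meijer_integrand_eq[OF t0] Ln_square_right_half_plane[OF t] g40_def
    by (simp add: eval_nat_numeral lessThan_Suc atLeastLessThanSuc mult_ac)
  have Gamma0: "strip_type (\<lambda>s. Gamma (- s)) (- pi / 2)" using strip_type_Gamma_minus[of 0] by simp
  have "strip_type (\<lambda>s. g40 \<nu> s * exp (s * (2 * Ln t))) ((- pi / 2 + (- pi / 2 + (- pi / 2 + (- pi / 2 + (pi / 2 + pi / 2))))) + \<bar>Im (2 * Ln t)\<bar>)"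
    unfolding g40_def
    by (intro strip_type_mult strip_type_Gamma_minus Gamma0
          strip_type_rGamma_minus strip_type_exp)
  hence ty: "strip_type (meijer_integrand 4 0 ?as ?bs (t\<^sup>2)) (- pi + \<bar>Im (2 * Ln t)\<bar>)"
    unfolding eq[abs_def] by simp
  have "meijer_G 4 0 ?as ?bs (t\<^sup>2) = (\<integral>y. meijer_integrand 4 0 ?as ?bs (t\<^sup>2) (Complex c y) \<partial>lborel) / (2 * pi)"
  proof (rule meijer_G_line(1)[OF _ _ _ _ t0 ty])
    fix j :: nat assume "j < 4"
    hence "j = 0 \<or> j = 1 \<or> j = 2 \<or> j = 3" by auto
    thus "?bs ! j \<in> \<real>" "c < Re (?bs ! j)" using c \<nu> by auto
  next
    show "- pi + \<bar>Im (2 * Ln t)\<bar> < 0" using Im_Ln_right_half_plane[OF t] by simp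
  qed auto
  thus ?thesis unfolding eq mint_def .
qed

section \<open>Variation of parameters\<close>

text \<open>Equals -t (I dD/dt - I' D) with I' = dI/dt, once \<open>besI_deriv\<close> and
  \<open>dfun_deriv\<close> are inserted; the term -2 I K comes from the (2 / t) K in the latter. D
  solves the modified Bessel equation with source 4 nu K, so its derivative is -4 nu I K /
  t.\<close>

definition coeffE :: "complex \<Rightarrow> complex \<Rightarrow> complex" where
  "coeffE \<nu> t = t * (besI (\<nu> + 1) t * dfun \<nu> t + besI \<nu> t * dfun (\<nu> + 1) t) - 2 * (besI \<nu> t * kfun \<nu> t)"

text \<open>The same expression with K in place of I; the sign change reflects that K_(nu+1) enters
  dK/dt with a minus sign.\<close>

definition coeffF :: "complex \<Rightarrow> complex \<Rightarrow> complex" where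
  "coeffF \<nu> t = t * (kfun \<nu> t * dfun (\<nu> + 1) t - kfun (\<nu> + 1) t * dfun \<nu> t) - 2 * (kfun \<nu> t)\<^sup>2"

lemma coeffE_deriv:
  assumes t: "Re t > 0"
  shows "(coeffE \<nu> has_field_derivative - 4 * \<nu> * besI \<nu> t * kfun \<nu> t / t) (at t)"
proof -
  note [derivative_intros] = besI_deriv[OF t] besI_deriv_up[OF t] kfun_deriv[OF t] dfun_deriv[OF t] dfun_deriv_up[OF t]
  have t0: "t \<noteq> 0" using t by auto
  show ?thesis
    unfolding coeffE_def [abs_def]
    by (rule derivative_eq_intros refl)+ (use t0 in \<open>simp add: field_simps power2_eq_square\<close>)
qed

lemma coeffF_deriv:
  assumes t: "Re t > 0"
  shows "(coeffF \<nu> has_field_derivative - 4 * \<nu> * (kfun \<nu> t)\<^sup>2 / t) (at t)"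
proof -
  note [derivative_intros] = kfun_deriv[OF t] kfun_deriv_up[OF t] dfun_deriv[OF t] dfun_deriv_up[OF t]
  have t0: "t \<noteq> 0" using t by auto
  show ?thesis
    unfolding coeffF_def [abs_def] power2_eq_square
    by (rule derivative_eq_intros refl)+ (use t0 in \<open>simp add: field_simps power2_eq_square\<close>)
qed

lemma zero_deriv_tendsto_0_imp_0:
  fixes f :: "complex \<Rightarrow> complex"
  assumes "\<And>t. Re t > 0 \<Longrightarrow> (f has_field_derivative 0) (at t)"
    and "((\<lambda>x::real. f (of_real x)) \<longlongrightarrow> 0) at_top" and "Re t > 0"
  shows "f t = 0"
proof -
  have "\<exists>c. \<forall>x\<in>{t. Re t > 0}. f x = c"
    by (intro has_field_derivative_zero_constant convex_halfspace_Re_gt)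
       (use assms(1) in \<open>auto intro: has_field_derivative_at_within\<close>)
  then obtain c where c: "\<And>x. Re x > 0 \<Longrightarrow> f x = c" by blast
  have "\<forall>\<^sub>F x::real in at_top. f (of_real x) = c"
    using eventually_gt_at_top[of "0::real"] by eventually_elim (auto intro: c)
  hence "((\<lambda>x::real. f (of_real x)) \<longlongrightarrow> c) at_top" by (rule tendsto_eventually)
  hence "c = 0" using assms(2) by (intro tendsto_unique[of at_top]) auto
  thus ?thesis using c assms(3) by simp
qed

lemma wronskian_IK:
  fixes \<nu> :: real
  assumes "\<nu> > 0" "\<nu> \<notin> \<int>" "Re t > 0"
  shows "t * (besI \<nu> t * kfun (\<nu> + 1) t + besI (\<nu> + 1) t * kfun \<nu> t) = 1"
proof -
  have "complex_of_real \<nu> \<notin> \<int>" using assms(2) by simp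
  moreover have "complex_of_real \<nu> + 1 \<notin> \<int>"
    using calculation by (metis Ints_1 Ints_diff add_diff_cancel_right')
  moreover have "t \<noteq> 0" using assms(3) by auto
  ultimately show ?thesis using knon_wronskian[of "of_real \<nu>" t] kfun_eq_knon[of _ t] assms by simp
qed

text \<open>I grows while K and D decay, so only products can be controlled. By
  \<open>dr_bounds\<close>, x D and x E are at most multiples of K_nu and K_(nu+1); all terms are
  then dominated by I_nu K_(nu+1) + I_(nu+1) K_nu, which the Wronskian relation evaluates to
  1/x.\<close>

lemma coeffE_real_bound:
  fixes \<nu> x :: real
  assumes \<nu>: "\<nu> > 0" "\<nu> \<notin> \<int>" and x: "x > 0"
  shows "norm (coeffE \<nu> (of_real x)) \<le> (4 * \<nu> + 4) / x"
proof -
  obtain i where i: "i \<ge> 0" "besI (of_real \<nu>) (of_real x) = of_real i" using besI_real_nonneg[of \<nu> x] \<nu> x by auto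
  obtain j where j: "j \<ge> 0" "besI (of_real \<nu> + 1) (of_real x) = of_real j" using besI_real_nonneg[of "\<nu> + 1" x] \<nu> x by auto
  define k where "k = kr \<nu> x"
  define l where "l = kr (\<nu> + 1) x"
  define D where "D = dr \<nu> x"
  define E where "E = dr (\<nu> + 1) x"
  have kl: "0 \<le> k" "k \<le> l" using kr_nonneg kr_mono \<nu> x by (auto simp: k_def l_def)
  have D: "0 \<le> x * D" "x * D \<le> 2 * \<nu> * k" using dr_bounds[of \<nu> x] \<nu> x by (auto simp: D_def k_def field_simps)
  have E: "0 \<le> x * E" "x * E \<le> 2 * (\<nu> + 1) * l" using dr_bounds[of "\<nu> + 1" x] \<nu> x by (auto simp: E_def l_def field_simps)
  have up: "kfun (of_real \<nu> + 1) (of_real x) = of_real l" "dfun (of_real \<nu> + 1) (of_real x) = of_real E"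
    using kfun_of_real[of "\<nu> + 1" x] dfun_of_real[of "\<nu> + 1" x] by (simp_all add: l_def E_def)
  have "complex_of_real (x * (i * l + j * k)) = 1"
    using wronskian_IK[OF \<nu>, of "of_real x"] x by (simp add: up i(2) j(2) kfun_of_real k_def)
  hence W: "x * (i * l + j * k) = 1" by (metis of_real_eq_1_iff)
  have eq: "coeffE \<nu> (of_real x) = of_real (j * (x * D) + i * (x * E) - 2 * (i * k))"
    unfolding coeffE_def up i(2) j(2) kfun_of_real dfun_of_real k_def[symmetric] D_def[symmetric] by (simp add: algebra_simps)
  have 1: "0 \<le> j * (x * D)" "j * (x * D) \<le> j * (2 * \<nu> * k)" "0 \<le> i * (x * E)" "i * (x * E) \<le> i * (2 * (\<nu> + 1) * l)"
     "0 \<le> i * k" "i * k \<le> i * l" "0 \<le> j * k"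
    using i(1) j(1) D E kl by (auto intro: mult_left_mono)
  have "\<bar>j * (x * D) + i * (x * E) - 2 * (i * k)\<bar> \<le> 2 * \<nu> * (j * k) + 2 * (\<nu> + 1) * (i * l) + 2 * (i * l)"
    using 1 by (simp add: algebra_simps abs_le_iff)
  also have "\<dots> \<le> (4 * \<nu> + 4) * (i * l + j * k)"
  proof -
    have "0 \<le> (2 * \<nu>) * (i * l)" "0 \<le> (2 * \<nu> + 4) * (j * k)" using 1 \<nu> by (auto intro!: mult_nonneg_nonneg)
    thus ?thesis by (simp add: algebra_simps)
  qed
  also have "i * l + j * k = 1 / x" using W x by (simp add: field_simps)
  finally show ?thesis unfolding eq norm_of_real by simp
qed

text \<open>Here every product has two decaying factors once D is bounded by K through
  \<open>dr_bounds\<close>.\<close>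

lemma coeffF_real_tendsto_0:
  fixes \<nu> :: real
  assumes \<nu>: "\<nu> > 0"
  shows "((\<lambda>x::real. coeffF \<nu> (of_real x)) \<longlongrightarrow> 0) at_top"
proof (rule Lim_null_comparison)
  show "\<forall>\<^sub>F x in at_top. norm (coeffF \<nu> (complex_of_real x)) \<le> (4 * \<nu> + 2) * (kr \<nu> x * kr (\<nu> + 1) x) + 2 * (kr \<nu> x * kr \<nu> x)"
    using eventually_gt_at_top[of "0::real"]
  proof eventually_elim
    case x: (elim x)
    define k where "k = kr \<nu> x"
    define l where "l = kr (\<nu> + 1) x"
    define D where "D = dr \<nu> x"
    define E where "E = dr (\<nu> + 1) x"
    have kl: "0 \<le> k" "0 \<le> l" using kr_nonneg x by (auto simp: k_def l_def)
    have D: "0 \<le> x * D" "x * D \<le> 2 * \<nu> * k" using dr_bounds[of \<nu> x] \<nu> x by (auto simp: D_def k_def field_simps)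
    have E: "0 \<le> x * E" "x * E \<le> 2 * (\<nu> + 1) * l" using dr_bounds[of "\<nu> + 1" x] \<nu> x by (auto simp: E_def l_def field_simps)
    have up: "kfun (of_real \<nu> + 1) (of_real x) = of_real l" "dfun (of_real \<nu> + 1) (of_real x) = of_real E"
      using kfun_of_real[of "\<nu> + 1" x] dfun_of_real[of "\<nu> + 1" x] by (simp_all add: l_def E_def)
    have eq: "coeffF \<nu> (of_real x) = of_real (k * (x * E) - l * (x * D) - 2 * (k * k))"
      unfolding coeffF_def up kfun_of_real dfun_of_real k_def[symmetric] D_def[symmetric] by (simp add: algebra_simps power2_eq_square)
    have "0 \<le> k * (x * E)" "k * (x * E) \<le> k * (2 * (\<nu> + 1) * l)" "0 \<le> l * (x * D)" "l * (x * D) \<le> l * (2 * \<nu> * k)"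
      "0 \<le> k * k"
      using D E kl by (auto intro: mult_left_mono)
    hence "\<bar>k * (x * E) - l * (x * D) - 2 * (k * k)\<bar> \<le> k * (2 * (\<nu> + 1) * l) + l * (2 * \<nu> * k) + 2 * (k * k)" by linarith
    also have "\<dots> = (4 * \<nu> + 2) * (k * l) + 2 * (k * k)" by (simp add: algebra_simps)
    finally show ?case unfolding eq norm_of_real k_def l_def .
  qed
  show "((\<lambda>x. (4 * \<nu> + 2) * (kr \<nu> x * kr (\<nu> + 1) x) + 2 * (kr \<nu> x * kr \<nu> x)) \<longlongrightarrow> 0) at_top"
    by (intro tendsto_add_zero tendsto_mult_right_zero tendsto_mult_zero kr_tendsto_0)
qed

section \<open>Comparison of E and F with the Meijer functions\<close>

lemma mult_Gamma_rGamma_minus: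
  fixes s :: complex
  assumes "Re s < 0"
  shows "s * (Gamma (- s) * rGamma (1 - s)) = - 1"
proof -
  have "Gamma (- s) \<noteq> 0" using not_nonpos_Int_Re[of "- s"] assms by (simp add: Gamma_eq_zero_iff)
  moreover have "- s * rGamma (1 - s) = rGamma (- s)" using rGamma_plus1[of "- s"] by simp
  moreover have "s * (Gamma (- s) * rGamma (1 - s)) = - (Gamma (- s) * (- s * rGamma (1 - s)))" by simp
  ultimately show ?thesis by (simp add: rGamma_inverse_Gamma)
qed

lemma exp_Ln_half:
  fixes \<nu> t :: complex
  assumes "t \<noteq> 0"
  shows "(exp (\<nu> * Ln (t / 2)))\<^sup>2 = exp (\<nu> * (2 * Ln t)) * exp (- (2 * \<nu> * of_real (ln 2)))"
proof -
  have "Ln (t / 2) = Ln t - of_real (ln 2)"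
    using Ln_divide_of_real[of 2 t] assms by simp
  hence "2 * (\<nu> * Ln (t / 2)) = \<nu> * (2 * Ln t) + - (2 * \<nu> * of_real (ln 2))"
    by (simp only:) (simp add: right_diff_distrib)
  thus ?thesis by (simp only: exp_double[symmetric] exp_add)
qed

text \<open>The factor s turns one Gamma(-s) / Gamma(1 - s) into the constant -1, and
  \<open>barnes_IK\<close> at l = 2 Ln t evaluates what is left.\<close>

lemma mint_g31_deriv:
  fixes \<nu> :: real
  assumes \<nu>: "\<nu> > 0" "2 * \<nu> \<notin> \<int>" and c: "- 1/2 < c" "c < 0" "\<nu> - c \<notin> \<int>" and t: "Re t > 0"
  shows "mint (\<lambda>s. s * g31 \<nu> s) c t = - 4 * of_real pi * of_real (sqrt pi) * (besI \<nu> t * kfun \<nu> t)"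
proof -
  have t0: "t \<noteq> 0" using t by auto
  have \<nu>': "complex_of_real \<nu> \<notin> \<int>" using \<nu>(2) by (auto simp: Ints_mult)
  have l: "\<bar>Im (2 * Ln t)\<bar> < pi" using Im_Ln_right_half_plane[OF t] by simp
  have e: "exp (2 * Ln t) = t\<^sup>2" using t0 by (simp add: exp_double)
  define p where "p = exp (of_real \<nu> * Ln (t / 2))"
  define B where "B = besB (of_real \<nu>) (t\<^sup>2 / 4)"
  define A where "A = besB (- of_real \<nu>) (t\<^sup>2 / 4)"
  define S where "S = sin (of_real pi * complex_of_real \<nu>)"
  have pp: "exp (of_real \<nu> * (2 * Ln t)) * exp (- (2 * of_real \<nu> * of_real (ln 2))) = p\<^sup>2"
    unfolding p_def using exp_Ln_half[OF t0] by simp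
  have p0: "p \<noteq> 0" by (simp add: p_def)
  have IB: "besI \<nu> t = p * B" "besI (- of_real \<nu>) t = inverse p * A"
    by (simp_all add: besI_def p_def A_def B_def exp_minus)
  have K: "kfun \<nu> t = of_real pi / 2 * ((inverse p * A - p * B) / S)"
    using kfun_eq_knon[of "of_real \<nu>" t] \<nu> \<nu>' t unfolding knon_def IB S_def by simp
  have "s * g31 \<nu> s = - (Gamma (- s) * Gamma (of_real \<nu> - s) * Gamma (1/2 + s) * rGamma (1 + of_real \<nu> + s))"
    if "Re s < 0" for s
  proof -
    have "s * g31 \<nu> s = (s * (Gamma (- s) * rGamma (1 - s))) * (Gamma (- s) * Gamma (of_real \<nu> - s) * Gamma (1/2 + s) * rGamma (1 + of_real \<nu> + s))"
      unfolding g31_def by (simp only: mult_ac)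
    thus ?thesis unfolding mult_Gamma_rGamma_minus[OF that] by simp
  qed
  hence "mint (\<lambda>s. s * g31 \<nu> s) c t = - (\<integral>y. Gamma (- Complex c y) * Gamma (of_real \<nu> - Complex c y) * Gamma (1/2 + Complex c y) *
             rGamma (1 + of_real \<nu> + Complex c y) * exp (Complex c y * (2 * Ln t)) \<partial>lborel)"
    unfolding mint_def using c(2) by simp
  hence "mint (\<lambda>s. s * g31 \<nu> s) c t = - (2 * pi * (of_real pi / S * of_real (sqrt pi) * (A * B - p\<^sup>2 * B\<^sup>2)))"
    unfolding barnes_IK[OF l \<nu> c] e pp S_def A_def B_def .
  \<comment> \<open>With p = (t/2)^nu this is the factorisation A B - p^2 B^2 = (p B)(A / p - p B),
    whose factors are I_nu and I_(-nu) - I_nu.\<close>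
  moreover have "- (2 * P * (P / S * R * (A * B - p\<^sup>2 * B\<^sup>2))) = - 4 * P * R * ((p * B) * (P / 2 * ((inverse p * A - p * B) / S)))" for P R :: complex
    by (cases "S = 0") (use p0 in \<open>simp_all add: field_simps power2_eq_square\<close>)
  ultimately show ?thesis unfolding IB K of_real_mult of_real_numeral by (simp only:)
qed

text \<open>As for \<open>mint_g31_deriv\<close>, but with \<open>barnes_KK\<close>; its bracket is
  the square (A / p - p B)^2, hence K^2.\<close>

lemma mint_g40_deriv:
  fixes \<nu> :: real
  assumes \<nu>: "\<nu> > 0" "2 * \<nu> \<notin> \<int>" and c: "c < - \<nu>" "c \<notin> \<int>" "\<nu> - c \<notin> \<int>" "- \<nu> - c \<notin> \<int>" and t: "Re t > 0"
  shows "mint (\<lambda>s. s * g40 \<nu> s) c t = - 4 * of_real (sqrt pi) * (kfun \<nu> t)\<^sup>2"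
proof -
  have t0: "t \<noteq> 0" using t by auto
  have \<nu>': "complex_of_real \<nu> \<notin> \<int>" using \<nu>(2) by (auto simp: Ints_mult)
  have l: "\<bar>Im (2 * Ln t)\<bar> < pi" using Im_Ln_right_half_plane[OF t] by simp
  have e: "exp (2 * Ln t) = t\<^sup>2" using t0 by (simp add: exp_double)
  define p where "p = exp (of_real \<nu> * Ln (t / 2))"
  define B where "B = besB (of_real \<nu>) (t\<^sup>2 / 4)"
  define A where "A = besB (- of_real \<nu>) (t\<^sup>2 / 4)"
  define S where "S = sin (of_real pi * complex_of_real \<nu>)"
  have pp: "exp (of_real \<nu> * (2 * Ln t)) * exp (- (2 * of_real \<nu> * of_real (ln 2))) = p\<^sup>2"
    unfolding p_def using exp_Ln_half[OF t0] by simp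
  have qq: "exp (- of_real \<nu> * (2 * Ln t)) * exp (2 * of_real \<nu> * of_real (ln 2)) = (inverse p)\<^sup>2"
    unfolding p_def using exp_Ln_half[OF t0, of "- of_real \<nu>"] by (simp add: exp_minus)
  have p0: "p \<noteq> 0" by (simp add: p_def)
  have IB: "besI \<nu> t = p * B" "besI (- of_real \<nu>) t = inverse p * A"
    by (simp_all add: besI_def p_def A_def B_def exp_minus)
  have K: "kfun \<nu> t = of_real pi / 2 * ((inverse p * A - p * B) / S)"
    using kfun_eq_knon[of "of_real \<nu>" t] \<nu> \<nu>' t unfolding knon_def IB S_def by simp
  have "s * g40 \<nu> s = - (Gamma (- s) * Gamma (of_real \<nu> - s) * Gamma (- of_real \<nu> - s) * rGamma (1/2 - s))"
    if "Re s < 0" for s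
  proof -
    have "s * g40 \<nu> s = (s * (Gamma (- s) * rGamma (1 - s))) * (Gamma (- s) * Gamma (of_real \<nu> - s) * Gamma (- of_real \<nu> - s) * rGamma (1/2 - s))"
      unfolding g40_def by (simp only: mult_ac)
    thus ?thesis unfolding mult_Gamma_rGamma_minus[OF that] by simp
  qed
  hence "mint (\<lambda>s. s * g40 \<nu> s) c t = - (\<integral>y. Gamma (- Complex c y) * Gamma (of_real \<nu> - Complex c y) * Gamma (- of_real \<nu> - Complex c y) *
             rGamma (1/2 - Complex c y) * exp (Complex c y * (2 * Ln t)) \<partial>lborel)"
    unfolding mint_def using c(1) \<nu>(1) by simp
  hence "mint (\<lambda>s. s * g40 \<nu> s) c t = - (2 * pi * (of_real pi / (2 * S\<^sup>2) * of_real (sqrt pi) * (p\<^sup>2 * B\<^sup>2 + (inverse p)\<^sup>2 * A\<^sup>2 - 2 * (A * B))))"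
    unfolding barnes_KK[OF l \<nu> c] e pp qq S_def A_def B_def .
  moreover have "- (2 * P * (P / (2 * S\<^sup>2) * R * (p\<^sup>2 * B\<^sup>2 + (inverse p)\<^sup>2 * A\<^sup>2 - 2 * (A * B)))) = - 4 * R * (P / 2 * ((inverse p * A - p * B) / S))\<^sup>2" for P R :: complex
    by (cases "S = 0") (use p0 in \<open>simp_all add: field_simps power2_eq_square\<close>)
  ultimately show ?thesis unfolding K of_real_mult of_real_numeral by (simp only:)
qed

text \<open>The derivative is computed on a generic line d, as the residue evaluation needs, and the
  value is carried to the given c because both lines compute the same Meijer function.\<close>

lemma coeffE_eq_mint:
  fixes \<nu> :: real
  assumes \<nu>: "\<nu> > 0" "2 * \<nu> \<notin> \<int>" and t: "Re t > 0" and c: "- 1/2 < c" "c < 0"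
  shows "coeffE \<nu> t = of_real \<nu> / of_real (sqrt pi) * (mint (g31 \<nu>) c t / (2 * pi))"
proof -
  have \<nu>': "\<nu> \<notin> \<int>" using \<nu>(2) by (auto simp: Ints_mult)
  obtain d where d: "- 1/2 < d" "d < 0" "\<And>x. x \<in> {\<nu>} \<Longrightarrow> x - d \<notin> \<int>"
    using exists_generic_abscissa[of "{\<nu>}" "-1/2" 0] by auto
  have type: "fam_type (\<lambda>_ y. g31 \<nu> (Complex d y)) {0} (- pi)"
    using g31_fam_type[OF d(1,2), of "{\<nu>}" \<nu> \<nu>] \<nu>(1) by (simp add: fam_type_def)
  note cont = g31_continuous[OF d(1,2) \<nu>(1)]
  define R where "R = complex_of_real (sqrt pi)"
  have R: "R \<noteq> 0" by (simp add: R_def)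
  \<comment> \<open>The quotient of -4 nu I K / t by (2 / t)(-4 pi sqrt(pi) I K).\<close>
  define K where "K = of_real \<nu> / R / (2 * of_real pi)"
  have "coeffE \<nu> t - K * mint (g31 \<nu>) d t = 0"
  proof (rule zero_deriv_tendsto_0_imp_0[OF _ _ t])
    fix t assume t: "Re t > 0"
    hence t0: "t \<noteq> 0" by auto
    note D = mint_g31_deriv[OF \<nu> d(1,2) d(3)[OF singletonI] t, folded R_def]
    have "((\<lambda>t. coeffE \<nu> t - K * mint (g31 \<nu>) d t) has_field_derivative
        - 4 * of_real \<nu> * besI \<nu> t * kfun \<nu> t / t - K * (2 / t * (- 4 * of_real pi * R * (besI \<nu> t * kfun \<nu> t)))) (at t)"
      by (intro DERIV_diff DERIV_cmult coeffE_deriv[OF t] mint_deriv[OF cont type t, unfolded D])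
    thus "((\<lambda>t. coeffE \<nu> t - K * mint (g31 \<nu>) d t) has_field_derivative 0) (at t)"
      using t0 R by (simp add: K_def field_simps)
  next
    have "((\<lambda>x::real. coeffE \<nu> (of_real x)) \<longlongrightarrow> 0) at_top"
    proof (rule Lim_null_comparison)
      show "\<forall>\<^sub>F x in at_top. norm (coeffE \<nu> (complex_of_real x)) \<le> (4 * \<nu> + 4) / x"
        using eventually_gt_at_top[of "0::real"] by eventually_elim (rule coeffE_real_bound[OF \<nu>(1) \<nu>'])
      show "((\<lambda>x. (4 * \<nu> + 4) / x) \<longlongrightarrow> 0) at_top"
        by (intro real_tendsto_divide_at_top[OF tendsto_const] filterlim_ident)
    qed
    from tendsto_diff[OF this tendsto_mult_right_zero[OF mint_tendsto_0[OF type cont d(2)], of K]]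
    show "((\<lambda>x::real. coeffE \<nu> (of_real x) - K * mint (g31 \<nu>) d (of_real x)) \<longlongrightarrow> 0) at_top" by simp
  qed
  moreover have "mint (g31 \<nu>) d t = mint (g31 \<nu>) c t"
    using meijer_G_31[OF d(1,2) \<nu>(1) t] meijer_G_31[OF c \<nu>(1) t] by simp
  ultimately show ?thesis by (simp add: K_def R_def)
qed

lemma coeffF_eq_mint:
  fixes \<nu> :: real
  assumes \<nu>: "\<nu> > 0" "2 * \<nu> \<notin> \<int>" and t: "Re t > 0" and c: "c < - \<nu>"
  shows "coeffF \<nu> t = of_real \<nu> * of_real (sqrt pi) * (mint (g40 \<nu>) c t / (2 * pi))"
proof -
  obtain d where d: "- \<nu> - 1 < d" "d < - \<nu>" "\<And>x. x \<in> {0, \<nu>, - \<nu>} \<Longrightarrow> x - d \<notin> \<int>"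
    using exists_generic_abscissa[of "{0, \<nu>, - \<nu>}" "- \<nu> - 1" "- \<nu>"] by auto
  have d': "d \<notin> \<int>" "\<nu> - d \<notin> \<int>" "- \<nu> - d \<notin> \<int>"
    using d(3)[of 0] d(3)[of \<nu>] d(3)[of "- \<nu>"] by auto
  have type: "fam_type (\<lambda>_ y. g40 \<nu> (Complex d y)) {0} (- pi)"
    using g40_fam_type[OF d(2), of "{\<nu>}" \<nu>] \<nu>(1) by (simp add: fam_type_def)
  note cont = g40_continuous[OF d(2) \<nu>(1)]
  define R where "R = complex_of_real (sqrt pi)"
  have R: "R \<noteq> 0" by (simp add: R_def)
  have RR: "complex_of_real pi = R * R" by (simp add: R_def flip: of_real_mult)
  \<comment> \<open>The quotient of -4 nu K^2 / t by (2 / t)(-4 sqrt(pi) K^2) is nu / (2 sqrt(pi)),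
    rewritten by pi = sqrt(pi)^2.\<close>
  define K where "K = of_real \<nu> * R / (2 * of_real pi)"
  have "coeffF \<nu> t - K * mint (g40 \<nu>) d t = 0"
  proof (rule zero_deriv_tendsto_0_imp_0[OF _ _ t])
    fix t assume t: "Re t > 0"
    hence t0: "t \<noteq> 0" by auto
    note D = mint_g40_deriv[OF \<nu> d(2) d' t, folded R_def]
    have "((\<lambda>t. coeffF \<nu> t - K * mint (g40 \<nu>) d t) has_field_derivative
        - 4 * of_real \<nu> * (kfun \<nu> t)\<^sup>2 / t - K * (2 / t * (- 4 * R * (kfun \<nu> t)\<^sup>2))) (at t)"
      by (intro DERIV_diff DERIV_cmult coeffF_deriv[OF t] mint_deriv[OF cont type t, unfolded D])
    thus "((\<lambda>t. coeffF \<nu> t - K * mint (g40 \<nu>) d t) has_field_derivative 0) (at t)"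
      using t0 R unfolding K_def RR by (simp add: field_simps)
  next
    from tendsto_diff[OF coeffF_real_tendsto_0[OF \<nu>(1)] tendsto_mult_right_zero[OF mint_tendsto_0[OF type cont], of K]]
    show "((\<lambda>x::real. coeffF \<nu> (of_real x) - K * mint (g40 \<nu>) d (of_real x)) \<longlongrightarrow> 0) at_top" using d(2) \<nu>(1) by simp
  qed
  moreover have "mint (g40 \<nu>) d t = mint (g40 \<nu>) c t"
    using meijer_G_40[OF d(2) \<nu>(1) t] meijer_G_40[OF c \<nu>(1) t] by simp
  ultimately show ?thesis by (simp add: K_def R_def)
qed

text \<open>Multiplying D by the Wronskian expression 1 and regrouping gives K E - I F: the terms
  with index-shifted D and the terms 2 I K^2 cancel.\<close>

lemma dfun_eq_mint_generic:
  fixes \<nu> :: real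
  assumes \<nu>: "\<nu> > 0" "2 * \<nu> \<notin> \<int>" and t: "Re t > 0" and c: "- 1/2 < c" "c < 0" and d: "d < - \<nu>"
  shows "dfun \<nu> t = of_real \<nu> * (kfun \<nu> t / of_real (sqrt pi) * (mint (g31 \<nu>) c t / (2 * pi))
           - of_real (sqrt pi) * besI \<nu> t * (mint (g40 \<nu>) d t / (2 * pi)))"
proof -
  have "\<nu> \<notin> \<int>" using \<nu>(2) by (auto simp: Ints_mult)
  note W = wronskian_IK[OF \<nu>(1) this t]
  have "dfun \<nu> t = dfun \<nu> t * (t * (besI \<nu> t * kfun (\<nu> + 1) t + besI (\<nu> + 1) t * kfun \<nu> t))"
    unfolding W by simp
  also have "\<dots> = kfun \<nu> t * coeffE \<nu> t - besI \<nu> t * coeffF \<nu> t"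
    unfolding coeffE_def coeffF_def by (simp add: algebra_simps power2_eq_square)
  finally show ?thesis
    unfolding coeffE_eq_mint[OF \<nu> t c] coeffF_eq_mint[OF \<nu> t d] by (simp add: algebra_simps)
qed

text \<open>The bound d < -nu - 1, stronger than in the generic case, lets one line serve all
  approximating indices up to nu + 1.\<close>

lemma dfun_eq_mint:
  fixes \<nu> :: real
  assumes \<nu>: "\<nu> > 0" and t: "Re t > 0" and c: "- 1/2 < c" "c < 0" and d: "d < - \<nu> - 1"
  shows "dfun \<nu> t = of_real \<nu> * (kfun \<nu> t / of_real (sqrt pi) * (mint (g31 \<nu>) c t / (2 * pi))
           - of_real (sqrt pi) * besI \<nu> t * (mint (g40 \<nu>) d t / (2 * pi)))" (is "_ = ?rhs \<nu>")
proof (cases "2 * \<nu> \<in> \<int>")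
  case False
  with assms show ?thesis by (intro dfun_eq_mint_generic) auto
next
  case True
  \<comment> \<open>Chosen so that 2 X n - 2 nu = 2 / (3 (n + 1)) lies strictly between 0 and 1; as
    2 nu is an integer here, 2 X n is not.\<close>
  define X where "X = (\<lambda>n. \<nu> + 1 / (3 * real (Suc n)))"
  have X: "\<nu> < X n" "X n \<le> \<nu> + 1" "2 * X n \<notin> \<int>" for n
  proof -
    show "\<nu> < X n" "X n \<le> \<nu> + 1" by (simp_all add: X_def field_simps)
    show "2 * X n \<notin> \<int>"
    proof
      assume "2 * X n \<in> \<int>"
      hence "2 * X n - 2 * \<nu> \<in> \<int>" using True by (rule Ints_diff)
      hence "2 / (3 * real (Suc n)) \<in> \<int>" by (simp add: X_def)
      then obtain m where m: "2 / (3 * real (Suc n)) = of_int m" by (auto elim: Ints_cases)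
      have "0 < 2 / (3 * real (Suc n))" "2 / (3 * real (Suc n)) < 1" by (simp_all add: field_simps)
      thus False unfolding m by simp
    qed
  qed
  have lim: "X \<longlonglongrightarrow> \<nu>"
  proof -
    have "(\<lambda>n. \<nu> + 1 / 3 * (1 / real (Suc n))) \<longlonglongrightarrow> \<nu> + 1 / 3 * 0"
      by (intro tendsto_intros LIMSEQ_Suc[OF lim_1_over_n])
    thus ?thesis by (simp add: X_def)
  qed
  hence limc: "(\<lambda>n. complex_of_real (X n)) \<longlonglongrightarrow> of_real \<nu>" by (rule tendsto_of_real)
  have pos: "X n > 0" for n using X(1)[of n] \<nu> by simp
  have dX: "d < - X n" for n using X(2)[of n] d by simp
  have m31: "(\<lambda>n. mint (g31 (X n)) c t) \<longlonglongrightarrow> mint (g31 \<nu>) c t"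
  proof (rule mint_tendsto_parameter[where N = "{\<nu>..\<nu> + 1}"])
    show "fam_type (\<lambda>\<nu> y. g31 \<nu> (Complex c y)) {\<nu>..\<nu> + 1} (- pi)"
      using \<nu> by (intro g31_fam_type[OF c order_refl])
  qed (use X less_imp_le[OF X(1)] t in \<open>auto intro!: g31_continuous g31_tendsto c \<nu> lim pos\<close>)
  have m40: "(\<lambda>n. mint (g40 (X n)) d t) \<longlonglongrightarrow> mint (g40 \<nu>) d t"
  proof (rule mint_tendsto_parameter[where N = "{\<nu>..\<nu> + 1}"])
    show "fam_type (\<lambda>\<nu> y. g40 \<nu> (Complex d y)) {\<nu>..\<nu> + 1} (- pi)"
      using \<nu> d by (intro g40_fam_type[OF _ order_refl]) auto
  qed (use X less_imp_le[OF X(1)] t d in \<open>auto intro!: g40_continuous g40_tendsto \<nu> lim pos dX\<close>)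
  have "(\<lambda>n. ?rhs (X n)) \<longlonglongrightarrow> ?rhs \<nu>"
    by (intro tendsto_intros limc m31 m40 kfun_dfun_tendsto(1)[OF limc t] besI_tendsto[OF limc]) auto
  moreover have "?rhs (X n) = dfun (X n) t" for n
    using dfun_eq_mint_generic[OF pos X(3) t c dX] by simp
  ultimately have "(\<lambda>n. dfun (X n) t) \<longlonglongrightarrow> ?rhs \<nu>" by (simp only:)
  with kfun_dfun_tendsto(2)[OF limc t] show ?thesis by (rule LIMSEQ_unique)
qed

theorem mainTheorem5:
  fixes \<nu> :: real and t :: complex
  assumes "\<nu> > 0" and "Re t > 0"
  shows "has_bochner_integral lborel
    (\<lambda>x::real. of_real x * exp (of_real (\<nu> * x) - t * of_real (cosh x)))
    (of_real \<nu> *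
      (macdonald_K (of_real \<nu>) t / of_real (sqrt pi) *
         meijer_G 3 1 [1/2, 1] [0, 0, of_real \<nu>, - of_real \<nu>] (t\<^sup>2)
       - of_real (sqrt pi) * bessel_I (of_real \<nu>) t *
         meijer_G 4 0 [1/2, 1] [0, 0, of_real \<nu>, - of_real \<nu>] (t\<^sup>2)))"
proof -
  \<comment> \<open>Sample abscissas: c between -1/2 and 0 separates the poles for the first Meijer
    function, and d lies below -nu - 1 as \<open>dfun_eq_mint\<close> asks.\<close>
  define c where "c = - (1/4 :: real)"
  define d where "d = - \<nu> - 2"
  have c: "- 1/2 < c" "c < 0" and d: "d < - \<nu> - 1" "d < - \<nu>" by (simp_all add: c_def d_def)
  have t0: "t \<noteq> 0" using assms by auto
  let ?p = "\<lambda>x::real. of_real x * exp (of_real \<nu> * of_real x) :: complex"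
  have eq: "of_real x * exp (of_real (\<nu> * x) - t * of_real (cosh x)) = ?p x * exp (- t * of_real (cosh x))" for x
    by (simp add: exp_diff exp_minus divide_inverse)
  have "integrable lborel (\<lambda>x. ?p x * exp (- t * of_real (cosh x)))"
    by (intro cint_integrable exp_growth_mult exp_growth_ident exp_growth_exp assms)
  hence "has_bochner_integral lborel (\<lambda>x. of_real x * exp (of_real (\<nu> * x) - t * of_real (cosh x))) (dfun (of_real \<nu>) t)"
    unfolding eq dfun_def cint_def by (rule has_bochner_integral_integrable)
  thus ?thesis
    unfolding dfun_eq_mint[OF assms c d(1)] meijer_G_31[OF c assms] meijer_G_40[OF d(2) assms]
      macdonald_K_eq_kfun[OF assms] bessel_I_eq[OF t0] .
qed

end
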